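(* The measures $E_1,\dots,E_6$ characterize truly tripartite entangled pure three-qubit states uniquely up to local unitaries and complex conjugation: if $|\psi\rangle$ and $|\chi\rangle$ are truly tripartite entangled three-qubit states, then $E_i(\psi)=E_i(\chi)$ for all $i=1,\dots,6$ if and only if $|\chi\rangle$ is LU-equivalent to $|\psi\rangle$ or to $|\psi^*\rangle$.
   Context: A pure three-qubit state is truly tripartite entangled if it is not a product state with respect to any of the bipartitions $1|23$, $2|13$, $3|12$. Two three-qubit states are LU-equivalent if they are related by $V_1\otimes V_2\otimes V_3$ with $V_i\in U(2)$. $|\psi^*\rangle$ is the complex conjugate of $|\psi\rangle$ in the computational basis. $\sigma_0=\mathbb{1}$, $\sigma_1,\sigma_2,\sigma_3$ are the Pauli matrices $\sigma_x,\sigma_y,\sigma_z$; $Y(\xi)=e^{i\xi\sigma_y}$, $Z(\xi)=e^{i\xi\sigma_z}$; $|+\rangle=(|0\rangle+|1\rangle)/\sqrt2$; $|\phi^+\rangle=(|00\rangle+|11\rangle)/\sqrt2$. Every truly tripartite entangled state is LU-equivalent to a state of the form $$\tfrac1{\sqrt2}\big(|0\rangle_1|\psi_s\rangle_{23}+|1\rangle_1 (U_2\otimes U_3)|\psi_s\rangle_{23}\big),\qquad(\dagger)$$ with $|\psi_s\rangle=a|00\rangle+b|11\rangle$, $a\ge b\ge0$, $a^2+b^2=1$, $U_2=Z(\alpha)Y(\beta)Z(\gamma)$, $U_3=Y(\beta')$, $\alpha,\gamma\in(-\pi/2,\pi/2]$, $\beta,\beta'\in[0,\pi/2]$. For each LU-equivalence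 class of truly tripartite entangled states, fix one decomposition $(\dagger)$ subject to the conventions: (i) the entanglement of $|\psi_s\rangle$ is maximal among all decompositions $(\dagger)$ of states in the class; (ii) if $|\psi_s\rangle$ is maximally entangled ($a=b$), then $\gamma=\beta'=0$, i.e. $U_2=Z(\alpha)Y(\beta)$ and $U_3=\mathbb{1}$. The measures of a state are computed from the decomposition fixed for its LU class. Entanglement of a bipartite pure state is the von Neumann entropy (base-2 logarithm) of either reduced state, and $E_{1|23}$ denotes the entanglement in the splitting $1|23$. For $i=2,3$ let $U_c^{1i}=|0\rangle\langle0|_1\otimes\mathbb{1}_i+|1\rangle\langle1|_1\otimes (U_i)_i$. - $E_1$ is the entanglement of $|\psi_s\rangle$. - $E_2=S\big(\tfrac12(|\phi^+\rangle\langle\phi^+|+(U_2\otimes\mathbb{1})|\phi^+\rangle\langle\phi^+|(U_2\otimes\mathbb{1})^\dagger)\big)$, with $S$ the von Neumann entropy; $E_3$ is the same with $U_3$ in place of $U_2$. - $E_4=E_{1|23}\big(\tfrac1{\sqrt2}(|0\rangle|\psi_s\rangle+|1\rangle(U_2\otimes\mathbb{1})|\psi_s\rangle)\big)$. - $E_5=E_{1|23}\big(a|+\rangle_1|00\rangle_{23}+b\,(U_2|+\rangle)_1|11\rangle_{23}\big)$. - $E_6(\psi)\in\{0,1\}$: with $\mathcal{S}_\psi=\{U_c^{13}U_c^{12}\sigma_n^{(2)}|+\rangle_1|\psi_s\rangle_{23}:n=0,1,2,3\}$ ($\sigma_n^{(2)}$ acting on qubit $2$), $E_6(\psi)=0$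 if $E_{1|23}(\psi)=\min_{\Phi\in\mathcal{S}_\psi}E_{1|23}(\Phi)$ and $E_6(\psi)=1$ otherwise. *)

theory Defs
  imports "HOL-Analysis.Analysis"
begin

text \<open>
  The computational basis of a qubit is indexed by the two-element numeral type \<^typ>\<open>2\<close>,
  whose elements are \<open>0\<close> and \<open>1\<close>; composite systems are indexed by product types, so that a
  three-qubit vector, indexed by \<open>2 \<times> (2 \<times> 2)\<close>, is literally a bipartite vector for the
  splitting \<open>1|23\<close>.
\<close>

type_synonym qubit = "complex ^ 2"
type_synonym two_qubit = "complex ^ (2 \<times> 2)"
type_synonym three_qubit = "complex ^ (2 \<times> 2 \<times> 2)"

definition ket :: "'n \<Rightarrow> complex ^ 'n::finite" where
  "ket i = axis i 1"

definition tensor_vec :: "complex ^ 'm \<Rightarrow> complex ^ 'n \<Rightarrow> complex ^ ('m::finite \<times> 'n::finite)"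
    (infixr "\<otimes>\<^sub>v" 75) where
  "u \<otimes>\<^sub>v v = (\<chi> p. u $ fst p * v $ snd p)"

definition tensor_mat ::
    "complex ^ 'm ^ 'm \<Rightarrow> complex ^ 'n ^ 'n \<Rightarrow>
      complex ^ ('m \<times> 'n) ^ ('m::finite \<times> 'n::finite)"
    (infixr "\<otimes>\<^sub>m" 75) where
  "A \<otimes>\<^sub>m B = (\<chi> p q. A $ fst p $ fst q * B $ snd p $ snd q)"

definition adjoint_mat :: "complex ^ 'n ^ 'n \<Rightarrow> complex ^ 'n ^ 'n" where
  "adjoint_mat A = (\<chi> i j. cnj (A $ j $ i))"

definition unitary_mat :: "complex ^ 'n ^ 'n \<Rightarrow> bool" where
  "unitary_mat V \<longleftrightarrow> adjoint_mat V ** V = mat 1 \<and> V ** adjoint_mat V = mat 1"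

text \<open>The rank-one operator \<open>|v\<rangle>\<langle>v|\<close>.\<close>

definition proj :: "complex ^ 'n \<Rightarrow> complex ^ 'n ^ 'n" where
  "proj v = (\<chi> i j. v $ i * cnj (v $ j))"

definition partial_trace_snd ::
    "complex ^ ('m \<times> 'n) ^ ('m::finite \<times> 'n::finite) \<Rightarrow> complex ^ 'm ^ 'm" where
  "partial_trace_snd \<rho> = (\<chi> i j. \<Sum>k\<in>UNIV. \<rho> $ (i, k) $ (j, k))"

text \<open>
  \<open>S(\<rho>) = - tr (\<rho> log\<^sub>2 \<rho>)\<close> for a density matrix \<open>\<rho>\<close>: the sum of \<open>- \<lambda> log\<^sub>2 \<lambda>\<close> over the eigenvalues,
  each counted with the (complex) dimension of its eigenspace. The convention \<open>0 log\<^sub>2 0 = 0\<close>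
  holds automatically.
\<close>

definition eigenspace :: "complex ^ 'n ^ 'n \<Rightarrow> real \<Rightarrow> (complex ^ 'n) set" where
  "eigenspace A l = {v. A *v v = complex_of_real l *s v}"

definition von_neumann_entropy :: "complex ^ 'n ^ 'n \<Rightarrow> real" where
  "von_neumann_entropy \<rho> =
     - (\<Sum>l | \<exists>v\<in>eigenspace \<rho> l. v \<noteq> 0. real (vec.dim (eigenspace \<rho> l)) * (l * log 2 l))"

text \<open>
  Entanglement of a bipartite pure state. On a \<^typ>\<open>three_qubit\<close> vector this is \<open>E\<^bsub>1|23\<^esub>\<close>.
\<close>

definition entanglement :: "complex ^ ('m::finite \<times> 'n::finite) \<Rightarrow> real" where
  "entanglement \<psi> = von_neumann_entropy (partial_trace_snd (proj \<psi>))"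

definition truly_tripartite_entangled :: "three_qubit \<Rightarrow> bool" where
  "truly_tripartite_entangled \<psi> \<longleftrightarrow> norm \<psi> = 1 \<and>
     \<not> (\<exists>(u :: qubit) (v :: two_qubit). \<forall>i j k. \<psi> $ (i, j, k) = u $ i * v $ (j, k)) \<and>
     \<not> (\<exists>(u :: qubit) (v :: two_qubit). \<forall>i j k. \<psi> $ (i, j, k) = u $ j * v $ (i, k)) \<and>
     \<not> (\<exists>(u :: qubit) (v :: two_qubit). \<forall>i j k. \<psi> $ (i, j, k) = u $ k * v $ (i, j))"

definition LU_equivalent :: "three_qubit \<Rightarrow> three_qubit \<Rightarrow> bool" where
  "LU_equivalent \<psi> \<phi> \<longleftrightarrow>
     (\<exists>(V1 :: complex^2^2) (V2 :: complex^2^2) (V3 :: complex^2^2).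
        unitary_mat V1 \<and> unitary_mat V2 \<and> unitary_mat V3 \<and> \<phi> = (V1 \<otimes>\<^sub>m V2 \<otimes>\<^sub>m V3) *v \<psi>)"

definition LU_class :: "three_qubit \<Rightarrow> three_qubit set" where
  "LU_class \<psi> = {\<phi>. LU_equivalent \<psi> \<phi>}"

definition conj_state :: "complex ^ 'n \<Rightarrow> complex ^ 'n" where
  "conj_state \<psi> = (\<chi> i. cnj (\<psi> $ i))"

definition mat2 :: "complex \<Rightarrow> complex \<Rightarrow> complex \<Rightarrow> complex \<Rightarrow> complex ^ 2 ^ 2" where
  "mat2 p q r s = (\<chi> i j. if i = 0 then (if j = 0 then p else q) else (if j = 0 then r else s))"

definition pauli :: "nat \<Rightarrow> complex ^ 2 ^ 2" where
  "pauli n =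
     (if n = 1 then mat2 0 1 1 0
      else if n = 2 then mat2 0 (- \<i>) \<i> 0
      else if n = 3 then mat2 1 0 0 (- 1)
      else mat 1)"

definition mat_exp :: "complex ^ 'n ^ 'n \<Rightarrow> complex ^ 'n ^ 'n" where
  "mat_exp A = (\<Sum>k. (1 / fact k) *\<^sub>R (((**) A) ^^ k) (mat 1))"

definition scale_mat :: "complex \<Rightarrow> complex ^ 'n ^ 'n \<Rightarrow> complex ^ 'n ^ 'n" where
  "scale_mat c A = (\<chi> i j. c * A $ i $ j)"

definition rotY :: "real \<Rightarrow> complex ^ 2 ^ 2" where
  "rotY \<xi> = mat_exp (scale_mat (\<i> * complex_of_real \<xi>) (pauli 2))"

definition rotZ :: "real \<Rightarrow> complex ^ 2 ^ 2" where
  "rotZ \<xi> = mat_exp (scale_mat (\<i> * complex_of_real \<xi>) (pauli 3))"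

definition ket_plus :: qubit where
  "ket_plus = (1 / sqrt 2) *\<^sub>R (ket 0 + ket 1)"

definition phi_plus :: two_qubit where
  "phi_plus = (1 / sqrt 2) *\<^sub>R (ket 0 \<otimes>\<^sub>v ket 0 + ket 1 \<otimes>\<^sub>v ket 1)"

record decomposition =
  coeff_a :: real
  coeff_b :: real
  ang_alpha :: real
  ang_beta :: real
  ang_gamma :: real
  ang_beta' :: real

definition seed :: "decomposition \<Rightarrow> two_qubit" where
  "seed d = coeff_a d *\<^sub>R (ket 0 \<otimes>\<^sub>v ket 0) + coeff_b d *\<^sub>R (ket 1 \<otimes>\<^sub>v ket 1)"

definition U2 :: "decomposition \<Rightarrow> complex ^ 2 ^ 2" where
  "U2 d = rotZ (ang_alpha d) ** rotY (ang_beta d) ** rotZ (ang_gamma d)"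

definition U3 :: "decomposition \<Rightarrow> complex ^ 2 ^ 2" where
  "U3 d = rotY (ang_beta' d)"

definition decomposed_state :: "decomposition \<Rightarrow> three_qubit" where
  "decomposed_state d =
     (1 / sqrt 2) *\<^sub>R (ket 0 \<otimes>\<^sub>v seed d + ket 1 \<otimes>\<^sub>v ((U2 d \<otimes>\<^sub>m U3 d) *v seed d))"

definition valid_parameters :: "decomposition \<Rightarrow> bool" where
  "valid_parameters d \<longleftrightarrow>
     coeff_a d \<ge> coeff_b d \<and> coeff_b d \<ge> 0 \<and> (coeff_a d)\<^sup>2 + (coeff_b d)\<^sup>2 = 1 \<and>
     ang_alpha d \<in> {- pi / 2 <.. pi / 2} \<and> ang_gamma d \<in> {- pi / 2 <.. pi / 2} \<and>
     ang_beta d \<in> {0 .. pi / 2} \<and> ang_beta' d \<in> {0 .. pi / 2}"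

definition is_decomposition :: "three_qubit set \<Rightarrow> decomposition \<Rightarrow> bool" where
  "is_decomposition C d \<longleftrightarrow> valid_parameters d \<and> decomposed_state d \<in> C"

text \<open>
  The conventions do not single out one decomposition per class, so the measures depend on an
  arbitrary choice: a function on LU classes that picks, for every class of truly tripartite
  entangled states, a decomposition obeying the conventions.
\<close>

definition admissible_decomposition :: "three_qubit set \<Rightarrow> decomposition \<Rightarrow> bool" where
  "admissible_decomposition C d \<longleftrightarrow> is_decomposition C d \<and>
     (\<forall>d'. is_decomposition C d' \<longrightarrow> entanglement (seed d') \<le> entanglement (seed d)) \<and>
     (coeff_a d = coeff_b d \<longrightarrow> ang_gamma d = 0 \<and> ang_beta' d = 0)"

definition admissible_choice :: "(three_qubit set \<Rightarrow> decomposition) \<Rightarrow> bool" where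
  "admissible_choice D \<longleftrightarrow>
     (\<forall>\<psi>. truly_tripartite_entangled \<psi> \<longrightarrow> admissible_decomposition (LU_class \<psi>) (D (LU_class \<psi>)))"

definition mixing_entropy :: "complex ^ 2 ^ 2 \<Rightarrow> real" where
  "mixing_entropy U = von_neumann_entropy ((1 / 2) *\<^sub>R
     (proj phi_plus + (U \<otimes>\<^sub>m mat 1) ** proj phi_plus ** adjoint_mat (U \<otimes>\<^sub>m mat 1)))"

definition Uc12 :: "decomposition \<Rightarrow> complex ^ (2 \<times> 2 \<times> 2) ^ (2 \<times> 2 \<times> 2)" where
  "Uc12 d = proj (ket 0) \<otimes>\<^sub>m mat 1 \<otimes>\<^sub>m mat 1 + proj (ket 1) \<otimes>\<^sub>m U2 d \<otimes>\<^sub>m mat 1"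

definition Uc13 :: "decomposition \<Rightarrow> complex ^ (2 \<times> 2 \<times> 2) ^ (2 \<times> 2 \<times> 2)" where
  "Uc13 d = proj (ket 0) \<otimes>\<^sub>m mat 1 \<otimes>\<^sub>m mat 1 + proj (ket 1) \<otimes>\<^sub>m mat 1 \<otimes>\<^sub>m U3 d"

definition S_set :: "decomposition \<Rightarrow> three_qubit set" where
  "S_set d = {Uc13 d *v (Uc12 d *v ((mat 1 \<otimes>\<^sub>m pauli n \<otimes>\<^sub>m mat 1) *v (ket_plus \<otimes>\<^sub>v seed d))) | n.
                n \<in> {0, 1, 2, 3}}"

definition E1 :: "(three_qubit set \<Rightarrow> decomposition) \<Rightarrow> three_qubit \<Rightarrow> real" where
  "E1 D \<psi> = entanglement (seed (D (LU_class \<psi>)))"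

definition E2 :: "(three_qubit set \<Rightarrow> decomposition) \<Rightarrow> three_qubit \<Rightarrow> real" where
  "E2 D \<psi> = mixing_entropy (U2 (D (LU_class \<psi>)))"

definition E3 :: "(three_qubit set \<Rightarrow> decomposition) \<Rightarrow> three_qubit \<Rightarrow> real" where
  "E3 D \<psi> = mixing_entropy (U3 (D (LU_class \<psi>)))"

definition E4 :: "(three_qubit set \<Rightarrow> decomposition) \<Rightarrow> three_qubit \<Rightarrow> real" where
  "E4 D \<psi> = (let d = D (LU_class \<psi>) in
     entanglement ((1 / sqrt 2) *\<^sub>R
       (ket (0 :: 2) \<otimes>\<^sub>v seed d + ket 1 \<otimes>\<^sub>v ((U2 d \<otimes>\<^sub>m mat 1) *v seed d))))"

definition E5 :: "(three_qubit set \<Rightarrow> decomposition) \<Rightarrow> three_qubit \<Rightarrow> real" where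
  "E5 D \<psi> = (let d = D (LU_class \<psi>) in
     entanglement (coeff_a d *\<^sub>R (ket_plus \<otimes>\<^sub>v ket (0 :: 2) \<otimes>\<^sub>v ket (0 :: 2)) +
       coeff_b d *\<^sub>R ((U2 d *v ket_plus) \<otimes>\<^sub>v ket 1 \<otimes>\<^sub>v ket 1)))"

definition E6 :: "(three_qubit set \<Rightarrow> decomposition) \<Rightarrow> three_qubit \<Rightarrow> real" where
  "E6 D \<psi> =
     (if entanglement \<psi> = Min (entanglement ` S_set (D (LU_class \<psi>))) then 0 else 1)"

end

theory Submission
  imports Defs
begin

text \<open>
  A three-qubit state is a pencil \<open>(M\<^sub>0, M\<^sub>1)\<close> of \<open>2 \<times> 2\<close> matrices, its slices along qubit 1. In a decomposition
  \<open>M\<^sub>0 = diag(a, b)\<close> and \<open>M\<^sub>1\<close> depends on \<open>cos \<beta>\<close>, \<open>cos \<beta>'\<close> and the phases \<open>x = exp(\<i>(\<alpha> + \<gamma>))\<close>,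
  \<open>y = exp(\<i>(\<alpha> - \<gamma>))\<close>. Entropies of rank-two density operators are strictly increasing functions of the
  determinant, so the measures amount to \<open>a b\<close>, \<open>cos \<beta>\<close>, \<open>cos \<beta>'\<close>, \<open>(Re x)\<^sup>2\<close>, \<open>(Im y)\<^sup>2\<close> and, through \<open>E\<^sub>6\<close>, the sign of
  \<open>Re x Re y\<close>. Exchanging the two slices replaces \<open>x\<close> by its conjugate, complex conjugation conjugates both
  phases, and \<open>(x, y)\<close>, \<open>(-x, -y)\<close> are equivalent; these moves account for all remaining ambiguity.

  Conversely the measures must not depend on the decomposition chosen for a class and for its conjugate.
  The decompositions of a state correspond to the bases of qubit 1 in which both slices have equal norm and
  equal determinant modulus. For generic parameters this forces the basis up to order and phases. In the
  remaining cases either the state is equivalent to its conjugate, so that both classes coincide, or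
  rotating the basis increases the entanglement of the seed, contrary to convention (i).
\<close>

subsection \<open>Matrices, local unitaries and pencils\<close>


text \<open>A choice \<open>D\<close> may pick unrelated parameters for a class and for its
  conjugate, so equality of the measures is a uniqueness statement rather than a computation. Let
  \<open>F\<close> be the inner product of the slices and let \<open>a b (z^2 + w^2) + t z w\<close>
  be the determinant of the slice combined with coefficients \<open>(z, w)\<close>. A new basis of
  qubit 1 with first row \<open>(z, w)\<close> keeps the norms equal iff
  \<open>Re (z * cnj w * F) = 0\<close>, and the determinant moduli equal iff
  \<open>a b * Re t * Re (z * cnj w) = 0\<close>. For \<open>b > 0\<close> these conditions are
  independent unless \<open>Im F = 0\<close> or \<open>Re t = 0\<close>. In the degenerate situation
  further bases remain, and a suitable one has squared determinant at least
  \<open>(a b)^2 + (Im t / 2)^2\<close>. Hence the seed was not maximal unless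
  \<open>Im t = 0\<close>. As \<open>Im t\<close> is a multiple of
  \<open>(a^2 - b^2) s s' Im y\<close>, its vanishing is also what lets \<open>y\<close> be
  conjugated by a local unitary; for \<open>a = b\<close> convention (ii) gives
  \<open>s' = 0\<close>. The two ways out of non-uniqueness are thus complementary.\<close>

lemma UNIV_two: "(UNIV :: 2 set) = {0, 1}"
  using UNIV_2 by auto

lemma two_cases: "(i :: 2) = 0 \<or> i = 1"
  using UNIV_two by auto

lemma forall_two: "(\<forall>i :: 2. P i) \<longleftrightarrow> P 0 \<and> P 1"
  by (metis two_cases)

lemma sum_two: "(\<Sum>i\<in>(UNIV :: 2 set). f i) = f 0 + f 1"
  by (simp add: UNIV_two)

lemma sum_UNIV_prod:
  "(\<Sum>p\<in>(UNIV :: ('a::finite \<times> 'b::finite) set). f p) = (\<Sum>i\<in>UNIV. \<Sum>j\<in>UNIV. f (i, j))"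
  by (simp add: UNIV_Times_UNIV[symmetric] sum.cartesian_product del: UNIV_Times_UNIV)

lemma mat2_nth [simp]:
  "mat2 p q r s $ 0 $ 0 = p" "mat2 p q r s $ 0 $ 1 = q"
  "mat2 p q r s $ 1 $ 0 = r" "mat2 p q r s $ 1 $ 1 = s"
  by (simp_all add: mat2_def)

lemma mat2_eq_iff: "(M :: complex^2^2) = N \<longleftrightarrow>
   M $ 0 $ 0 = N $ 0 $ 0 \<and> M $ 0 $ 1 = N $ 0 $ 1 \<and> M $ 1 $ 0 = N $ 1 $ 0 \<and> M $ 1 $ 1 = N $ 1 $ 1"
  by (auto simp add: vec_eq_iff forall_two)

lemma mat2_one: "mat 1 = mat2 1 0 0 1"
  by (simp add: mat2_eq_iff mat_def)

lemma mat2_mult: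
  "mat2 a b c d ** mat2 e f g h = mat2 (a*e + b*g) (a*f + b*h) (c*e + d*g) (c*f + d*h)"
  by (simp add: mat2_eq_iff matrix_matrix_mult_def sum_two)

lemma mult_nth_two: "((A :: complex^2^2) ** B) $ i $ j = A $ i $ 0 * B $ 0 $ j + A $ i $ 1 * B $ 1 $ j"
  by (simp add: matrix_matrix_mult_def sum_two)

lemma adjoint_nth [simp]: "adjoint_mat A $ i $ j = cnj (A $ j $ i)"
  by (simp add: adjoint_mat_def)

lemma scale_nth [simp]: "scale_mat c A $ i $ j = c * A $ i $ j"
  by (simp add: scale_mat_def)

lemma transpose_nth [simp]: "transpose A $ i $ j = A $ j $ i"
  by (simp add: transpose_def)

lemma adjoint_mult: "adjoint_mat (A ** B) = adjoint_mat B ** adjoint_mat A"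
  by (simp add: vec_eq_iff matrix_matrix_mult_def mult.commute)

lemma adjoint_adjoint [simp]: "adjoint_mat (adjoint_mat A) = A"
  by (simp add: vec_eq_iff)

lemma adjoint_one [simp]: "adjoint_mat (mat 1) = mat 1"
  by (simp add: vec_eq_iff mat_def)

lemma unitary_one [simp]: "unitary_mat (mat 1)"
  by (simp add: unitary_mat_def)

lemma unitary_adjoint: "unitary_mat V \<Longrightarrow> unitary_mat (adjoint_mat V)"
  by (simp add: unitary_mat_def)

lemma unitary_mult:
  assumes "unitary_mat V" "unitary_mat W" shows "unitary_mat (V ** W)"
proof -
  have "adjoint_mat W ** adjoint_mat V ** (V ** W) = adjoint_mat W ** (adjoint_mat V ** V) ** W"
    by (simp add: matrix_mul_assoc)
  moreover have "V ** W ** (adjoint_mat W ** adjoint_mat V) = V ** (W ** adjoint_mat W) ** adjoint_mat V"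
    by (simp add: matrix_mul_assoc)
  ultimately show ?thesis using assms by (simp add: unitary_mat_def adjoint_mult)
qed

lemma unitaryI: "adjoint_mat (V :: complex^'n^'n) ** V = mat 1 \<Longrightarrow> unitary_mat V"
  by (simp add: unitary_mat_def matrix_left_right_inverse)

definition conj_mat :: "complex^'n^'n \<Rightarrow> complex^'n^'n" where
  "conj_mat A = (\<chi> i j. cnj (A $ i $ j))"

lemma conj_mat_nth [simp]: "conj_mat A $ i $ j = cnj (A $ i $ j)"
  by (simp add: conj_mat_def)

lemma unitary_conj: "unitary_mat V \<Longrightarrow> unitary_mat (conj_mat V)"
proof (rule unitaryI)
  assume "unitary_mat V"
  then have "adjoint_mat V ** V = mat 1" by (simp add: unitary_mat_def)
  then have "conj_mat (adjoint_mat V ** V) = mat 1" by (simp add: vec_eq_iff mat_def)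
  moreover have "conj_mat (adjoint_mat V ** V) = adjoint_mat (conj_mat V) ** conj_mat V"
    by (simp add: vec_eq_iff matrix_matrix_mult_def)
  ultimately show "adjoint_mat (conj_mat V) ** conj_mat V = mat 1" by simp
qed

lemma unitary_transpose: "unitary_mat V \<Longrightarrow> unitary_mat (transpose V)"
proof -
  assume "unitary_mat V"
  moreover have "transpose V = conj_mat (adjoint_mat V)" by (simp add: vec_eq_iff)
  ultimately show ?thesis by (metis unitary_adjoint unitary_conj)
qed

lemma tensor_mat_mult: "(A \<otimes>\<^sub>m B) ** (C \<otimes>\<^sub>m E) = (A ** C) \<otimes>\<^sub>m (B ** E)"
  by (simp add: vec_eq_iff tensor_mat_def matrix_matrix_mult_def sum_UNIV_prod sum_product mult_ac)

lemma tensor_mat_one [simp]: "mat 1 \<otimes>\<^sub>m mat 1 = mat 1"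
  by (simp add: vec_eq_iff tensor_mat_def mat_def)

section \<open>Local unitary equivalence\<close>

lemma LU_refl: "LU_equivalent \<psi> \<psi>"
  unfolding LU_equivalent_def
  by (intro exI[of _ "mat 1"]) simp

lemma LU_trans:
  assumes "LU_equivalent \<psi> \<phi>" "LU_equivalent \<phi> \<eta>" shows "LU_equivalent \<psi> \<eta>"
proof -
  obtain A B C where u: "unitary_mat A" "unitary_mat B" "unitary_mat C"
    and p: "\<phi> = (A \<otimes>\<^sub>m B \<otimes>\<^sub>m C) *v \<psi>"
    using assms(1) unfolding LU_equivalent_def by blast
  obtain A' B' C' where u': "unitary_mat A'" "unitary_mat B'" "unitary_mat C'"
    and p': "\<eta> = (A' \<otimes>\<^sub>m B' \<otimes>\<^sub>m C') *v \<phi>"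
    using assms(2) unfolding LU_equivalent_def by blast
  have "\<eta> = ((A' ** A) \<otimes>\<^sub>m (B' ** B) \<otimes>\<^sub>m (C' ** C)) *v \<psi>"
    unfolding p p' by (simp add: matrix_vector_mul_assoc tensor_mat_mult)
  with u u' show ?thesis unfolding LU_equivalent_def
    by (metis unitary_mult)
qed

lemma LU_sym:
  assumes "LU_equivalent \<psi> \<phi>" shows "LU_equivalent \<phi> \<psi>"
proof -
  obtain A B C where u: "unitary_mat A" "unitary_mat B" "unitary_mat C"
    and p: "\<phi> = (A \<otimes>\<^sub>m B \<otimes>\<^sub>m C) *v \<psi>"
    using assms unfolding LU_equivalent_def by blast
  have "(adjoint_mat A \<otimes>\<^sub>m adjoint_mat B \<otimes>\<^sub>m adjoint_mat C) *v \<phi> = \<psi>"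
    using u unfolding p by (simp add: matrix_vector_mul_assoc tensor_mat_mult unitary_mat_def)
  with u show ?thesis unfolding LU_equivalent_def
    by (metis unitary_adjoint)
qed

lemma LU_class_eq: "LU_equivalent \<psi> \<phi> \<Longrightarrow> LU_class \<psi> = LU_class \<phi>"
  unfolding LU_class_def using LU_sym LU_trans by blast

lemma matrix_vector_mult_scaleR_right: "(A :: complex^'n^'m) *v (r *\<^sub>R x) = r *\<^sub>R (A *v x)"
  by (simp add: vec_eq_iff matrix_vector_mult_def scaleR_sum_right)

lemma LU_scaleR: "LU_equivalent \<psi> \<phi> \<Longrightarrow> LU_equivalent (r *\<^sub>R \<psi>) (r *\<^sub>R \<phi>)"
  unfolding LU_equivalent_def by (auto simp: matrix_vector_mult_scaleR_right)

lemma LU_scaleR_iff: "r \<noteq> 0 \<Longrightarrow> LU_equivalent (r *\<^sub>R \<psi>) (r *\<^sub>R \<phi>) \<longleftrightarrow> LU_equivalent \<psi> \<phi>"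
  using LU_scaleR[of "r *\<^sub>R \<psi>" "r *\<^sub>R \<phi>" "inverse r"] LU_scaleR[of \<psi> \<phi> r] by auto

lemma conj_state_mult: "conj_state (A *v x) = conj_mat A *v conj_state x"
  by (simp add: vec_eq_iff conj_state_def matrix_vector_mult_def)

lemma conj_mat_tensor: "conj_mat (A \<otimes>\<^sub>m B) = conj_mat A \<otimes>\<^sub>m conj_mat B"
  by (simp add: vec_eq_iff tensor_mat_def)

lemma LU_conj:
  assumes "LU_equivalent \<psi> \<phi>" shows "LU_equivalent (conj_state \<psi>) (conj_state \<phi>)"
proof -
  obtain A B C where u: "unitary_mat A" "unitary_mat B" "unitary_mat C"
    and p: "\<phi> = (A \<otimes>\<^sub>m B \<otimes>\<^sub>m C) *v \<psi>"
    using assms unfolding LU_equivalent_def by blast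
  have "conj_state \<phi> = (conj_mat A \<otimes>\<^sub>m conj_mat B \<otimes>\<^sub>m conj_mat C) *v conj_state \<psi>"
    unfolding p by (simp add: conj_state_mult conj_mat_tensor)
  with u show ?thesis unfolding LU_equivalent_def using unitary_conj by blast
qed

section \<open>Pencils and their invariants\<close>

definition pencil :: "complex^2^2 \<Rightarrow> complex^2^2 \<Rightarrow> three_qubit" where
  "pencil M N = (\<chi> p. (if fst p = 0 then M else N) $ fst (snd p) $ snd (snd p))"

lemma pencil_nth [simp]:
  "pencil M N $ (0, j, k) = M $ j $ k" "pencil M N $ (1, j, k) = N $ j $ k"
  by (simp_all add: pencil_def)

lemma three_qubit_eq_iff:
  "(\<psi> :: three_qubit) = \<phi> \<longleftrightarrow> (\<forall>j k. \<psi> $ (0, j, k) = \<phi> $ (0, j, k) \<and> \<psi> $ (1, j, k) = \<phi> $ (1, j, k))"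
proof
  assume eq: "\<forall>j k. \<psi> $ (0, j, k) = \<phi> $ (0, j, k) \<and> \<psi> $ (1, j, k) = \<phi> $ (1, j, k)"
  have "\<psi> $ (i, j, k) = \<phi> $ (i, j, k)" for i j k
    using two_cases[of i] eq by auto
  then show "\<psi> = \<phi>" by (simp add: vec_eq_iff)
qed simp

lemma pencil_eq_iff: "pencil M N = pencil M' N' \<longleftrightarrow> M = M' \<and> N = N'"
  by (simp add: three_qubit_eq_iff) (simp add: vec_eq_iff, blast)

lemma pencil_exhaust: obtains M N where "\<psi> = pencil M N"
proof
  show "\<psi> = pencil (\<chi> j k. \<psi> $ (0, j, k)) (\<chi> j k. \<psi> $ (1, j, k))"
    by (simp add: three_qubit_eq_iff)
qed

text \<open>Qubit 2 indexes the rows of a slice and qubit 3 its columns, so their unitaries act by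
  \<open>A ** M ** transpose B\<close>; the unitary on qubit 1 mixes the two slices
  linearly.\<close>

lemma local_unitary_pencil:
  "(V \<otimes>\<^sub>m A \<otimes>\<^sub>m B) *v pencil M N =
     pencil (scale_mat (V $ 0 $ 0) (A ** M ** transpose B) + scale_mat (V $ 0 $ 1) (A ** N ** transpose B))
            (scale_mat (V $ 1 $ 0) (A ** M ** transpose B) + scale_mat (V $ 1 $ 1) (A ** N ** transpose B))"
  by (simp add: three_qubit_eq_iff matrix_vector_mult_def tensor_mat_def sum_UNIV_prod
     matrix_matrix_mult_def sum_two algebra_simps)

lemma LU_pencilI:
  fixes V A B :: "complex^2^2"
  assumes "unitary_mat V" "unitary_mat A" "unitary_mat B"
    "M' = scale_mat (V $ 0 $ 0) (A ** M ** transpose B) + scale_mat (V $ 0 $ 1) (A ** N ** transpose B)"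
    "N' = scale_mat (V $ 1 $ 0) (A ** M ** transpose B) + scale_mat (V $ 1 $ 1) (A ** N ** transpose B)"
  shows "LU_equivalent (pencil M N) (pencil M' N')"
  unfolding LU_equivalent_def
  by (rule exI[of _ V], rule exI[of _ A], rule exI[of _ B]) (simp only: assms local_unitary_pencil simp_thms)

text \<open>Its modulus is unchanged by unitaries on qubits 2 and 3 and, for a slice of norm 1,
  fixes the singular values.\<close>

definition det2 :: "complex^2^2 \<Rightarrow> complex" where
  "det2 M = M $ 0 $ 0 * M $ 1 $ 1 - M $ 0 $ 1 * M $ 1 $ 0"

lemma det2_mult: "det2 (A ** B) = det2 A * det2 B"
  by (simp add: det2_def mult_nth_two algebra_simps)

lemma det2_transpose [simp]: "det2 (transpose A) = det2 A"
  by (simp add: det2_def mult.commute)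

lemma det2_scale: "det2 (scale_mat c A) = c^2 * det2 A"
  by (simp add: det2_def power2_eq_square algebra_simps)

lemma unitary_det2:
  assumes "unitary_mat V" shows "cmod (det2 V) = 1"
proof -
  have "det2 (adjoint_mat V ** V) = 1"
    using assms by (simp add: unitary_mat_def det2_def mat_def)
  moreover have "det2 (adjoint_mat V) = cnj (det2 V)" by (simp add: det2_def mult.commute)
  ultimately have "cnj (det2 V) * det2 V = 1" by (simp add: det2_mult)
  then have "complex_of_real (cmod (det2 V) ^ 2) = 1"
    by (metis complex_norm_square mult.commute)
  then have "cmod (det2 V) ^ 2 = 1" using of_real_eq_1_iff by blast
  then show ?thesis by (simp add: power2_eq_1_iff) (smt (verit) norm_ge_zero)
qed

text \<open>The Hilbert-Schmidt inner product. The Gram matrix of the two slices is the reduced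
  density operator of qubit 1, hence its role in every entropy across \<open>1|23\<close>.\<close>

definition frob :: "complex^2^2 \<Rightarrow> complex^2^2 \<Rightarrow> complex" where
  "frob M N = (\<Sum>j\<in>UNIV. \<Sum>k\<in>UNIV. M $ j $ k * cnj (N $ j $ k))"

lemma frob_trace: "frob M N = trace (M ** adjoint_mat N)"
  by (simp add: frob_def trace_def matrix_matrix_mult_def)

lemma frob_unitary:
  assumes "unitary_mat A" "unitary_mat B"
  shows "frob (A ** M ** transpose B) (A ** N ** transpose B) = frob M N"
proof -
  have B: "transpose B ** adjoint_mat (transpose B) = mat 1"
    using unitary_transpose[OF assms(2)] by (simp add: unitary_mat_def)
  have A: "adjoint_mat A ** A = mat 1" using assms(1) by (simp add: unitary_mat_def)
  have "(A ** M ** transpose B) ** adjoint_mat (A ** N ** transpose B)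
     = A ** (M ** (transpose B ** adjoint_mat (transpose B)) ** adjoint_mat N ** adjoint_mat A)"
    by (simp add: adjoint_mult matrix_mul_assoc)
  also have "\<dots> = A ** ((M ** adjoint_mat N) ** adjoint_mat A)" by (simp add: B matrix_mul_assoc)
  finally have "frob (A ** M ** transpose B) (A ** N ** transpose B)
      = trace (A ** ((M ** adjoint_mat N) ** adjoint_mat A))" by (simp add: frob_trace)
  also have "\<dots> = trace (((M ** adjoint_mat N) ** adjoint_mat A) ** A)" by (rule trace_mul_sym)
  also have "\<dots> = trace ((M ** adjoint_mat N) ** (adjoint_mat A ** A))" by (simp add: matrix_mul_assoc)
  finally show ?thesis by (simp add: A frob_trace)
qed


subsection \<open>Parametrised pencils\<close>

lemma unitary_mat2_iff: "unitary_mat (mat2 p q r s) \<longleftrightarrow>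
    p * cnj p + r * cnj r = 1 \<and> q * cnj q + s * cnj s = 1 \<and> q * cnj p + s * cnj r = 0"
    (is "?L \<longleftrightarrow> ?R")
proof -
  have adj: "adjoint_mat (mat2 p q r s) = mat2 (cnj p) (cnj r) (cnj q) (cnj s)"
    by (simp add: mat2_eq_iff)
  have "?L \<longleftrightarrow> adjoint_mat (mat2 p q r s) ** mat2 p q r s = mat 1"
    using unitaryI by (auto simp: unitary_mat_def)
  also have "\<dots> \<longleftrightarrow> cnj p * p + cnj r * r = 1 \<and> cnj p * q + cnj r * s = 0 \<and>
      cnj q * p + cnj s * r = 0 \<and> cnj q * q + cnj s * s = 1"
    by (simp add: adj mat2_mult) (simp add: mat2_one mat2_eq_iff)
  also have "\<dots> \<longleftrightarrow> ?R"
  proof -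
    have 1: "cnj q * p + cnj s * r = cnj (q * cnj p + s * cnj r)" by simp
    have 2: "cnj p * q + cnj r * s = q * cnj p + s * cnj r"
      "cnj p * p + cnj r * r = p * cnj p + r * cnj r" "cnj q * q + cnj s * s = q * cnj q + s * cnj s"
      by (simp_all only: mult.commute)
    show ?thesis unfolding 1 2 by (metis complex_cnj_zero)
  qed
  finally show ?thesis .
qed

section \<open>Closed forms of the rotations\<close>

lemma mat_exp_eqI:
  assumes "\<And>i j. (\<lambda>k. ((((**) A) ^^ k) (mat 1)) $ i $ j / fact k) sums (B $ i $ j)"
  shows "mat_exp A = B"
proof -
  have "(\<lambda>k. (1 / fact k) *\<^sub>R (((**) A) ^^ k) (mat 1)) sums B"
    unfolding sums_def
  proof (intro vec_tendstoI)
    fix i j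
    have "(\<lambda>n. \<Sum>k<n. ((((**) A) ^^ k) (mat 1)) $ i $ j / fact k) \<longlonglongrightarrow> B $ i $ j"
      using assms[of i j] by (simp add: sums_def)
    then show "(\<lambda>n. (\<Sum>k<n. (1 / fact k) *\<^sub>R (((**) A) ^^ k) (mat 1)) $ i $ j) \<longlonglongrightarrow> B $ i $ j"
      by (simp add: scaleR_conv_of_real[where ?'a = complex])
  qed
  then show ?thesis unfolding mat_exp_def by (rule sums_unique[symmetric])
qed

lemma cis_sums: "(\<lambda>k. (\<i> * complex_of_real \<xi>) ^ k / fact k) sums cis \<xi>"
  using exp_converges[of "\<i> * complex_of_real \<xi>"]
  by (simp add: scaleR_conv_of_real cis_conv_exp field_simps)

lemma divide_fact_complex:
  "Re (z / fact k) = Re z / fact k" "Im (z / fact k) = Im z / fact k"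
  by (metis Re_divide_of_real of_real_fact) (metis Im_divide_of_real of_real_fact)

lemma rotZ_eq: "rotZ \<xi> = mat2 (cis \<xi>) 0 0 (cis (- \<xi>))"
  unfolding rotZ_def
proof (rule mat_exp_eqI)
  let ?A = "scale_mat (\<i> * complex_of_real \<xi>) (pauli 3)"
  let ?z = "\<i> * complex_of_real \<xi>"
  have A: "?A = mat2 ?z 0 0 (- ?z)" by (simp add: mat2_eq_iff pauli_def)
  have pw: "(((**) ?A) ^^ k) (mat 1) = mat2 (?z ^ k) 0 0 ((- ?z) ^ k)" for k
    by (induction k) (simp_all add: mat2_one, simp add: A mat2_mult)
  have m: "(- ?z) ^ k = (\<i> * complex_of_real (- \<xi>)) ^ k" for k by simp
  have 1: "(\<lambda>k. mat2 (?z ^ k) 0 0 ((- ?z) ^ k) $ 0 $ 0 / fact k) sums (mat2 (cis \<xi>) 0 0 (cis (- \<xi>)) $ 0 $ 0)"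
    using cis_sums[of \<xi>] by simp
  have 2: "(\<lambda>k. mat2 (?z ^ k) 0 0 ((- ?z) ^ k) $ 1 $ 1 / fact k) sums (mat2 (cis \<xi>) 0 0 (cis (- \<xi>)) $ 1 $ 1)"
    using cis_sums[of "- \<xi>"] unfolding m by simp
  fix i j
  show "(\<lambda>k. ((((**) ?A) ^^ k) (mat 1)) $ i $ j / fact k) sums (mat2 (cis \<xi>) 0 0 (cis (- \<xi>)) $ i $ j)"
    unfolding pw using two_cases[of i] two_cases[of j] 1 2 by auto
qed

lemma rotY_eq: "rotY \<xi> = mat2 (cos \<xi>) (sin \<xi>) (- sin \<xi>) (cos \<xi>)"
  unfolding rotY_def
proof (rule mat_exp_eqI)
  let ?A = "scale_mat (\<i> * complex_of_real \<xi>) (pauli 2)"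
  let ?z = "\<i> * complex_of_real \<xi>"
  have A: "?A = mat2 0 \<xi> (- \<xi>) 0" by (simp add: mat2_eq_iff pauli_def complex_eq_iff)
  \<comment> \<open>\<open>?A\<close> is the real 2x2 matrix representing the complex number
    \<open>?z\<close>, so its powers represent the powers of \<open>?z\<close>.\<close>
  have pw: "(((**) ?A) ^^ k) (mat 1) = mat2 (Re (?z ^ k)) (Im (?z ^ k)) (- Im (?z ^ k)) (Re (?z ^ k))" for k
    by (induction k) (simp_all add: mat2_one, simp add: A mat2_mult)
  have R: "(\<lambda>k. Re (?z ^ k) / fact k) sums cos \<xi>"
    using sums_Re[OF cis_sums[of \<xi>]] by (simp add: divide_fact_complex)
  have I: "(\<lambda>k. Im (?z ^ k) / fact k) sums sin \<xi>"
    using sums_Im[OF cis_sums[of \<xi>]] by (simp add: divide_fact_complex)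
  have R': "(\<lambda>k. complex_of_real (Re (?z ^ k)) / fact k) sums complex_of_real (cos \<xi>)"
    using sums_of_real[OF R, where ?'a = complex] by simp
  have I': "(\<lambda>k. complex_of_real (Im (?z ^ k)) / fact k) sums complex_of_real (sin \<xi>)"
    using sums_of_real[OF I, where ?'a = complex] by simp
  have I'': "(\<lambda>k. - complex_of_real (Im (?z ^ k)) / fact k) sums - complex_of_real (sin \<xi>)"
    using sums_minus[OF I'] by simp
  fix i j
  show "(\<lambda>k. ((((**) ?A) ^^ k) (mat 1)) $ i $ j / fact k) sums
     (mat2 (cos \<xi>) (sin \<xi>) (- sin \<xi>) (cos \<xi>) $ i $ j)"
    unfolding pw using two_cases[of i] two_cases[of j] R' I' I'' by auto
qed

text \<open>
  With \<open>c = cos \<beta>\<close>, \<open>s = sin \<beta>\<close>, \<open>x = exp(\<i>(\<alpha> + \<gamma>))\<close>, \<open>y = exp(\<i>(\<alpha> - \<gamma>))\<close> this is \<open>U\<^sub>2\<close>; primed letters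
  refer to \<open>U\<^sub>3\<close>.
\<close>

definition euler_mat :: "real \<Rightarrow> real \<Rightarrow> complex \<Rightarrow> complex \<Rightarrow> complex^2^2" where
  "euler_mat c s x y = mat2 (c * x) (s * y) (- s * cnj y) (c * cnj x)"

text \<open>The product of \<open>U\<^sub>2\<close>, diag(a, b) and the transpose of
  \<open>U\<^sub>3\<close>, expanded because the uniqueness argument compares the entries one at a
  time.\<close>

definition param_slice :: "real \<Rightarrow> real \<Rightarrow> real \<Rightarrow> real \<Rightarrow> real \<Rightarrow> real \<Rightarrow> complex \<Rightarrow> complex \<Rightarrow> complex^2^2" where
  "param_slice a b c s c' s' x y = mat2
     (a * c * c' * x + b * s * s' * y) (- a * c * s' * x + b * s * c' * y)
     (- a * s * c' * cnj y + b * c * s' * cnj x) (a * s * s' * cnj y + b * c * c' * cnj x)"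

lemma param_slice_eq: "param_slice a b c s c' s' x y = euler_mat c s x y ** mat2 a 0 0 b ** transpose (euler_mat c' s' 1 1)"
  by (simp add: param_slice_def euler_mat_def mat2_eq_iff mult_nth_two algebra_simps)

definition param_pencil :: "real \<Rightarrow> real \<Rightarrow> real \<Rightarrow> real \<Rightarrow> real \<Rightarrow> real \<Rightarrow> complex \<Rightarrow> complex \<Rightarrow> three_qubit" where
  "param_pencil a b c s c' s' x y = pencil (mat2 a 0 0 b) (param_slice a b c s c' s' x y)"

lemma euler_mat_unitary:
  assumes "c\<^sup>2 + s\<^sup>2 = 1" "cmod x = 1" "cmod y = 1"
  shows "unitary_mat (euler_mat c s x y)"
proof -
  have x: "x * cnj x = 1" "y * cnj y = 1"
    using assms by (simp_all add: complex_norm_square[symmetric])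
  have "complex_of_real (c\<^sup>2 + s\<^sup>2) = 1" using assms by simp
  then have cs: "complex_of_real c ^ 2 + complex_of_real s ^ 2 = 1" by simp
  have "c * x * (c * cnj x) + s * cnj y * (s * y) = complex_of_real c ^ 2 * (x * cnj x) + complex_of_real s ^ 2 * (y * cnj y)"
       "s * y * (s * cnj y) + c * cnj x * (c * x) = complex_of_real c ^ 2 * (x * cnj x) + complex_of_real s ^ 2 * (y * cnj y)"
    by (simp_all add: power2_eq_square algebra_simps)
  then show ?thesis using x cs by (simp add: euler_mat_def unitary_mat2_iff)
qed

lemma U2_eq: "U2 d = euler_mat (cos (ang_beta d)) (sin (ang_beta d))
    (cis (ang_alpha d + ang_gamma d)) (cis (ang_alpha d - ang_gamma d))"
  by (simp add: U2_def rotZ_eq rotY_eq euler_mat_def mat2_mult mat2_eq_iff cis_mult[symmetric] cis_cnj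
      diff_conv_add_uminus algebra_simps del: add_uminus_conv_diff)

lemma U3_eq: "U3 d = euler_mat (cos (ang_beta' d)) (sin (ang_beta' d)) 1 1"
  by (simp add: U3_def rotY_eq euler_mat_def)

lemma seed_nth [simp]:
  "seed d $ (0, 0) = coeff_a d" "seed d $ (0, 1) = 0" "seed d $ (1, 0) = 0" "seed d $ (1, 1) = coeff_b d"
  by (simp_all add: seed_def tensor_vec_def ket_def axis_def scaleR_conv_of_real[where ?'a = complex])

lemma tensor_mat_mult_nth:
  "((A \<otimes>\<^sub>m B) *v v) $ (i, j) = (\<Sum>k\<in>UNIV. \<Sum>l\<in>UNIV. A $ i $ k * B $ j $ l * v $ (k, l))"
  by (simp add: matrix_vector_mult_def tensor_mat_def sum_UNIV_prod)

lemma ket_tensor_pencil: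
  "ket (0 :: 2) \<otimes>\<^sub>v u + ket 1 \<otimes>\<^sub>v v = pencil (\<chi> j k. u $ (j, k)) (\<chi> j k. v $ (j, k))"
  by (simp add: three_qubit_eq_iff tensor_vec_def ket_def axis_def)

lemma tensor_seed:
  "(\<chi> j k. ((A \<otimes>\<^sub>m B) *v seed d) $ (j, k)) = A ** mat2 (coeff_a d) 0 0 (coeff_b d) ** transpose B"
  by (simp add: vec_eq_iff tensor_mat_mult_nth mult_nth_two sum_two algebra_simps)

lemma seed_mat: "(\<chi> j k. seed d $ (j, k)) = mat2 (coeff_a d) 0 0 (coeff_b d)"
  by (simp add: mat2_eq_iff)

definition decomposition_pencil :: "decomposition \<Rightarrow> three_qubit" where
  "decomposition_pencil d = param_pencil (coeff_a d) (coeff_b d) (cos (ang_beta d)) (sin (ang_beta d))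
     (cos (ang_beta' d)) (sin (ang_beta' d)) (cis (ang_alpha d + ang_gamma d)) (cis (ang_alpha d - ang_gamma d))"

lemma decomposed_state_eq: "decomposed_state d = (1 / sqrt 2) *\<^sub>R decomposition_pencil d"
  by (simp only: decomposed_state_def decomposition_pencil_def param_pencil_def ket_tensor_pencil tensor_seed seed_mat U2_eq U3_eq param_slice_eq)

lemma LU_decomposed_iff: "LU_equivalent (decomposed_state d) (decomposed_state e) \<longleftrightarrow> LU_equivalent (decomposition_pencil d) (decomposition_pencil e)"
  by (simp add: decomposed_state_eq LU_scaleR_iff)

lemma conj_state_scaleR: "conj_state (r *\<^sub>R \<psi>) = r *\<^sub>R conj_state \<psi>"
  by (simp add: vec_eq_iff conj_state_def)

lemma conj_state_param_pencil: "conj_state (param_pencil a b c s c' s' x y) = param_pencil a b c s c' s' (cnj x) (cnj y)"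
  by (simp add: three_qubit_eq_iff forall_two conj_state_def param_pencil_def param_slice_def)

section \<open>Moves between equivalent parameters\<close>

lemma param_pencil_neg: "LU_equivalent (param_pencil a b c s c' s' x y) (param_pencil a b c s c' s' (- x) (- y))"
  unfolding param_pencil_def
  by (rule LU_pencilI[of "mat2 1 0 0 (-1)" "mat 1" "mat 1"])
     (simp_all add: unitary_mat2_iff mat2_eq_iff param_slice_def)

lemma cnj_mult_self: "cmod z = 1 \<Longrightarrow> z * cnj z = 1" "cmod z = 1 \<Longrightarrow> cnj z * z = 1"
  by (simp_all add: complex_norm_square[symmetric] mult.commute[of "cnj z"])

text \<open>Opposite diagonal phases on qubits 2 and 3 fix every diagonal matrix, in particular the
  seed, and turn the two off-diagonal entries in opposite directions. This gauge freedom makes a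
  phase immaterial when it occurs only off the diagonal.\<close>

lemma diag_conj_param_pencil:
  assumes z: "cmod z = 1"
  shows "LU_equivalent (pencil (mat2 a 0 0 b) (mat2 p q r t)) (pencil (mat2 a 0 0 b) (mat2 p (z\<^sup>2 * q) (cnj z ^ 2 * r) t))"
proof (rule LU_pencilI[of "mat2 1 0 0 1" "mat2 z 0 0 (cnj z)" "mat2 (cnj z) 0 0 z"])
  note u = cnj_mult_self[OF z]
  have e: "v = z * v * cnj z" "v = cnj z * v * z" for v
    using u by (simp_all add: mult.commute[of _ v] mult.assoc)
  show "mat2 a 0 0 b =
     scale_mat (mat2 1 0 0 1 $ 0 $ 0) (mat2 z 0 0 (cnj z) ** mat2 a 0 0 b ** transpose (mat2 (cnj z) 0 0 z)) +
     scale_mat (mat2 1 0 0 1 $ 0 $ 1) (mat2 z 0 0 (cnj z) ** mat2 p q r t ** transpose (mat2 (cnj z) 0 0 z))"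
    using e[of a] e[of b] by (simp add: mat2_eq_iff mult_nth_two)
  show "mat2 p (z\<^sup>2 * q) (cnj z ^ 2 * r) t =
     scale_mat (mat2 1 0 0 1 $ 1 $ 0) (mat2 z 0 0 (cnj z) ** mat2 a 0 0 b ** transpose (mat2 (cnj z) 0 0 z)) +
     scale_mat (mat2 1 0 0 1 $ 1 $ 1) (mat2 z 0 0 (cnj z) ** mat2 p q r t ** transpose (mat2 (cnj z) 0 0 z))"
    using e[of p] e[of t] by (simp add: mat2_eq_iff mult_nth_two power2_eq_square)
qed (use cnj_mult_self[OF z] in \<open>simp_all add: unitary_mat2_iff\<close>)

lemma unit_square: assumes "cmod w = 1" obtains z where "cmod z = 1" "z\<^sup>2 = w"
proof
  show "(csqrt w)\<^sup>2 = w" by simp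
  show "cmod (csqrt w) = 1" using assms by (simp add: norm_csqrt)
qed

text \<open>With \<open>c' = 0\<close> the phase \<open>x\<close> occurs only off the diagonal of
  the second slice, once plain and once conjugated.\<close>

lemma param_pencil_shift_x:
  assumes "cmod x = 1" "cmod x' = 1"
  shows "LU_equivalent (param_pencil a b c s 0 s' x y) (param_pencil a b c s 0 s' x' y)"
proof -
  have "cmod (x' * cnj x) = 1" using assms by (simp add: norm_mult)
  then obtain z where z: "cmod z = 1" "z\<^sup>2 = x' * cnj x" by (rule unit_square)
  have x': "x' = z\<^sup>2 * x" using cnj_mult_self[OF assms(1)] by (simp add: z mult.assoc)
  show ?thesis
    using diag_conj_param_pencil[OF z(1), of a b "b * s * s' * y" "- a * c * s' * x" "b * c * s' * cnj x" "a * s * s' * cnj y"]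
    unfolding param_pencil_def param_slice_def x' by (simp add: algebra_simps)
qed

text \<open>With \<open>s' = 0\<close> it is \<open>y\<close> that occurs only off the
  diagonal.\<close>

lemma param_pencil_shift_y:
  assumes "cmod y = 1" "cmod y' = 1"
  shows "LU_equivalent (param_pencil a b c s c' 0 x y) (param_pencil a b c s c' 0 x y')"
proof -
  have "cmod (y' * cnj y) = 1" using assms by (simp add: norm_mult)
  then obtain z where z: "cmod z = 1" "z\<^sup>2 = y' * cnj y" by (rule unit_square)
  have y': "y' = z\<^sup>2 * y" using cnj_mult_self[OF assms(1)] by (simp add: z mult.assoc)
  show ?thesis
    using diag_conj_param_pencil[OF z(1), of a b "a * c * c' * x" "b * s * c' * y" "- a * s * c' * cnj y" "b * c * c' * cnj x"]
    unfolding param_pencil_def param_slice_def y' by (simp add: algebra_simps)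
qed

text \<open>With \<open>b = 0\<close> the first row of the second slice carries only
  \<open>x\<close> and the second row only \<open>cnj y\<close>, while the first slice has at most
  one non-zero entry. A phase on the second slice and one on the second row therefore adjust
  \<open>x\<close> and \<open>y\<close> independently.\<close>

lemma param_pencil_product_seed:
  assumes "cmod x = 1" "cmod x' = 1" "cmod y = 1" "cmod y' = 1"
  shows "LU_equivalent (param_pencil a 0 c s c' s' x y) (param_pencil a 0 c s c' s' x' y')"
proof -
  let ?n = "x' * cnj x"
  let ?m = "cnj ?n * y * cnj y'"
  note u = cnj_mult_self[OF assms(1)] cnj_mult_self[OF assms(2)] cnj_mult_self[OF assms(3)] cnj_mult_self[OF assms(4)]
  have n: "cmod ?n = 1" and m: "cmod ?m = 1" using assms by (simp_all add: norm_mult)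
  have e1: "?n * x = x'" using u by (simp add: mult.assoc)
  have "?n * ?m * cnj y = (?n * cnj ?n) * (y * cnj y) * cnj y'" by (simp only: mult_ac)
  then have e2: "?n * ?m * cnj y = cnj y'" by (simp only: cnj_mult_self(1)[OF n] u mult_1)
  obtain n m where nm: "cmod n = 1" "cmod m = 1" "x' = n * x" "cnj y' = n * m * cnj y"
    using n m e1 e2 by metis
  show ?thesis
    unfolding param_pencil_def
    by (rule LU_pencilI[of "mat2 1 0 0 n" "mat2 1 0 0 m" "mat 1"])
       (use cnj_mult_self[OF nm(1)] cnj_mult_self[OF nm(2)] in
         \<open>simp_all add: unitary_mat2_iff mat2_eq_iff mult_nth_two param_slice_def nm(3,4) mat2_one mult_ac\<close>)
qed


subsection \<open>Entropies of rank-two density operators\<close>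

definition binary_entropy :: "real \<Rightarrow> real" where
  "binary_entropy x = - (x * log 2 x + (1 - x) * log 2 (1 - x))"

text \<open>Entropy of a two-point spectrum with sum 1 and product \<open>D\<close>, evaluated at
  the larger root of \<open>l\<^sup>2 - l + D\<close>.\<close>

definition det_entropy :: "real \<Rightarrow> real" where
  "det_entropy D = binary_entropy ((1 + sqrt (1 - 4 * D)) / 2)"

text \<open>The derivative \<open>log 2 (1 - z) - log 2 z\<close> is negative beyond 1/2. The
  endpoint 1 is treated apart, since the logarithm of \<open>1 - x\<close> is not continuous
  there.\<close>

lemma binary_entropy_strict_decreasing:
  assumes "1 / 2 \<le> x" "x < y" "y \<le> 1"
  shows "binary_entropy y < binary_entropy x"
proof (cases "y = 1")
  case True
  have "x * log 2 x < 0" "(1 - x) * log 2 (1 - x) < 0"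
    using assms True by (auto intro!: mult_pos_neg)
  then show ?thesis by (simp add: binary_entropy_def True)
next
  case False
  show ?thesis
  proof (rule DERIV_neg_imp_decreasing_open[OF assms(2)])
    fix z assume z: "x < z" "z < y"
    then have z01: "0 < z" "z < 1" "z > 1 - z" using assms by auto
    have "(binary_entropy has_real_derivative (log 2 (1 - z) - log 2 z)) (at z)"
      unfolding binary_entropy_def[abs_def] log_def
      by (rule derivative_eq_intros refl | use z01 in \<open>simp add: field_simps; fail\<close>)+
    moreover have "log 2 (1 - z) - log 2 z < 0" using z01 by simp
    ultimately show "\<exists>w. (binary_entropy has_real_derivative w) (at z) \<and> w < 0" by blast
  next
    show "continuous_on {x..y} binary_entropy"
      unfolding binary_entropy_def[abs_def] log_def
      by (intro continuous_intros) (use assms False in auto)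
  qed
qed

lemma det_entropy_strict_mono:
  assumes "0 \<le> D" "D < D'" "D' \<le> 1 / 4" shows "det_entropy D < det_entropy D'"
  unfolding det_entropy_def
  by (rule binary_entropy_strict_decreasing) (use assms in auto)

lemma det_entropy_le_iff:
  assumes "0 \<le> D" "D \<le> 1 / 4" "0 \<le> D'" "D' \<le> 1 / 4"
  shows "det_entropy D \<le> det_entropy D' \<longleftrightarrow> D \<le> D'"
  using det_entropy_strict_mono assms by (metis linorder_not_le order_le_less)

lemma det_entropy_eq_iff:
  assumes "0 \<le> D" "D \<le> 1 / 4" "0 \<le> D'" "D' \<le> 1 / 4"
  shows "det_entropy D = det_entropy D' \<longleftrightarrow> D = D'"
  using det_entropy_le_iff[OF assms] det_entropy_le_iff[OF assms(3,4,1,2)] by auto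

section \<open>Spectra of products and of 2x2 matrices\<close>

text \<open>If \<open>A B v = l v\<close>, then \<open>B v / l\<close> lies in the
  \<open>l\<close>-eigenspace of \<open>B A\<close> and \<open>A\<close> maps it back to
  \<open>v\<close>; the division confines the argument to non-zero eigenvalues.\<close>

lemma eigenspace_dim_le:
  assumes "l \<noteq> 0"
  shows "vec.dim (eigenspace ((A :: complex^'m^'n) ** B) l) \<le> vec.dim (eigenspace (B ** A) l)"
proof -
  have "eigenspace (A ** B) l \<subseteq> (*v) A ` eigenspace (B ** A) l"
  proof
    fix v assume "v \<in> eigenspace (A ** B) l"
    then have v: "A *v (B *v v) = complex_of_real l *s v"
      by (simp add: eigenspace_def matrix_vector_mul_assoc)
    let ?w = "(1 / complex_of_real l) *s (B *v v)"
    have "A *v ?w = v" using assms by (simp add: vec.scale v)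
    moreover have "?w \<in> eigenspace (B ** A) l"
      using assms by (simp add: eigenspace_def matrix_vector_mul_assoc[symmetric] vec.scale v)
    ultimately show "v \<in> (*v) A ` eigenspace (B ** A) l" by force
  qed
  then have "vec.dim (eigenspace (A ** B) l) \<le> vec.dim ((*v) A ` eigenspace (B ** A) l)"
    by (rule vec.dim_subset)
  also have "\<dots> \<le> vec.dim (eigenspace (B ** A) l)"
    by (rule vec.dim_image_le) (rule matrix_vector_mul_linear_gen)
  finally show ?thesis .
qed

lemma eigenvalue_iff_dim: "(\<exists>v\<in>eigenspace A l. v \<noteq> 0) \<longleftrightarrow> vec.dim (eigenspace A l) \<noteq> 0"
  by (auto simp: vec.dim_eq_0)

lemma entropy_alt:
  "von_neumann_entropy \<rho> =
     - (\<Sum>l | l \<noteq> 0 \<and> vec.dim (eigenspace \<rho> l) \<noteq> 0. real (vec.dim (eigenspace \<rho> l)) * (l * log 2 l))"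
proof -
  let ?S = "{l. vec.dim (eigenspace \<rho> l) \<noteq> 0}"
  let ?f = "\<lambda>l. real (vec.dim (eigenspace \<rho> l)) * (l * log 2 l)"
  have "sum ?f (?S - {0}) = sum ?f ?S"
  proof (cases "finite ?S")
    case True then show ?thesis by (intro sum.mono_neutral_left) auto
  next
    \<comment> \<open>Over an infinite set \<open>sum\<close> has the default value 0, and deleting
      one point keeps the set infinite, so both sides are 0.\<close>
    case False then show ?thesis by simp
  qed
  moreover have "?S - {0} = {l. l \<noteq> 0 \<and> vec.dim (eigenspace \<rho> l) \<noteq> 0}" by auto
  ultimately show ?thesis by (simp add: von_neumann_entropy_def eigenvalue_iff_dim)
qed

text \<open>Replaces the spectrum of a mixture of few pure states in a large space by that of their
  small Gram matrix. The kernels may differ in dimension but contribute nothing to the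
  entropy.\<close>

lemma entropy_mult_commute:
  "von_neumann_entropy ((A :: complex^'m^'n) ** B) = von_neumann_entropy (B ** A)"
proof -
  have "vec.dim (eigenspace (A ** B) l) = vec.dim (eigenspace (B ** A) l)" if "l \<noteq> 0" for l
    using eigenspace_dim_le[OF that] by (metis order_antisym)
  then have "{l. l \<noteq> 0 \<and> vec.dim (eigenspace (A ** B) l) \<noteq> 0} = {l. l \<noteq> 0 \<and> vec.dim (eigenspace (B ** A) l) \<noteq> 0}"
    and "real (vec.dim (eigenspace (A ** B) l)) * (l * log 2 l) = real (vec.dim (eigenspace (B ** A) l)) * (l * log 2 l)" for l
    by (metis, metis mult_zero_left mult_zero_right)
  then show ?thesis unfolding entropy_alt by (simp only:)
qed

lemma eigenspace_mat2_iff: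
  "v \<in> eigenspace (mat2 p q r s) l \<longleftrightarrow>
     (p - l) * v $ 0 + q * v $ 1 = 0 \<and> r * v $ 0 + (s - l) * v $ 1 = 0"
  by (auto simp: eigenspace_def vec_eq_iff forall_two matrix_vector_mult_def sum_two algebra_simps)

text \<open>A kernel vector is read off from a non-zero row of the shifted matrix; the vanishing
  determinant makes the other row annihilate it too. Two independent kernel vectors would force the
  matrix to be scalar.\<close>

lemma dim_eigenspace_mat2:
  assumes "(p - l) * (s - l) = q * r" "mat2 p q r s \<noteq> mat2 l 0 0 l"
  shows "vec.dim (eigenspace (mat2 p q r s) l) = 1"
proof -
  let ?E = "eigenspace (mat2 p q r s) (l :: real)"
  have "\<exists>w\<in>?E. w \<noteq> 0"
  proof (cases "p - l = 0 \<and> q = 0")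
    case True
    let ?w = "(\<chi> i. if i = 0 then s - l else - r) :: complex^2"
    have "?w \<in> ?E" using assms True by (simp add: eigenspace_mat2_iff)
    moreover have "?w \<noteq> 0" using assms True by (auto simp: vec_eq_iff forall_two)
    ultimately show ?thesis by blast
  next
    case False
    let ?w = "(\<chi> i. if i = 0 then q else l - p) :: complex^2"
    have "?w \<in> ?E" using assms(1) by (simp add: eigenspace_mat2_iff algebra_simps)
    moreover have "?w \<noteq> 0" using assms False by (auto simp: vec_eq_iff forall_two)
    ultimately show ?thesis by blast
  qed
  then obtain w where w: "w \<in> ?E" "w \<noteq> 0" by blast
  have dep: "v $ 0 * w $ 1 = v $ 1 * w $ 0" if v: "v \<in> ?E" for v
  proof (rule ccontr)
    assume neq: "v $ 0 * w $ 1 \<noteq> v $ 1 * w $ 0"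
    let ?d = "v $ 0 * w $ 1 - v $ 1 * w $ 0"
    have e: "(p - l) * v $ 0 + q * v $ 1 = 0" "r * v $ 0 + (s - l) * v $ 1 = 0"
      "(p - l) * w $ 0 + q * w $ 1 = 0" "r * w $ 0 + (s - l) * w $ 1 = 0"
      using v w by (simp_all add: eigenspace_mat2_iff)
    have "(p - l) * ?d = 0" "q * ?d = 0" "r * ?d = 0" "(s - l) * ?d = 0"
      using e by algebra+
    then show False using neq assms(2) by auto
  qed
  have "?E \<subseteq> vec.span {w}"
  proof
    fix v assume v: "v \<in> ?E"
    show "v \<in> vec.span {w}"
    proof (cases "w $ 0 = 0")
      case False
      then have "v = (v $ 0 / w $ 0) *s w"
        using dep[OF v] by (simp add: vec_eq_iff forall_two field_simps)
      then show ?thesis by (metis vec.span_base vec.span_scale singletonI)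
    next
      case True
      then have "w $ 1 \<noteq> 0" using w by (auto simp: vec_eq_iff forall_two)
      then have "v = (v $ 1 / w $ 1) *s w"
        using dep[OF v] True by (simp add: vec_eq_iff forall_two field_simps)
      then show ?thesis by (metis vec.span_base vec.span_scale singletonI)
    qed
  qed
  then show ?thesis using w by (intro vec.dim_unique[of "{w}"]) auto
qed

text \<open>The trace is 1, so the eigenvalues are the roots of \<open>l\<^sup>2 - l + D\<close>. A
  double root makes the Hermitian matrix half the identity and needs its own case, because only then
  is an eigenspace two-dimensional.\<close>

lemma entropy_mat2:
  fixes p r :: real and z :: complex
  assumes pr: "p + r = 1"
  shows "von_neumann_entropy (mat2 p z (cnj z) r) = det_entropy (p * r - (cmod z)\<^sup>2)"
proof -
  let ?\<rho> = "mat2 p z (cnj z) r"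
  define D where "D = p * r - (cmod z)\<^sup>2"
  define h where "h = sqrt (1 - 4 * D)"
  have disc: "1 - 4 * D = (p - r)\<^sup>2 + 4 * (cmod z)\<^sup>2"
  proof -
    have "(p + r)\<^sup>2 = 1" using pr by simp
    then show ?thesis by (simp add: D_def power2_eq_square algebra_simps)
  qed
  then have h2: "h\<^sup>2 = 1 - 4 * D" by (simp add: h_def)
  have char: "(p - l) * (r - l) = z * cnj z \<longleftrightarrow> l\<^sup>2 - l + D = 0" for l :: real
  proof -
    have "(complex_of_real p - l) * (complex_of_real r - l) = z * cnj z
       \<longleftrightarrow> complex_of_real ((p - l) * (r - l)) = complex_of_real ((cmod z)\<^sup>2)"
      by (simp add: complex_norm_square[symmetric])
    also have "\<dots> \<longleftrightarrow> (p - l) * (r - l) = (cmod z)\<^sup>2" by (simp only: of_real_eq_iff)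
    also have "\<dots> \<longleftrightarrow> l\<^sup>2 - (p + r) * l + D = 0"
      by (auto simp: D_def power2_eq_square algebra_simps)
    finally show ?thesis by (simp add: pr)
  qed
  define l1 where "l1 = (1 + h) / 2"
  define l2 where "l2 = (1 - h) / 2"
  have roots: "l\<^sup>2 - l + D = 0 \<longleftrightarrow> l = l1 \<or> l = l2" for l
  proof -
    have "4 * (l\<^sup>2 - l + D) = (2 * l - 1 - h) * (2 * l - 1 + h)"
      using h2 by (simp add: power2_eq_square algebra_simps)
    then have "l\<^sup>2 - l + D = 0 \<longleftrightarrow> (2 * l - 1 - h) * (2 * l - 1 + h) = 0" by (metis mult_eq_0_iff zero_neq_numeral)
    then show ?thesis by (auto simp: l1_def l2_def)
  qed
  have nz: "l\<^sup>2 - l + D = 0" if dim: "vec.dim (eigenspace ?\<rho> l) \<noteq> 0" for l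
  proof -
    obtain v where v: "v \<in> eigenspace ?\<rho> l" "v \<noteq> 0" using dim unfolding eigenvalue_iff_dim[symmetric] by blast
    then have e: "(p - l) * v $ 0 + z * v $ 1 = 0" "cnj z * v $ 0 + (r - l) * v $ 1 = 0"
      by (simp_all add: eigenspace_mat2_iff)
    then have "(complex_of_real (p - l) * complex_of_real (r - l) - z * cnj z) * v $ 0 = 0"
        "(complex_of_real (p - l) * complex_of_real (r - l) - z * cnj z) * v $ 1 = 0"
      by algebra+
    moreover have "v $ 0 \<noteq> 0 \<or> v $ 1 \<noteq> 0" using v by (auto simp: vec_eq_iff forall_two)
    ultimately have "complex_of_real (p - l) * complex_of_real (r - l) = z * cnj z" by auto
    then show ?thesis using char[of l] by simp
  qed
  show ?thesis
  proof (cases "h = 0")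
    case True
    then have "(p - r)\<^sup>2 = 0" "(cmod z)\<^sup>2 = 0" using disc h2
      by (smt (verit) zero_le_power2 zero_power2)+
    then have pz: "p = 1/2" "r = 1/2" "z = 0" using pr by auto
    have l: "l1 = 1/2" "l2 = 1/2" using True by (simp_all add: l1_def l2_def)
    have "eigenspace ?\<rho> (1/2) = UNIV" by (auto simp: eigenspace_mat2_iff pz)
    then have dim: "vec.dim (eigenspace ?\<rho> (1/2)) = 2" by (simp only: vec_dim_card) simp
    have "vec.dim (eigenspace ?\<rho> l) \<noteq> 0 \<longleftrightarrow> l = 1/2" for l
      using nz[of l] roots[of l] l dim by (metis zero_neq_numeral)
    then have "{l. l \<noteq> 0 \<and> vec.dim (eigenspace ?\<rho> l) \<noteq> 0} = {1/2}"
      by (simp only:) auto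
    then have "von_neumann_entropy ?\<rho> = 1" unfolding entropy_alt by (simp add: dim log_divide)
    moreover have "det_entropy D = 1"
      using True by (simp add: det_entropy_def h_def[symmetric] binary_entropy_def log_divide)
    ultimately show ?thesis by (simp add: D_def)
  next
    case False
    have neq: "mat2 p z (cnj z) r \<noteq> mat2 l 0 0 l" for l :: real
    proof
      assume "mat2 p z (cnj z) r = mat2 l 0 0 l"
      then have "p = l" "r = l" "z = 0" by (auto simp: mat2_eq_iff)
      then show False using disc h2 False by simp
    qed
    have dims: "vec.dim (eigenspace ?\<rho> l) = 1" if "l\<^sup>2 - l + D = 0" for l
      by (rule dim_eigenspace_mat2) (use char[of l] that neq in auto)
    have S: "{l. vec.dim (eigenspace ?\<rho> l) \<noteq> 0} = {l1, l2}"
      using nz dims roots by fastforce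
    have "l1 \<noteq> l2" using False by (simp add: l1_def l2_def)
    then have "von_neumann_entropy ?\<rho> = - (l1 * log 2 l1 + l2 * log 2 l2)"
      unfolding von_neumann_entropy_def eigenvalue_iff_dim S using dims roots by simp
    also have "l2 = 1 - l1" by (simp add: l1_def l2_def field_simps)
    finally show ?thesis
      by (simp add: det_entropy_def binary_entropy_def D_def[symmetric] h_def[symmetric] l1_def)
  qed
qed

section \<open>Entanglement as a Gram determinant\<close>

lemma partial_trace_proj:
  "partial_trace_snd (proj \<psi>) $ i $ j = (\<Sum>k\<in>UNIV. \<psi> $ (i, k) * cnj (\<psi> $ (j, k)))"
  by (simp add: partial_trace_snd_def proj_def)

lemma sum_cnj_self: "(\<Sum>k\<in>A. f k * cnj (f k)) = complex_of_real (\<Sum>k\<in>A. (cmod (f k))\<^sup>2)"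
  by (simp only: of_real_sum complex_norm_square)

lemma entanglement_eq:
  fixes \<psi> :: "complex ^ (2 \<times> 'n::finite)"
  defines "p \<equiv> \<Sum>k\<in>UNIV. (cmod (\<psi> $ (0, k)))\<^sup>2"
    and "r \<equiv> \<Sum>k\<in>UNIV. (cmod (\<psi> $ (1, k)))\<^sup>2"
    and "z \<equiv> \<Sum>k\<in>UNIV. \<psi> $ (0, k) * cnj (\<psi> $ (1, k))"
  assumes "p + r = 1"
  shows "entanglement \<psi> = det_entropy (p * r - (cmod z)\<^sup>2)"
proof -
  have "partial_trace_snd (proj \<psi>) = mat2 p z (cnj z) r"
    by (simp add: mat2_eq_iff partial_trace_proj p_def r_def z_def sum_cnj_self mult.commute)
  then show ?thesis using entropy_mat2[OF assms(4)] by (simp add: entanglement_def)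
qed

lemma frob_cnj: "cnj (frob M N) = frob N M"
  by (simp add: frob_def mult.commute)

lemma frob_self: "frob M M = complex_of_real (Re (frob M M))" "Re (frob M M) \<ge> 0"
proof -
  show "frob M M = complex_of_real (Re (frob M M))"
    using frob_cnj[of M M] by (simp add: complex_eq_iff)
  show "Re (frob M M) \<ge> 0"
    by (simp add: frob_def sum_two)
qed

lemma Re_mult_cnj: "Re (z * cnj z) = (cmod z)\<^sup>2"
  unfolding cmod_power2 by (simp add: power2_eq_square)

lemma frob_norm: "Re (frob M M) = (\<Sum>j\<in>UNIV. \<Sum>k\<in>UNIV. (cmod (M $ j $ k))\<^sup>2)"
  by (simp only: frob_def Re_sum Re_mult_cnj)

lemma frob_Cauchy_Schwarz: "(cmod (frob M N))\<^sup>2 \<le> Re (frob M M) * Re (frob N N)"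
proof -
  define A where "A = Re (frob N N)"
  define z where "z = frob M N"
  \<comment> \<open>\<open>A\<close> times the component of \<open>M\<close> orthogonal to
    \<open>N\<close>, scaled to avoid a division; its squared norm is \<open>A\<close> times the
    defect in the inequality.\<close>
  define P where "P = scale_mat A M + scale_mat (- z) N"
  have zc: "frob N M = cnj z" by (simp add: z_def frob_cnj)
  have "frob P P = A * (A * frob M M) - A * (cnj z * z) - z * (A * cnj z) + z * (cnj z * frob N N)"
    unfolding zc[symmetric] unfolding z_def P_def by (simp add: frob_def sum_two algebra_simps)
  also have "frob N N = A" unfolding A_def by (rule frob_self)
  also have "frob M M = Re (frob M M)" by (rule frob_self)
  also have "A * (A * complex_of_real (Re (frob M M))) - A * (cnj z * z) - z * (A * cnj z) + z * (cnj z * A)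
      = A * complex_of_real (A * Re (frob M M)) - A * (z * cnj z)"
    by (simp add: algebra_simps)
  also have "\<dots> = complex_of_real (A * (A * Re (frob M M) - (cmod z)\<^sup>2))"
    by (simp add: complex_norm_square[symmetric] algebra_simps)
  finally have "A * (A * Re (frob M M) - (cmod z)\<^sup>2) \<ge> 0"
    using frob_self(2)[of P] by simp
  moreover have "A \<ge> 0" unfolding A_def by (rule frob_self)
  moreover have "z = 0" if "A = 0"
  proof -
    have "N = 0" using that unfolding A_def
      by (auto simp: frob_norm sum_two mat2_eq_iff add_nonneg_eq_0_iff)
    then show ?thesis by (simp add: z_def frob_def)
  qed
  ultimately show ?thesis
    by (cases "A = 0") (auto simp: zero_le_mult_iff mult.commute A_def[symmetric] z_def[symmetric])
qed

lemma entanglement_pencil: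
  assumes "Re (frob M M) + Re (frob N N) = 1"
  shows "entanglement (pencil M N) = det_entropy (Re (frob M M) * Re (frob N N) - (cmod (frob M N))\<^sup>2)"
proof -
  have f: "(\<Sum>k\<in>UNIV. (cmod (pencil M N $ (0, k)))\<^sup>2) = Re (frob M M)"
       "(\<Sum>k\<in>UNIV. (cmod (pencil M N $ (1, k)))\<^sup>2) = Re (frob N N)"
       "(\<Sum>k\<in>UNIV. pencil M N $ (0, k) * cnj (pencil M N $ (1, k))) = frob M N"
    by (simp_all add: sum_UNIV_prod frob_norm) (simp add: frob_def)
  show ?thesis using entanglement_eq[of "pencil M N"] assms unfolding f by simp
qed

lemma scaleR_pencil: "r *\<^sub>R pencil M N = pencil (scale_mat r M) (scale_mat r N)"
  by (simp add: three_qubit_eq_iff scaleR_conv_of_real[where ?'a = complex])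

lemma frob_scale: "frob (scale_mat r M) (scale_mat t N) = r * cnj t * frob M N"
  by (simp add: frob_def sum_two algebra_simps)

lemma entanglement_half_pencil:
  assumes "frob M M = 1" "frob N N = 1"
  shows "entanglement ((1 / sqrt 2) *\<^sub>R pencil M N) = det_entropy ((1 - (cmod (frob M N))\<^sup>2) / 4)"
    and "cmod (frob M N) \<le> 1"
proof -
  let ?r = "complex_of_real (1 / sqrt 2)"
  have r: "?r * cnj ?r = 1 / 2" by (simp add: of_real_mult[symmetric] real_sqrt_mult[symmetric] del: of_real_mult)
  show "entanglement ((1 / sqrt 2) *\<^sub>R pencil M N) = det_entropy ((1 - (cmod (frob M N))\<^sup>2) / 4)"
    unfolding scaleR_pencil
    by (subst entanglement_pencil) (simp_all only: frob_scale r assms, simp_all add: norm_divide power_divide diff_divide_distrib)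
  have "(cmod (frob M N))\<^sup>2 \<le> 1" using frob_Cauchy_Schwarz[of M N] by (simp add: assms)
  then show "cmod (frob M N) \<le> 1" by (simp add: power_le_one_iff)
qed

text \<open>\<open>E6\<close> evaluates the entanglement of the state itself, which has to be
  carried over to its decomposition. Unitaries on qubits 2 and 3 leave the Gram matrix of the slices
  unchanged; the one on qubit 1 conjugates it, preserving trace and determinant.\<close>

lemma entanglement_LU:
  assumes "LU_equivalent \<psi> \<phi>" "norm \<psi> = 1"
  shows "entanglement \<phi> = entanglement \<psi>"
proof -
  obtain M N where MN: "\<psi> = pencil M N" by (rule pencil_exhaust)
  obtain V A B :: "complex^2^2" where u: "unitary_mat V" "unitary_mat A" "unitary_mat B"
    and p: "\<phi> = (V \<otimes>\<^sub>m A \<otimes>\<^sub>m B) *v \<psi>"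
    using assms unfolding LU_equivalent_def by blast
  define M' where "M' = A ** M ** transpose B"
  define N' where "N' = A ** N ** transpose B"
  have fr: "frob M' M' = frob M M" "frob N' N' = frob N N" "frob M' N' = frob M N" "frob N' M' = frob N M"
    unfolding M'_def N'_def by (rule frob_unitary[OF u(2,3)])+
  have n: "Re (frob M M) + Re (frob N N) = 1"
  proof -
    have "(norm \<psi>)\<^sup>2 = Re (frob M M) + Re (frob N N)"
      by (simp add: norm_vec_def L2_set_def sum_nonneg sum_UNIV_prod sum_two MN frob_norm)
    then show ?thesis using assms by simp
  qed
  define G where "G = mat2 (frob M' M') (frob M' N') (frob N' M') (frob N' N')"
  define P where "P = scale_mat (V $ 0 $ 0) M' + scale_mat (V $ 0 $ 1) N'"
  define Q where "Q = scale_mat (V $ 1 $ 0) M' + scale_mat (V $ 1 $ 1) N'"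
  have phi: "\<phi> = pencil P Q" unfolding p MN local_unitary_pencil P_def Q_def M'_def N'_def ..
  have H: "mat2 (frob P P) (frob P Q) (frob Q P) (frob Q Q) = V ** G ** adjoint_mat V"
    by (simp add: mat2_eq_iff mult_nth_two G_def P_def Q_def frob_def sum_two algebra_simps)
  have "trace (V ** G ** adjoint_mat V) = trace (adjoint_mat V ** (V ** G))" by (rule trace_mul_sym)
  also have "\<dots> = trace G" using u(1) by (simp add: matrix_mul_assoc unitary_mat_def)
  finally have tr: "frob P P + frob Q Q = frob M M + frob N N"
    unfolding H[symmetric] by (simp add: trace_def sum_two G_def fr)
  have "det2 (V ** G ** adjoint_mat V) = (det2 V * cnj (det2 V)) * det2 G"
    by (simp add: det2_mult) (simp add: det2_def algebra_simps)
  also have "det2 V * cnj (det2 V) = 1" using unitary_det2[OF u(1)] by (rule cnj_mult_self)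
  finally have "det2 (mat2 (frob P P) (frob P Q) (frob Q P) (frob Q Q)) = det2 G" by (simp only: H mult_1)
  then have "frob P P * frob Q Q - frob P Q * cnj (frob P Q) = frob M M * frob N N - frob M N * cnj (frob M N)"
    by (simp add: det2_def G_def frob_cnj fr)
  then have "complex_of_real (Re (frob P P) * Re (frob Q Q) - (cmod (frob P Q))\<^sup>2)
     = complex_of_real (Re (frob M M) * Re (frob N N) - (cmod (frob M N))\<^sup>2)"
    by (simp add: frob_self(1)[symmetric] complex_norm_square[symmetric])
  then have d: "Re (frob P P) * Re (frob Q Q) - (cmod (frob P Q))\<^sup>2
     = Re (frob M M) * Re (frob N N) - (cmod (frob M N))\<^sup>2" by (simp only: of_real_eq_iff)
  have "Re (frob P P + frob Q Q) = Re (frob M M + frob N N)" by (simp only: tr)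
  then have "Re (frob P P) + Re (frob Q Q) = 1" using n by simp
  then show ?thesis unfolding phi MN by (simp add: entanglement_pencil n d)
qed

lemma proj_unitary_image: "A ** proj v ** adjoint_mat A = proj (A *v v)"
  by (simp add: vec_eq_iff proj_def matrix_matrix_mult_def matrix_vector_mult_def sum_product sum_distrib_left
       sum_distrib_right mult_ac)

text \<open>The 4x4 mixture is \<open>A ** B\<close>, where the columns of \<open>A\<close> are the
  two states scaled by \<open>1 / sqrt 2\<close> and \<open>B\<close> is its adjoint. Then
  \<open>B ** A\<close> is half the 2x2 Gram matrix, and the overlap of the two states is half the
  trace of \<open>U\<close>.\<close>

lemma mixing_entropy_eq:
  fixes U :: "complex^2^2"
  assumes "unitary_mat U"
  shows "mixing_entropy U = det_entropy ((1 - (cmod ((U $ 0 $ 0 + U $ 1 $ 1) / 2))\<^sup>2) / 4)"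
proof -
  let ?v = "(U \<otimes>\<^sub>m mat 1) *v phi_plus"
  define s where "s = complex_of_real (1 / sqrt 2)"
  have cs: "cnj s = s" by (simp add: s_def)
  define A :: "complex^2^(2 \<times> 2)" where
    "A = (\<chi> p j. s * (if j = 0 then phi_plus $ p else ?v $ p))"
  define B :: "complex^(2 \<times> 2)^2" where "B = (\<chi> j p. cnj (A $ p $ j))"
  have s: "s * s = 1 / 2" by (simp add: s_def of_real_mult[symmetric] real_sqrt_mult[symmetric] del: of_real_mult)
  have phi: "phi_plus $ (j, k) = (if j = k then s else 0)" for j k
    using two_cases[of j] two_cases[of k]
    by (auto simp: s_def phi_plus_def tensor_vec_def ket_def axis_def scaleR_conv_of_real[where ?'a = complex])
  have v: "?v $ (j, k) = s * U $ j $ k" for j k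
    using two_cases[of k] by (auto simp: tensor_mat_mult_nth phi sum_two mat_def)
  have AB: "(1 / 2) *\<^sub>R (proj phi_plus + (U \<otimes>\<^sub>m mat 1) ** proj phi_plus ** adjoint_mat (U \<otimes>\<^sub>m mat 1)) = A ** B"
  proof -
    have "((1 / 2) *\<^sub>R (proj phi_plus + proj ?v)) $ p $ q = (A ** B) $ p $ q" for p q
    proof -
      have "(A ** B) $ p $ q = (s * s) * (phi_plus $ p * cnj (phi_plus $ q)) + (s * s) * (?v $ p * cnj (?v $ q))"
        by (simp add: matrix_matrix_mult_def sum_two A_def B_def cs)
      then show ?thesis unfolding s
        by (simp add: proj_def scaleR_conv_of_real[where ?'a = complex] algebra_simps)
    qed
    then show ?thesis by (simp add: proj_unitary_image vec_eq_iff)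
  qed
  let ?t = "cnj (U $ 0 $ 0 + U $ 1 $ 1) / 4"
  have col: "cnj (U $ 0 $ 0) * U $ 0 $ 0 + cnj (U $ 1 $ 0) * U $ 1 $ 0 = 1"
     "cnj (U $ 0 $ 1) * U $ 0 $ 1 + cnj (U $ 1 $ 1) * U $ 1 $ 1 = 1"
    using assms unfolding unitary_mat_def by (simp_all add: mat2_eq_iff mult_nth_two mat2_one)
  have ss: "s * s * (s * s) = 1 / 4" by (simp only: s) simp
  have "(B ** A) $ i $ j = (\<Sum>k\<in>UNIV. \<Sum>l\<in>UNIV. cnj (A $ (k, l) $ i) * A $ (k, l) $ j)" for i j
    by (simp add: matrix_matrix_mult_def B_def sum_UNIV_prod)
  then have BA: "(B ** A) $ 0 $ 0 = (s * s * (s * s)) * 2"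
      "(B ** A) $ 0 $ 1 = (s * s * (s * s)) * (U $ 0 $ 0 + U $ 1 $ 1)"
      "(B ** A) $ 1 $ 0 = (s * s * (s * s)) * cnj (U $ 0 $ 0 + U $ 1 $ 1)"
      "(B ** A) $ 1 $ 1 = (s * s * (s * s)) * ((cnj (U $ 0 $ 0) * U $ 0 $ 0 + cnj (U $ 1 $ 0) * U $ 1 $ 0)
          + (cnj (U $ 0 $ 1) * U $ 0 $ 1 + cnj (U $ 1 $ 1) * U $ 1 $ 1))"
    by (simp_all add: sum_two A_def phi v cs algebra_simps)
  have "B ** A = mat2 (1/2) (cnj ?t) (cnj (cnj ?t)) (1/2)"
    unfolding mat2_eq_iff BA ss col by simp
  also have "\<dots> = mat2 (complex_of_real (1/2)) (cnj ?t) (cnj (cnj ?t)) (complex_of_real (1/2))" by simp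
  finally have "von_neumann_entropy (B ** A) = det_entropy (1/2 * (1/2) - (cmod (cnj ?t))\<^sup>2)"
    by (metis entropy_mat2 field_sum_of_halves)
  moreover have "1/2 * (1/2) - (cmod (cnj ?t))\<^sup>2 = (1 - (cmod ((U $ 0 $ 0 + U $ 1 $ 1) / 2))\<^sup>2) / 4"
    by (simp add: norm_divide power_divide field_simps del: complex_cnj_add)
  ultimately show ?thesis by (simp only: mixing_entropy_def AB entropy_mult_commute[of A B])
qed


subsection \<open>Uniqueness of generic parameters\<close>

lemma unitary_mult_cancel:
  assumes "unitary_mat A" shows "adjoint_mat A ** A = mat 1" "A ** adjoint_mat A = mat 1"
  using assms by (simp_all add: unitary_mat_def)

text \<open>The adjoints of \<open>U\<^sub>2\<close> and \<open>U\<^sub>3\<close> turn the second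
  slice into the seed, and the seed into a slice built from the adjoint Euler matrices. The extra
  diagonal factors cancel on the seed and flip the off-diagonal signs back, so that only
  \<open>x\<close> ends up conjugated.\<close>

lemma param_pencil_swap:
  assumes "c\<^sup>2 + s\<^sup>2 = 1" "c'\<^sup>2 + s'\<^sup>2 = 1" "cmod x = 1" "cmod y = 1"
  shows "\<exists>A B. unitary_mat A \<and> unitary_mat B \<and>
     (mat2 0 1 1 0 \<otimes>\<^sub>m A \<otimes>\<^sub>m B) *v param_pencil a b c s c' s' x y = param_pencil a b c s c' s' (cnj x) y"
proof -
  let ?S = "mat2 (complex_of_real a) 0 0 (complex_of_real b)"
  let ?U = "euler_mat c s x y" and ?W = "euler_mat c' s' 1 1"
  let ?K = "mat2 (- \<i>) 0 0 \<i>" and ?L = "mat2 \<i> 0 0 (- \<i>)"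
  define A where "A = ?K ** adjoint_mat ?U"
  define B where "B = ?L ** adjoint_mat ?W"
  have U: "unitary_mat ?U" and W: "unitary_mat ?W" using assms by (simp_all add: euler_mat_unitary)
  have KL: "unitary_mat ?K" "unitary_mat ?L" by (simp_all add: unitary_mat2_iff)
  have AB: "unitary_mat A" "unitary_mat B"
    unfolding A_def B_def using U W KL by (simp_all add: unitary_mult unitary_adjoint)
  have WT: "transpose ?W ** transpose (adjoint_mat ?W) = mat 1"
    using unitary_mult_cancel(1)[OF W] by (metis matrix_transpose_mul transpose_mat)
  have "A ** param_slice a b c s c' s' x y ** transpose B
      = ?K ** (adjoint_mat ?U ** ?U) ** ?S ** (transpose ?W ** transpose (adjoint_mat ?W)) ** transpose ?L"
    unfolding A_def B_def param_slice_eq matrix_transpose_mul by (simp only: matrix_mul_assoc)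
  also have "\<dots> = ?K ** ?S ** transpose ?L" by (simp add: WT unitary_mult_cancel(1)[OF U])
  also have "\<dots> = ?S" by (simp add: mat2_eq_iff mult_nth_two complex_eq_iff)
  finally have 1: "A ** param_slice a b c s c' s' x y ** transpose B = ?S" .
  have 2: "A ** ?S ** transpose B = param_slice a b c s c' s' (cnj x) y"
    by (simp add: A_def B_def mat2_eq_iff mult_nth_two euler_mat_def param_slice_def algebra_simps)
  have "(mat2 0 1 1 0 \<otimes>\<^sub>m A \<otimes>\<^sub>m B) *v param_pencil a b c s c' s' x y = param_pencil a b c s c' s' (cnj x) y"
    unfolding param_pencil_def local_unitary_pencil 1 2 by (simp add: pencil_eq_iff mat2_eq_iff)
  with AB show ?thesis by blast
qed

lemma unitary_swap: "unitary_mat (mat2 0 1 1 0)"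
  by (simp add: unitary_mat2_iff)

lemma param_pencil_swap_LU:
  assumes "c\<^sup>2 + s\<^sup>2 = 1" "c'\<^sup>2 + s'\<^sup>2 = 1" "cmod x = 1" "cmod y = 1"
  shows "LU_equivalent (param_pencil a b c s c' s' x y) (param_pencil a b c s c' s' (cnj x) y)"
  using param_pencil_swap[OF assms] unitary_swap unfolding LU_equivalent_def by metis

section \<open>Invariants of a parametrised pencil\<close>

lemma det2_param_slice:
  assumes "c\<^sup>2 + s\<^sup>2 = 1" "c'\<^sup>2 + s'\<^sup>2 = 1" "cmod x = 1" "cmod y = 1"
  shows "det2 (param_slice a b c s c' s' x y) = a * b"
proof -
  have "complex_of_real (c\<^sup>2 + s\<^sup>2) = 1" "complex_of_real (c'\<^sup>2 + s'\<^sup>2) = 1" using assms by simp_all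
  then have e: "complex_of_real c * c + complex_of_real s * s = 1" "complex_of_real c' * c' + complex_of_real s' * s' = 1"
    by (simp_all add: power2_eq_square)
  have "det2 (euler_mat c s x y) = complex_of_real c * c * (x * cnj x) + complex_of_real s * s * (y * cnj y)"
    by (simp add: det2_def euler_mat_def algebra_simps)
  moreover have "det2 (euler_mat c' s' 1 1) = 1" using e by (simp add: det2_def euler_mat_def)
  ultimately show ?thesis
    using e cnj_mult_self[OF assms(3)] cnj_mult_self[OF assms(4)]
    by (simp add: param_slice_eq det2_mult) (simp add: det2_def)
qed

lemma frob_diag: "frob (mat2 a 0 0 b) (mat2 a 0 0 b) = complex_of_real (a\<^sup>2 + b\<^sup>2)"
  by (simp add: frob_def sum_two power2_eq_square)

lemma frob_param_slice:
  assumes "c\<^sup>2 + s\<^sup>2 = 1" "c'\<^sup>2 + s'\<^sup>2 = 1" "cmod x = 1" "cmod y = 1"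
  shows "frob (param_slice a b c s c' s' x y) (param_slice a b c s c' s' x y) = complex_of_real (a\<^sup>2 + b\<^sup>2)"
  unfolding param_slice_eq using assms by (simp add: frob_unitary euler_mat_unitary frob_diag)

lemma frob_diag_param_slice:
  "frob (mat2 a 0 0 b) (param_slice a b c s c' s' x y) =
     Complex (c * c' * (a\<^sup>2 + b\<^sup>2) * Re x + 2 * a * b * s * s' * Re y) (- c * c' * (a\<^sup>2 - b\<^sup>2) * Im x)"
  by (simp add: frob_def sum_two param_slice_def complex_eq_iff power2_eq_square algebra_simps)

lemma unitary2_second_row:
  assumes "unitary_mat (V :: complex^2^2)"
  shows "V $ 1 $ 0 = - det2 V * cnj (V $ 0 $ 1)" "V $ 1 $ 1 = det2 V * cnj (V $ 0 $ 0)"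
    "V $ 0 $ 0 * cnj (V $ 0 $ 0) + V $ 0 $ 1 * cnj (V $ 0 $ 1) = 1"
proof -
  have "V ** adjoint_mat V = mat 1" using assms by (simp add: unitary_mat_def)
  then have e: "V $ 0 $ 0 * cnj (V $ 0 $ 0) + V $ 0 $ 1 * cnj (V $ 0 $ 1) = 1"
    "V $ 1 $ 0 * cnj (V $ 0 $ 0) + V $ 1 $ 1 * cnj (V $ 0 $ 1) = 0"
    by (simp_all add: mat2_eq_iff mult_nth_two mat2_one)
  show "V $ 1 $ 0 = - det2 V * cnj (V $ 0 $ 1)" using e unfolding det2_def by algebra
  show "V $ 1 $ 1 = det2 V * cnj (V $ 0 $ 0)" using e unfolding det2_def by algebra
  show "V $ 0 $ 0 * cnj (V $ 0 $ 0) + V $ 0 $ 1 * cnj (V $ 0 $ 1) = 1" by (rule e)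
qed

lemma unitary2_norms:
  assumes "unitary_mat (V :: complex^2^2)"
  shows "(cmod (V $ 0 $ 0))\<^sup>2 + (cmod (V $ 0 $ 1))\<^sup>2 = 1" "cmod (V $ 1 $ 0) = cmod (V $ 0 $ 1)"
    "cmod (V $ 1 $ 1) = cmod (V $ 0 $ 0)"
proof -
  have "complex_of_real ((cmod (V $ 0 $ 0))\<^sup>2 + (cmod (V $ 0 $ 1))\<^sup>2) = 1"
    using unitary2_second_row(3)[OF assms] by (simp add: complex_norm_square[symmetric])
  then show "(cmod (V $ 0 $ 0))\<^sup>2 + (cmod (V $ 0 $ 1))\<^sup>2 = 1" by (simp only: of_real_eq_1_iff)
  show "cmod (V $ 1 $ 0) = cmod (V $ 0 $ 1)" "cmod (V $ 1 $ 1) = cmod (V $ 0 $ 0)"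
    using unitary2_second_row(1,2)[OF assms] unitary_det2[OF assms] by (simp_all add: norm_mult)
qed

text \<open>The rows of a 2x2 unitary are \<open>(z, w)\<close> and, up to a phase,
  \<open>(- cnj w, cnj z)\<close>; the two terms are the squared determinant moduli of the resulting
  slices. Their quartic difference collapses to a multiple of \<open>Re (z * cnj w)\<close>, so that
  the determinant condition becomes linear in \<open>z * cnj w\<close>.\<close>

lemma quadratic_form_antipodal:
  "(cmod (complex_of_real m * (z\<^sup>2 + w\<^sup>2) + t * (z * w)))\<^sup>2
     - (cmod (complex_of_real m * (cnj z ^ 2 + cnj w ^ 2) - t * (cnj z * cnj w)))\<^sup>2
   = 4 * m * Re t * ((cmod z)\<^sup>2 + (cmod w)\<^sup>2) * Re (z * cnj w)"
  unfolding cmod_power2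
  by (simp add: power2_eq_square algebra_simps)

text \<open>Both pure coefficients are \<open>a b\<close>, the common determinant of the slices; the
  mixed coefficient is their polarised determinant.\<close>

lemma det2_pencil_combination:
  assumes "c\<^sup>2 + s\<^sup>2 = 1" "c'\<^sup>2 + s'\<^sup>2 = 1" "cmod x = 1" "cmod y = 1"
  shows "det2 (scale_mat z (mat2 a 0 0 b) + scale_mat w (param_slice a b c s c' s' x y)) =
    complex_of_real (a * b) * (z\<^sup>2 + w\<^sup>2) +
    Complex (2 * a * b * c * c' * Re x + s * s' * (a\<^sup>2 + b\<^sup>2) * Re y) (- (a\<^sup>2 - b\<^sup>2) * s * s' * Im y) * (z * w)"
proof -
  have t: "Complex (2 * a * b * c * c' * Re x + s * s' * (a\<^sup>2 + b\<^sup>2) * Re y) (- (a\<^sup>2 - b\<^sup>2) * s * s' * Im y)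
     = a * param_slice a b c s c' s' x y $ 1 $ 1 + b * param_slice a b c s c' s' x y $ 0 $ 0"
    by (simp add: param_slice_def complex_eq_iff power2_eq_square algebra_simps)
  have "det2 (scale_mat z (mat2 a 0 0 b) + scale_mat w (param_slice a b c s c' s' x y)) =
     complex_of_real a * b * z\<^sup>2 + det2 (param_slice a b c s c' s' x y) * w\<^sup>2 +
     (a * param_slice a b c s c' s' x y $ 1 $ 1 + b * param_slice a b c s c' s' x y $ 0 $ 0) * (z * w)"
    by (simp add: det2_def power2_eq_square algebra_simps)
  then show ?thesis unfolding t det2_param_slice[OF assms] by (simp add: algebra_simps)
qed

lemma transform_combination:
  "scale_mat z (A ** M ** B) + scale_mat w (A ** N ** B) = A ** (scale_mat z M + scale_mat w N) ** B"
  for A B :: "complex^2^2"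
  by (simp add: mat2_eq_iff mult_nth_two algebra_simps)

lemma frob_combination:
  "Re (frob (scale_mat z M + scale_mat w N) (scale_mat z M + scale_mat w N)) =
     (cmod z)\<^sup>2 * Re (frob M M) + (cmod w)\<^sup>2 * Re (frob N N) + 2 * Re (z * cnj w * frob M N)"
proof -
  have "frob (scale_mat z M + scale_mat w N) (scale_mat z M + scale_mat w N) =
     z * cnj z * frob M M + w * cnj w * frob N N + z * cnj w * frob M N + cnj (z * cnj w * frob M N)"
    by (simp add: frob_cnj) (simp add: frob_def sum_two algebra_simps)
  also have "z * cnj z = complex_of_real ((cmod z)\<^sup>2)" by (rule complex_norm_square[symmetric])
  also have "w * cnj w = complex_of_real ((cmod w)\<^sup>2)" by (rule complex_norm_square[symmetric])
  finally show ?thesis by (simp add: algebra_simps del: of_real_power)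
qed

text \<open>
  Equal norms and equal determinant moduli of the two new slices are two independent real linear
  conditions on \<open>z * cnj w\<close>, where \<open>(z, w)\<close> is the first row of \<open>V\<close>.
\<close>

lemma first_unitary_monomial:
  assumes eq: "(V \<otimes>\<^sub>m A \<otimes>\<^sub>m B) *v param_pencil a b c s c' s' x y = param_pencil a b C S C' S' X Y"
    and u: "unitary_mat V" "unitary_mat A" "unitary_mat B"
    and cs: "c\<^sup>2 + s\<^sup>2 = 1" "c'\<^sup>2 + s'\<^sup>2 = 1" "cmod x = 1" "cmod y = 1"
    and CS: "C\<^sup>2 + S\<^sup>2 = 1" "C'\<^sup>2 + S'\<^sup>2 = 1" "cmod X = 1" "cmod Y = 1"
    and ab: "a\<^sup>2 + b\<^sup>2 = 1" "0 < b" "b < a"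
    and gen: "c * c' * Im x \<noteq> 0" "2 * a * b * c * c' * Re x + s * s' * Re y \<noteq> 0"
  shows "V $ 0 $ 0 = 0 \<or> V $ 0 $ 1 = 0"
proof -
  let ?S = "mat2 (complex_of_real a) 0 0 (complex_of_real b)"
  let ?M = "param_slice a b c s c' s' x y"
  let ?N = "param_slice a b C S C' S' X Y"
  define z where "z = V $ 0 $ 0"
  define w where "w = V $ 0 $ 1"
  note row = unitary2_second_row[OF u(1)]
  have e: "?S = A ** (scale_mat z ?S + scale_mat w ?M) ** transpose B"
      "?N = A ** (scale_mat (V $ 1 $ 0) ?S + scale_mat (V $ 1 $ 1) ?M) ** transpose B"
    using eq unfolding param_pencil_def local_unitary_pencil pencil_eq_iff transform_combination z_def w_def by metis+
  have zw: "(cmod z)\<^sup>2 + (cmod w)\<^sup>2 = 1" using unitary2_norms(1)[OF u(1)] by (simp add: z_def w_def)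
  have "Re (frob ?S ?S) = Re (frob (scale_mat z ?S + scale_mat w ?M) (scale_mat z ?S + scale_mat w ?M))"
    using frob_unitary[OF u(2,3)] e(1) by metis
  then have "Re (z * cnj w * frob ?S ?M) = 0"
    using zw ab by (simp only: frob_combination frob_diag frob_param_slice[OF cs]) simp
  then have r1: "Re (z * cnj w) * (c * c' * Re x + 2 * a * b * s * s' * Re y) + Im (z * cnj w) * (c * c' * (a\<^sup>2 - b\<^sup>2) * Im x) = 0"
    unfolding frob_diag_param_slice ab by (simp add: algebra_simps)
  let ?t = "Complex (2 * a * b * c * c' * Re x + s * s' * (a\<^sup>2 + b\<^sup>2) * Re y) (- (a\<^sup>2 - b\<^sup>2) * s * s' * Im y)"
  have dAB: "cmod (det2 (A ** Q ** transpose B)) = cmod (det2 Q)" for Q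
    using unitary_det2[OF u(2)] unitary_det2[OF u(3)] by (simp add: det2_mult norm_mult)
  have "cmod (det2 ?S) = cmod (det2 ?N)"
    by (simp add: det2_param_slice[OF CS]) (simp add: det2_def)
  then have "cmod (det2 (scale_mat z ?S + scale_mat w ?M)) =
      cmod (det2 (scale_mat (V $ 1 $ 0) ?S + scale_mat (V $ 1 $ 1) ?M))"
    using e dAB by metis
  \<comment> \<open>Unitarity expresses the second row through the first, so both new slices are
    governed by \<open>(z, w)\<close> alone.\<close>
  also have "scale_mat (V $ 1 $ 0) ?S + scale_mat (V $ 1 $ 1) ?M =
      scale_mat (det2 V) (scale_mat (- cnj w) ?S + scale_mat (cnj z) ?M)"
    unfolding row by (simp add: mat2_eq_iff z_def w_def algebra_simps)
  also have "cmod (det2 \<dots>) = cmod (det2 (scale_mat (- cnj w) ?S + scale_mat (cnj z) ?M))"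
    using unitary_det2[OF u(1)] by (simp add: det2_scale norm_mult norm_power)
  also have "det2 (scale_mat (- cnj w) ?S + scale_mat (cnj z) ?M) =
      complex_of_real (a * b) * (cnj z ^ 2 + cnj w ^ 2) - ?t * (cnj z * cnj w)"
    unfolding det2_pencil_combination[OF cs] by (simp add: algebra_simps)
  finally have "(cmod (complex_of_real (a * b) * (z\<^sup>2 + w\<^sup>2) + ?t * (z * w)))\<^sup>2
     - (cmod (complex_of_real (a * b) * (cnj z ^ 2 + cnj w ^ 2) - ?t * (cnj z * cnj w)))\<^sup>2 = 0"
    unfolding det2_pencil_combination[OF cs] by simp
  \<comment> \<open>The remaining factor is four times \<open>a b\<close> times the real part of
    \<open>?t\<close>, which is non-zero by the second genericity assumption.\<close>
  then have r2: "Re (z * cnj w) = 0"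
    unfolding quadratic_form_antipodal zw using gen(2) ab by simp
  have "a\<^sup>2 - b\<^sup>2 \<noteq> 0" using ab(2,3) by (simp add: power2_eq_iff)
  moreover have "Im (z * cnj w) * (c * c' * (a\<^sup>2 - b\<^sup>2) * Im x) = 0"
    using r1 unfolding r2 by (simp only: mult_zero_left add_0)
  ultimately have "Im (z * cnj w) = 0" using gen(1) by (auto simp only: mult_eq_0_iff)
  with r2 have "z * cnj w = 0" by (simp only: complex_eq_iff zero_complex.sel simp_thms)
  then show ?thesis by (auto simp: z_def w_def)
qed

lemma scaled_norm_swap:
  fixes u v :: complex and a b :: real
  shows "(cmod (b * v - a * u))\<^sup>2 - (cmod (b * u - a * v))\<^sup>2 = (a\<^sup>2 - b\<^sup>2) * ((cmod u)\<^sup>2 - (cmod v)\<^sup>2)"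
  unfolding cmod_power2 by (simp add: power2_eq_square algebra_simps)

text \<open>With \<open>V\<close> diagonal each slice only acquires a phase besides the action on
  qubits 2 and 3. The singular values of the seed are distinct and non-zero, so matrices preserving
  it up to a phase are diagonal, and the slices can be compared entry by entry.\<close>

lemma diagonal_equivalence_parameters:
  assumes eq: "(V \<otimes>\<^sub>m A \<otimes>\<^sub>m B) *v param_pencil a b c s c' s' x y = param_pencil a b C S C' S' X Y"
    and u: "unitary_mat V" "unitary_mat A" "unitary_mat B"
    and V: "V $ 0 $ 1 = 0"
    and cs: "c\<^sup>2 + s\<^sup>2 = 1" "c'\<^sup>2 + s'\<^sup>2 = 1" "cmod x = 1" "cmod y = 1"
    and CS: "C\<^sup>2 + S\<^sup>2 = 1" "C'\<^sup>2 + S'\<^sup>2 = 1" "cmod X = 1" "cmod Y = 1"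
    and nn: "0 \<le> c" "0 \<le> s" "0 \<le> c'" "0 \<le> s'" "0 \<le> C" "0 \<le> S" "0 \<le> C'" "0 \<le> S'"
    and ab: "0 < b" "b < a"
    and gen: "c * c' \<noteq> 0" "s * s' \<noteq> 0"
  shows "C = c \<and> C' = c' \<and> (X = x \<and> Y = y \<or> X = - x \<and> Y = - y)"
proof -
  let ?S = "mat2 (complex_of_real a) 0 0 (complex_of_real b)"
  define M where "M = param_slice a b c s c' s' x y"
  define N where "N = param_slice a b C S C' S' X Y"
  define v where "v = V $ 0 $ 0"
  have V10: "V $ 1 $ 0 = 0" using unitary2_second_row(1)[OF u(1)] V by simp
  define v' where "v' = V $ 1 $ 1"
  have v: "cmod v = 1" "cmod v' = 1"
    using unitary2_norms[OF u(1)] V by (simp_all add: v_def v'_def power2_eq_1_iff) (smt (verit) norm_ge_zero)+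
  have e: "?S = scale_mat v (A ** ?S ** transpose B)" "N = scale_mat v' (A ** M ** transpose B)"
    using eq unfolding param_pencil_def local_unitary_pencil pencil_eq_iff V V10
    by (simp_all add: v_def v'_def mat2_eq_iff M_def N_def)
  have B1: "transpose B ** conj_mat B = mat 1"
  proof -
    have "transpose B ** conj_mat B = transpose (adjoint_mat B ** B)"
      by (simp add: mat2_eq_iff mult_nth_two algebra_simps)
    then show ?thesis using unitary_mult_cancel(1)[OF u(3)] by simp
  qed
  have "?S ** conj_mat B = scale_mat v (A ** ?S ** (transpose B ** conj_mat B))"
    by (subst e(1)) (simp add: mat2_eq_iff mult_nth_two algebra_simps)
  then have h: "?S ** conj_mat B = scale_mat v (A ** ?S)" by (simp add: B1)
  then have h': "a * cnj (B $ 0 $ 1) = v * (A $ 0 $ 1 * b)" "b * cnj (B $ 1 $ 0) = v * (A $ 1 $ 0 * a)"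
    "a * cnj (B $ 0 $ 0) = v * (A $ 0 $ 0 * a)" "b * cnj (B $ 1 $ 1) = v * (A $ 1 $ 1 * b)"
    by (simp_all add: mat2_eq_iff mult_nth_two)
  have "cmod (a * cnj (B $ 0 $ 1)) = cmod (v * (A $ 0 $ 1 * b))" "cmod (b * cnj (B $ 1 $ 0)) = cmod (v * (A $ 1 $ 0 * a))"
    using h' by simp_all
  \<comment> \<open>The two off-diagonal entries of a 2x2 unitary have the same modulus, which gives
    two relations with \<open>a\<close> and \<open>b\<close> exchanged; together they force both
    moduli to vanish.\<close>
  then have "a * cmod (B $ 0 $ 1) = b * cmod (A $ 0 $ 1)" "b * cmod (B $ 0 $ 1) = a * cmod (A $ 0 $ 1)"
    using ab v by (simp_all add: norm_mult mult.commute unitary2_norms(2)[OF u(2)] unitary2_norms(2)[OF u(3)])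
  then have "(a * a - b * b) * cmod (A $ 0 $ 1) = 0" "(a * a - b * b) * cmod (B $ 0 $ 1) = 0" by algebra+
  moreover have "a * a - b * b \<noteq> 0"
    using ab mult_strict_mono[of b a b a] by simp
  ultimately have off: "A $ 0 $ 1 = 0" "B $ 0 $ 1 = 0" "A $ 1 $ 0 = 0" "B $ 1 $ 0 = 0"
    using unitary2_norms(2)[OF u(2)] unitary2_norms(2)[OF u(3)] by auto
  define p where "p = A $ 0 $ 0" define q where "q = A $ 1 $ 1"
  define r where "r = B $ 0 $ 0" define t where "t = B $ 1 $ 1"
  have un: "cmod p = 1" "cmod q = 1" "cmod r = 1" "cmod t = 1"
    using unitary2_norms[OF u(2)] unitary2_norms[OF u(3)] off
    by (simp_all add: p_def q_def r_def t_def power2_eq_1_iff) (smt (verit) norm_ge_zero)+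
  have S: "v * (p * r) = 1" "v * (q * t) = 1"
    using e(1) ab by (auto simp: mat2_eq_iff mult_nth_two off p_def q_def r_def t_def mult_ac)
  \<comment> \<open>The relative phase of the two slices. It multiplies both diagonal entries, and
    the equal determinants of \<open>M\<close> and \<open>N\<close> make it a sign.\<close>
  define \<epsilon> where "\<epsilon> = v' * cnj v"
  have pr: "v' * (p * r) = \<epsilon>" "v' * (q * t) = \<epsilon>"
  proof -
    have "cnj v * (v * k) = k" for k
      using cnj_mult_self[OF v(1)] by (simp add: mult.assoc[symmetric])
    from this[of "p * r"] this[of "q * t"] have "p * r = cnj v" "q * t = cnj v"
      unfolding S by simp_all
    then show "v' * (p * r) = \<epsilon>" "v' * (q * t) = \<epsilon>" by (simp_all add: \<epsilon>_def)
  qed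
  have N: "N $ 0 $ 0 = v' * (p * r) * M $ 0 $ 0" "N $ 1 $ 1 = v' * (q * t) * M $ 1 $ 1"
    "N $ 0 $ 1 = v' * (p * t) * M $ 0 $ 1" "N $ 1 $ 0 = v' * (q * r) * M $ 1 $ 0"
    using e(2) by (auto simp: mat2_eq_iff mult_nth_two off p_def q_def r_def t_def mult_ac)
  have n01: "cmod (N $ 0 $ 1) = cmod (M $ 0 $ 1)" "cmod (N $ 1 $ 0) = cmod (M $ 1 $ 0)"
    by (simp_all add: N norm_mult un v)
  have "det2 N = (v' * (p * r)) * (v' * (q * t)) * det2 M"
    by (simp add: det2_def N algebra_simps)
  then have "\<epsilon>\<^sup>2 = 1"
    unfolding pr using ab by (simp add: M_def N_def det2_param_slice[OF cs] det2_param_slice[OF CS] power2_eq_square)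
  then have eps: "\<epsilon> = 1 \<or> \<epsilon> = - 1" by (simp add: power2_eq_1_iff)
  \<comment> \<open>Up to conjugating the second, the diagonal entries are \<open>a P + b Q\<close>
    and \<open>b P + a Q\<close>, an invertible system because \<open>a\<close> and \<open>b\<close>
    have different squares.\<close>
  define P where "P = c * c' * x" define Q where "Q = s * s' * y"
  define P' where "P' = C * C' * X" define Q' where "Q' = S * S' * Y"
  have "a * P' + b * Q' = \<epsilon> * (a * P + b * Q)"
    using N(1) unfolding pr by (simp add: M_def N_def param_slice_def P_def Q_def P'_def Q'_def mult_ac)
  moreover have "b * P' + a * Q' = \<epsilon> * (b * P + a * Q)"
  proof -
    have "cnj (N $ 1 $ 1) = cnj (\<epsilon> * M $ 1 $ 1)" using N(2) unfolding pr by simp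
    moreover have "cnj \<epsilon> = \<epsilon>" using eps by auto
    ultimately show ?thesis by (simp add: M_def N_def param_slice_def P_def Q_def P'_def Q'_def algebra_simps)
  qed
  ultimately have "(complex_of_real a * a - complex_of_real b * b) * (P' - \<epsilon> * P) = 0"
      "(complex_of_real a * a - complex_of_real b * b) * (Q' - \<epsilon> * Q) = 0"
    by algebra+
  moreover have "complex_of_real a * a - complex_of_real b * b \<noteq> 0"
    using \<open>a * a - b * b \<noteq> 0\<close> by (metis of_real_diff of_real_eq_0_iff of_real_mult)
  ultimately have PQ: "P' = \<epsilon> * P" "Q' = \<epsilon> * Q" by simp_all
  have "cmod P' = cmod P" "cmod Q' = cmod Q" unfolding PQ using eps by auto
  then have cc: "C * C' = c * c'" "S * S' = s * s'"
    using nn cs CS by (simp_all add: P_def Q_def P'_def Q'_def norm_mult)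
  \<comment> \<open>The moduli of the off-diagonal entries survive the unknown phases. The
    difference of their squares yields \<open>c\<^sup>2 - c'\<^sup>2\<close>, while
    \<open>cc\<close> yields the sum.\<close>
  have "cmod (b * (s * c' * y) - a * (c * s' * x)) = cmod (b * (S * C' * Y) - a * (C * S' * X))"
    using n01(1) by (simp add: M_def N_def param_slice_def mult_ac)
  moreover have "cmod (b * (c * s' * x) - a * (s * c' * y)) = cmod (b * (C * S' * X) - a * (S * C' * Y))"
  proof -
    have "cmod (cnj (M $ 1 $ 0)) = cmod (cnj (N $ 1 $ 0))" using n01(2) by simp
    then show ?thesis by (simp add: M_def N_def param_slice_def mult_ac del: complex_mod_cnj)
  qed
  ultimately have "(a\<^sup>2 - b\<^sup>2) * ((cmod (c * s' * x))\<^sup>2 - (cmod (s * c' * y))\<^sup>2) =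
      (a\<^sup>2 - b\<^sup>2) * ((cmod (C * S' * X))\<^sup>2 - (cmod (S * C' * Y))\<^sup>2)"
    unfolding scaled_norm_swap[symmetric] by simp
  then have "(c * s')\<^sup>2 - (s * c')\<^sup>2 = (C * S')\<^sup>2 - (S * C')\<^sup>2"
    using \<open>a * a - b * b \<noteq> 0\<close> cs(3,4) CS(3,4) nn by (simp add: norm_mult power_mult_distrib power2_eq_square)
  moreover have "(k * s1)\<^sup>2 - (s2 * k')\<^sup>2 = k\<^sup>2 - k'\<^sup>2" if "k\<^sup>2 + s2\<^sup>2 = 1" "k'\<^sup>2 + s1\<^sup>2 = 1" for k k' s1 s2 :: real
    using that by algebra
  ultimately have d: "c\<^sup>2 - c'\<^sup>2 = C\<^sup>2 - C'\<^sup>2" using cs CS by metis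
  have "(k * k')\<^sup>2 - (s2 * s1)\<^sup>2 = k\<^sup>2 + k'\<^sup>2 - 1" if "k\<^sup>2 + s2\<^sup>2 = 1" "k'\<^sup>2 + s1\<^sup>2 = 1" for k k' s1 s2 :: real
    using that by algebra
  then have "c\<^sup>2 + c'\<^sup>2 - 1 = C\<^sup>2 + C'\<^sup>2 - 1" using cs CS cc by metis
  with d have "C\<^sup>2 = c\<^sup>2" "C'\<^sup>2 = c'\<^sup>2" by simp_all
  then have c: "C = c" "C' = c'" using nn by (simp_all add: power2_eq_iff_nonneg)
  have "X = \<epsilon> * x" using PQ(1) gen(1) by (simp add: P_def P'_def c mult_ac)
  moreover have "Y = \<epsilon> * y"
  proof -
    have "complex_of_real (S * S') * Y = complex_of_real (s * s') * (\<epsilon> * y)"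
      using PQ(2) by (simp add: Q_def Q'_def mult_ac)
    then show ?thesis using gen(2) by (simp add: cc(2) del: of_real_mult)
  qed
  ultimately show ?thesis using eps c by auto
qed

text \<open>An antidiagonal \<open>V\<close> becomes diagonal after composition with the exchange of
  slices, at the price of conjugating \<open>x\<close>. The conclusion keeps the quantities that
  survive this conjugation and the joint sign change, and from which the measures are
  computed.\<close>

lemma generic_parameters_unique:
  assumes LU: "LU_equivalent (param_pencil a b c s c' s' x y) (param_pencil a b C S C' S' X Y)"
    and cs: "c\<^sup>2 + s\<^sup>2 = 1" "c'\<^sup>2 + s'\<^sup>2 = 1" "cmod x = 1" "cmod y = 1"
    and CS: "C\<^sup>2 + S\<^sup>2 = 1" "C'\<^sup>2 + S'\<^sup>2 = 1" "cmod X = 1" "cmod Y = 1"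
    and nn: "0 \<le> c" "0 \<le> s" "0 \<le> c'" "0 \<le> s'" "0 \<le> C" "0 \<le> S" "0 \<le> C'" "0 \<le> S'"
    and ab: "a\<^sup>2 + b\<^sup>2 = 1" "0 < b" "b < a"
    and gen: "c * c' * Im x \<noteq> 0" "s * s' \<noteq> 0" "2 * a * b * c * c' * Re x + s * s' * Re y \<noteq> 0"
  shows "C = c \<and> C' = c' \<and> (Re X)\<^sup>2 = (Re x)\<^sup>2 \<and> (Im Y)\<^sup>2 = (Im y)\<^sup>2 \<and> Re X * Re Y = Re x * Re y"
proof -
  obtain V A B where u: "unitary_mat V" "unitary_mat A" "unitary_mat B"
    and eq: "(V \<otimes>\<^sub>m A \<otimes>\<^sub>m B) *v param_pencil a b c s c' s' x y = param_pencil a b C S C' S' X Y"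
    using LU unfolding LU_equivalent_def by metis
  have cc: "c * c' \<noteq> 0" using gen by auto
  from first_unitary_monomial[OF eq u cs CS ab gen(1,3)] show ?thesis
  proof
    assume "V $ 0 $ 1 = 0"
    from diagonal_equivalence_parameters[OF eq u this cs CS nn ab(2,3) cc gen(2)] show ?thesis by auto
  next
    assume V: "V $ 0 $ 0 = 0"
    have xc: "cmod (cnj x) = 1" using cs by simp
    obtain A' B' where u': "unitary_mat A'" "unitary_mat B'"
      and eq': "(mat2 0 1 1 0 \<otimes>\<^sub>m A' \<otimes>\<^sub>m B') *v param_pencil a b c s c' s' (cnj x) y = param_pencil a b c s c' s' x y"
      using param_pencil_swap[OF cs(1,2) xc cs(4), of a b] by auto
    let ?F = "mat2 0 1 1 0"
    have e: "((V ** ?F) \<otimes>\<^sub>m (A ** A') \<otimes>\<^sub>m (B ** B')) *v param_pencil a b c s c' s' (cnj x) y = param_pencil a b C S C' S' X Y"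
      unfolding eq[symmetric] eq'[symmetric] by (simp add: matrix_vector_mul_assoc tensor_mat_mult)
    have VF: "(V ** ?F) $ 0 $ 1 = 0" by (simp add: mult_nth_two V)
    from diagonal_equivalence_parameters[OF e unitary_mult[OF u(1) unitary_swap] unitary_mult[OF u(2) u'(1)]
        unitary_mult[OF u(3) u'(2)] VF cs(1,2) xc cs(4) CS nn ab(2,3) cc gen(2)]
    show ?thesis by auto
  qed
qed


subsection \<open>Existence of decompositions\<close>

lemma hermitian2_diagonalization:
  fixes p r :: real and z :: complex
  obtains V :: "complex^2^2" and l m :: real
  where "unitary_mat V" "m \<le> l" "mat2 p z (cnj z) r = V ** mat2 l 0 0 m ** adjoint_mat V"
proof -
  \<comment> \<open>In polar coordinates the modulus is half the spectral gap, and half the argument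
    is the diagonalising rotation angle once the phase of \<open>z\<close> is split off.\<close>
  let ?\<zeta> = "Complex ((p - r) / 2) (cmod z)"
  define g where "g = cmod ?\<zeta>"
  define h where "h = Arg ?\<zeta> / 2"
  define e where "e = cis (Arg z)"
  have "?\<zeta> = rcis g (2 * h)" by (simp add: g_def h_def rcis_cmod_Arg)
  then have "Re ?\<zeta> = g * cos (2 * h)" "Im ?\<zeta> = g * sin (2 * h)" by (metis Re_rcis, metis Im_rcis)
  then have gh: "p - r = 2 * g * (cos h * cos h - sin h * sin h)" "cmod z = 2 * g * (sin h * cos h)"
    by (simp_all add: cos_double sin_double power2_eq_square)
  have e: "cmod e = 1" by (simp add: e_def)
  have z: "z = cmod z * e" by (metis e_def rcis_cmod_Arg rcis_def)
  have sc: "cos h * cos h + sin h * sin h = 1" using sin_cos_squared_add3[of h] by simp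
  then have scc: "complex_of_real (cos h) * cos h + complex_of_real (sin h) * sin h = 1"
    by (metis of_real_1 of_real_add of_real_mult)
  let ?V = "mat2 (e * cos h) (- e * sin h) (sin h) (cos h)"
  let ?l = "(p + r) / 2 + g" and ?m = "(p + r) / 2 - g"
  note ee = cnj_mult_self[OF e]
  have 1: "unitary_mat ?V"
  proof -
    have "e * cos h * cnj (e * cos h) + sin h * cnj (sin h) = (e * cnj e) * (complex_of_real (cos h) * cos h) + complex_of_real (sin h) * sin h"
      "- e * sin h * cnj (- e * sin h) + cos h * cnj (cos h) = (e * cnj e) * (complex_of_real (sin h) * sin h) + complex_of_real (cos h) * cos h"
      "- e * sin h * cnj (e * cos h) + cos h * cnj (sin h) = - (e * cnj e) * (complex_of_real (sin h) * cos h) + complex_of_real (cos h) * sin h"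
      by (simp_all add: algebra_simps)
    then show ?thesis using scc by (simp add: unitary_mat2_iff ee add.commute)
  qed
  have pr: "p = ?l * (cos h * cos h) + ?m * (sin h * sin h)" "r = ?l * (sin h * sin h) + ?m * (cos h * cos h)"
    using gh(1) sc by algebra+
  have zz: "z = e * ((?l - ?m) * (sin h * cos h))"
    using gh(2) by (subst z) (simp add: mult_ac)
  have "mat2 (e * C) (- e * S) S C ** mat2 l 0 0 m ** adjoint_mat (mat2 (e * C) (- e * S) S C) =
     mat2 ((e * cnj e) * complex_of_real (l * (C * C) + m * (S * S))) (e * ((l - m) * (S * C)))
       (cnj (e * ((l - m) * (S * C)))) (complex_of_real (l * (S * S) + m * (C * C)))" for C S l m :: real
    by (simp add: mat2_eq_iff mult_nth_two algebra_simps)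
  from this[of "cos h" "sin h" ?l ?m] have "mat2 p z (cnj z) r = ?V ** mat2 ?l 0 0 ?m ** adjoint_mat ?V"
    unfolding ee pr[symmetric] mult_1 zz[symmetric] by metis
  with 1 show ?thesis by (intro that[of ?V ?m ?l]) (simp_all add: g_def)
qed

lemma unit_phase: obtains e where "cmod e = 1" "z = complex_of_real (cmod z) * e"
  by (metis norm_cis rcis_cmod_Arg rcis_def)

text \<open>Diagonalising \<open>N ** adjoint_mat N\<close> leaves \<open>R\<close> with orthogonal
  rows of lengths \<open>a\<close> and \<open>b\<close>. Norm 1 gives \<open>a > 0\<close>, so the
  first row can be normalised; the second is a multiple of the unit vector orthogonal to it.\<close>

lemma singular_value_decomposition:
  fixes N :: "complex^2^2"
  assumes N: "frob N N = 1"
  obtains V W a b where "unitary_mat V" "unitary_mat W" "N = V ** mat2 (complex_of_real a) 0 0 (complex_of_real b) ** transpose W"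
    "b \<le> a" "0 \<le> b" "a\<^sup>2 + b\<^sup>2 = 1" "a * b = cmod (det2 N)"
proof -
  define H where "H = N ** adjoint_mat N"
  define z where "z = H $ 0 $ 1"
  define p where "p = (cmod (N $ 0 $ 0))\<^sup>2 + (cmod (N $ 0 $ 1))\<^sup>2"
  define r where "r = (cmod (N $ 1 $ 0))\<^sup>2 + (cmod (N $ 1 $ 1))\<^sup>2"
  have H: "H = mat2 p z (cnj z) r"
    by (simp add: mat2_eq_iff H_def z_def p_def r_def mult_nth_two complex_norm_square[symmetric] mult.commute
       del: of_real_power)
  obtain V l m where V: "unitary_mat V" and ml: "m \<le> l" and VH: "H = V ** mat2 (complex_of_real l) 0 0 (complex_of_real m) ** adjoint_mat V"
    using hermitian2_diagonalization[of p z r] H by metis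
  define R where "R = adjoint_mat V ** N"
  have VV: "adjoint_mat V ** V = mat 1" "V ** adjoint_mat V = mat 1" using V by (simp_all add: unitary_mat_def)
  have "R ** adjoint_mat R = adjoint_mat V ** H ** V"
    by (simp add: R_def H_def adjoint_mult matrix_mul_assoc)
  also have "\<dots> = (adjoint_mat V ** V) ** mat2 l 0 0 m ** (adjoint_mat V ** V)"
    unfolding VH by (simp only: matrix_mul_assoc)
  finally have RR: "R ** adjoint_mat R = mat2 l 0 0 m" by (simp add: VV)
  then have row: "R $ 0 $ 0 * cnj (R $ 0 $ 0) + R $ 0 $ 1 * cnj (R $ 0 $ 1) = l"
    "R $ 1 $ 0 * cnj (R $ 1 $ 0) + R $ 1 $ 1 * cnj (R $ 1 $ 1) = m"
    "R $ 1 $ 0 * cnj (R $ 0 $ 0) + R $ 1 $ 1 * cnj (R $ 0 $ 1) = 0"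
    by (simp_all add: mat2_eq_iff mult_nth_two)
  have lm: "l + m = 1"
  proof -
    have "trace (R ** adjoint_mat R) = trace (adjoint_mat R ** R)" by (rule trace_mul_sym)
    also have "adjoint_mat R ** R = adjoint_mat N ** (V ** adjoint_mat V) ** N"
      by (simp add: R_def adjoint_mult matrix_mul_assoc)
    also have "trace \<dots> = trace (N ** adjoint_mat N)" by (simp add: VV) (rule trace_mul_sym)
    also have "\<dots> = 1" using N by (simp add: frob_trace)
    finally have "complex_of_real (l + m) = 1" by (simp add: RR trace_def sum_two)
    then show ?thesis by (simp only: of_real_eq_1_iff)
  qed
  have m0: "0 \<le> m"
  proof -
    have "complex_of_real ((cmod (R $ 1 $ 0))\<^sup>2 + (cmod (R $ 1 $ 1))\<^sup>2) = m"
      using row(2) by (simp add: complex_norm_square[symmetric])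
    then have "(cmod (R $ 1 $ 0))\<^sup>2 + (cmod (R $ 1 $ 1))\<^sup>2 = m" by (simp only: of_real_eq_iff)
    then show ?thesis by (metis add_nonneg_nonneg zero_le_power2)
  qed
  define a where "a = sqrt l" define b where "b = sqrt m"
  have l0: "0 < l" using ml lm by simp
  have ab: "a * a = l" "b * b = m" "0 < a" "0 \<le> b" using l0 m0 by (simp_all add: a_def b_def)
  have a2: "complex_of_real a * a = l" "complex_of_real b * b = m" using ab by (metis of_real_mult)+
  define y where "y = R $ 0 $ 0 / a" define w where "w = R $ 0 $ 1 / a"
  have R0: "R $ 0 $ 0 = a * y" "R $ 0 $ 1 = a * w" using ab by (simp_all add: y_def w_def)
  have yw: "y * cnj y + w * cnj w = 1"
  proof -
    have "complex_of_real l * (y * cnj y + w * cnj w) = l"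
      using row(1) unfolding R0 a2(1)[symmetric] by (simp add: algebra_simps)
    then show ?thesis using l0 by simp
  qed
  \<comment> \<open>The multiple is obtained as a determinant, not by dividing by \<open>b\<close>,
    which may be zero.\<close>
  define k where "k = y * R $ 1 $ 1 - w * R $ 1 $ 0"
  have orth: "R $ 1 $ 0 * cnj y + R $ 1 $ 1 * cnj w = 0"
  proof -
    have "complex_of_real a * (R $ 1 $ 0 * cnj y + R $ 1 $ 1 * cnj w) = 0"
      using row(3) unfolding R0 by (simp add: algebra_simps)
    then show ?thesis using ab by simp
  qed
  have R1: "R $ 1 $ 0 = - k * cnj w" "R $ 1 $ 1 = k * cnj y"
    using yw orth unfolding k_def by algebra+
  have "k * cnj k = m"
  proof -
    have "k * cnj k * (y * cnj y + w * cnj w) = m" using row(2) unfolding R1 by (simp add: algebra_simps)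
    then show ?thesis by (simp add: yw)
  qed
  then have "complex_of_real ((cmod k)\<^sup>2) = complex_of_real (b * b)" by (simp add: complex_norm_square[symmetric] ab)
  then have "(cmod k)\<^sup>2 = b\<^sup>2" by (simp only: of_real_eq_iff power2_eq_square)
  then have kb: "cmod k = b" using ab by (simp add: power2_eq_iff_nonneg)
  obtain e where e: "cmod e = 1" "k = complex_of_real (cmod k) * e" by (rule unit_phase)
  then have k: "k = b * e" by (simp add: kb)
  let ?Z = "mat2 y w (- e * cnj w) (e * cnj y)"
  have "unitary_mat (transpose ?Z)"
  proof -
    have "transpose ?Z = mat2 y (- e * cnj w) w (e * cnj y)" by (simp add: mat2_eq_iff)
    moreover have "- e * cnj w * cnj (- e * cnj w) + e * cnj y * cnj (e * cnj y) = (e * cnj e) * (y * cnj y + w * cnj w)"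
      by (simp add: algebra_simps)
    ultimately show ?thesis by (simp add: unitary_mat2_iff yw cnj_mult_self[OF e(1)])
  qed
  moreover have R: "R = mat2 (complex_of_real a) 0 0 (complex_of_real b) ** ?Z"
    by (simp add: mat2_eq_iff mult_nth_two R0 R1 k)
  have NV: "N = V ** mat2 (complex_of_real a) 0 0 (complex_of_real b) ** transpose (transpose ?Z)"
  proof -
    have "N = (V ** adjoint_mat V) ** N" by (simp add: VV)
    also have "\<dots> = V ** R" by (simp only: R_def matrix_mul_assoc)
    finally show ?thesis by (simp add: R matrix_mul_assoc)
  qed
  moreover have "a * b = cmod (det2 N)"
  proof -
    have "cmod (det2 N) = cmod (det2 V) * cmod (det2 (mat2 (complex_of_real a) 0 0 (complex_of_real b))) * cmod (det2 (transpose ?Z))"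
      by (subst NV) (simp add: det2_mult norm_mult)
    also have "\<dots> = a * b" using unitary_det2[OF V] unitary_det2[OF \<open>unitary_mat (transpose ?Z)\<close>] ab
      by (simp add: det2_def norm_mult)
    finally show ?thesis by simp
  qed
  moreover have "b \<le> a" using ml by (simp add: a_def b_def)
  moreover have "a\<^sup>2 + b\<^sup>2 = 1" using ab lm by (simp add: power2_eq_square)
  ultimately show ?thesis using V ab(4) by (intro that)
qed

section \<open>Euler angles and the normal form\<close>

lemma unitary_euler:
  assumes "unitary_mat (U :: complex^2^2)"
  obtains t c s x y where "cmod t = 1" "cmod x = 1" "cmod y = 1" "0 \<le> c" "0 \<le> s" "c\<^sup>2 + s\<^sup>2 = 1"
    "U = scale_mat t (euler_mat c s x y)"
proof -
  \<comment> \<open>A square root of the determinant, split off as a global phase, reduces to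
    determinant 1, where the first row determines the second.\<close>
  obtain t where t: "cmod t = 1" "t\<^sup>2 = det2 U" using unitary_det2[OF assms] by (rule unit_square)
  obtain x where x: "cmod x = 1" "U $ 0 $ 0 * cnj t = complex_of_real (cmod (U $ 0 $ 0 * cnj t)) * x" by (rule unit_phase)
  obtain y where y: "cmod y = 1" "U $ 0 $ 1 * cnj t = complex_of_real (cmod (U $ 0 $ 1 * cnj t)) * y" by (rule unit_phase)
  define c where "c = cmod (U $ 0 $ 0)" define s where "s = cmod (U $ 0 $ 1)"
  have tt: "t * (v * cnj t) = v" for v
    using cnj_mult_self[OF t(1)] by (simp add: mult.left_commute mult.commute)
  have U0: "U $ 0 $ 0 = t * (c * x)" "U $ 0 $ 1 = t * (s * y)"
    using x y tt[of "U $ 0 $ 0"] tt[of "U $ 0 $ 1"] t(1) by (simp_all add: c_def s_def norm_mult)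
  have "U = scale_mat t (euler_mat c s x y)"
  proof -
    have "t\<^sup>2 * cnj (t * v) = t * cnj v" for v
      using tt[of "t * cnj v"] by (simp add: power2_eq_square mult_ac)
    then show ?thesis
      using unitary2_second_row[OF assms] unfolding U0 t(2)[symmetric]
      by (simp add: mat2_eq_iff euler_mat_def U0)
  qed
  moreover have "c\<^sup>2 + s\<^sup>2 = 1" using unitary2_norms(1)[OF assms] by (simp add: c_def s_def)
  moreover have "0 \<le> c" "0 \<le> s" by (simp_all add: c_def s_def)
  ultimately show ?thesis using that t x y by metis
qed

lemma euler_mat_diag:
  "mat2 g 0 0 (cnj g) ** euler_mat c s x y ** mat2 h 0 0 (cnj h) = euler_mat c s (g * x * h) (g * y * cnj h)"
  by (simp add: euler_mat_def mat2_eq_iff mult_nth_two algebra_simps)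

lemma pencil_phase_second:
  assumes "cmod t = 1" shows "LU_equivalent (pencil M (scale_mat t N)) (pencil M N)"
proof (rule LU_pencilI[of "mat2 1 0 0 (cnj t)" "mat 1" "mat 1"])
  have "cnj t * (t * v) = v" for v using cnj_mult_self[OF assms] by (simp add: mult.assoc[symmetric])
  then show "N = scale_mat (mat2 1 0 0 (cnj t) $ 1 $ 0) (mat 1 ** M ** transpose (mat 1)) +
     scale_mat (mat2 1 0 0 (cnj t) $ 1 $ 1) (mat 1 ** scale_mat t N ** transpose (mat 1))"
    by (simp add: mat2_eq_iff)
qed (use cnj_mult_self[OF assms] in \<open>simp_all add: unitary_mat2_iff mat2_eq_iff\<close>)

lemma pencil_local_23:
  assumes "unitary_mat A" "unitary_mat B"
  shows "LU_equivalent (pencil M N) (pencil (A ** M ** transpose B) (A ** N ** transpose B))"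
  by (rule LU_pencilI[of "mat2 1 0 0 1" A B]) (use assms in \<open>simp_all add: unitary_mat2_iff mat2_eq_iff\<close>)

text \<open>\<open>U\<^sub>3\<close> is a pure \<open>Y\<close> rotation, so the diagonal factors of
  \<open>W\<close> must disappear. The right one commutes with the seed and moves over to
  \<open>U\<close>; the left one is cancelled by opposite phases on qubits 2 and 3, which fix the
  seed.\<close>

lemma pencil_to_param_pencil:
  assumes U: "unitary_mat U" "unitary_mat W"
  obtains c s c' s' x y where "0 \<le> c" "0 \<le> s" "c\<^sup>2 + s\<^sup>2 = 1" "0 \<le> c'" "0 \<le> s'" "c'\<^sup>2 + s'\<^sup>2 = 1"
    "cmod x = 1" "cmod y = 1"
    "LU_equivalent (pencil (mat2 (complex_of_real a) 0 0 (complex_of_real b))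
        (U ** mat2 (complex_of_real a) 0 0 (complex_of_real b) ** transpose W)) (param_pencil a b c s c' s' x y)"
proof -
  let ?S = "mat2 (complex_of_real a) 0 0 (complex_of_real b)"
  obtain t c s x y where t: "cmod t = 1" "cmod x = 1" "cmod y = 1" "0 \<le> c" "0 \<le> s" "c\<^sup>2 + s\<^sup>2 = 1"
    and Ue: "U = scale_mat t (euler_mat c s x y)" by (rule unitary_euler[OF U(1)])
  obtain t' c' s' x' y' where t': "cmod t' = 1" "cmod x' = 1" "cmod y' = 1" "0 \<le> c'" "0 \<le> s'" "c'\<^sup>2 + s'\<^sup>2 = 1"
    and We: "W = scale_mat t' (euler_mat c' s' x' y')" by (rule unitary_euler[OF U(2)])
  have "cmod (x' * y') = 1" using t' by (simp add: norm_mult)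
  \<comment> \<open>Chosen to solve \<open>g * h = x'\<close> and \<open>g * cnj h = y'\<close>,
    which splits the phases of \<open>W\<close> into a left and a right diagonal factor.\<close>
  then obtain g where g: "cmod g = 1" "g\<^sup>2 = x' * y'" by (rule unit_square)
  define h where "h = cnj g * x'"
  have h: "cmod h = 1" using g t' by (simp add: h_def norm_mult)
  note gg = cnj_mult_self[OF g(1)] and xx = cnj_mult_self[OF t'(2)] and hh = cnj_mult_self[OF h]
  have gh: "g * h = x'" using gg by (simp add: h_def mult.assoc[symmetric])
  have gh': "g * cnj h = y'"
  proof -
    have "g * cnj h = g\<^sup>2 * cnj x'" by (simp add: h_def power2_eq_square mult_ac)
    also have "\<dots> = (x' * cnj x') * y'" unfolding g(2) by (simp only: mult_ac)
    finally show ?thesis by (simp add: xx)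
  qed
  let ?G = "mat2 g 0 0 (cnj g)" and ?H = "mat2 h 0 0 (cnj h)" and ?G' = "mat2 (cnj g) 0 0 g"
  have W1: "euler_mat c' s' x' y' = ?G ** euler_mat c' s' 1 1 ** ?H"
    by (simp add: euler_mat_diag gh gh')
  have uG: "unitary_mat ?G" "unitary_mat ?G'" using gg by (simp_all add: unitary_mat2_iff)
  have S: "?G ** ?S ** transpose ?G' = ?S"
    using gg by (simp add: mat2_eq_iff mult_nth_two)
  have "?G ** (U ** ?S ** transpose W) ** transpose ?G' =
     scale_mat (t * t') (?G ** euler_mat c s x y ** ?S ** transpose (euler_mat c' s' x' y') ** transpose ?G')"
    unfolding Ue We by (simp add: mat2_eq_iff mult_nth_two algebra_simps)
  also have "?G ** euler_mat c s x y ** ?S ** transpose (euler_mat c' s' x' y') ** transpose ?G'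
     = ?G ** euler_mat c s x y ** (?S ** transpose ?H) ** transpose (euler_mat c' s' 1 1) ** (transpose ?G ** transpose ?G')"
    unfolding W1 matrix_transpose_mul by (simp only: matrix_mul_assoc)
  also have "?S ** transpose ?H = ?H ** ?S" by (simp add: mat2_eq_iff mult_nth_two)
  also have "transpose ?G ** transpose ?G' = mat 1" using gg by (simp add: mat2_eq_iff mult_nth_two) (simp add: mat2_one gg)
  also have "?G ** euler_mat c s x y ** (?H ** ?S) = euler_mat c s (g * x * h) (g * y * cnj h) ** ?S"
    by (simp only: matrix_mul_assoc euler_mat_diag)
  finally have M: "?G ** (U ** ?S ** transpose W) ** transpose ?G' =
      scale_mat (t * t') (param_slice a b c s c' s' (g * x * h) (g * y * cnj h))" by (simp add: param_slice_eq)
  have "LU_equivalent (pencil ?S (U ** ?S ** transpose W))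
      (pencil ?S (scale_mat (t * t') (param_slice a b c s c' s' (g * x * h) (g * y * cnj h))))"
    using pencil_local_23[OF uG, of ?S "U ** ?S ** transpose W"] unfolding S M .
  moreover have "cmod (t * t') = 1" using t t' by (simp add: norm_mult)
  ultimately have "LU_equivalent (pencil ?S (U ** ?S ** transpose W)) (param_pencil a b c s c' s' (g * x * h) (g * y * cnj h))"
    unfolding param_pencil_def using LU_trans pencil_phase_second by blast
  moreover have "cmod (g * x * h) = 1" "cmod (g * y * cnj h) = 1" using g t h by (simp_all add: norm_mult)
  ultimately show ?thesis by (intro that[OF t(4-6) t'(4-6)])
qed

lemma reduce_mod_pi: obtains k :: int where "- pi / 2 < t - k * pi" "t - k * pi \<le> pi / 2"
proof
  \<comment> \<open>The interval is open on the left and closed on the right, hence a ceiling and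
    not a floor.\<close>
  let ?k = "\<lceil>t / pi - 1 / 2\<rceil>"
  have "t / pi - 1 / 2 \<le> ?k" "?k < t / pi - 1 / 2 + 1" by (simp_all add: ceiling_correct) linarith
  then have "(t / pi - 1 / 2) * pi \<le> ?k * pi" "?k * pi < (t / pi + 1 / 2) * pi"
    using pi_gt_zero by (simp_all add: mult_le_cancel_right)
  then show "- pi / 2 < t - ?k * pi" "t - ?k * pi \<le> pi / 2"
    by (simp_all add: algebra_simps)
qed

text \<open>Shifting \<alpha> and \<gamma> by multiples of \<open>pi\<close> multiplies both phases
  by the same sign, since the sum and the difference of two integers have equal parity; the joint
  sign is a local unitary.\<close>

lemma param_pencil_to_decomposition:
  assumes "b \<le> a" "0 \<le> b" "a\<^sup>2 + b\<^sup>2 = 1"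
    and "0 \<le> c" "0 \<le> s" "c\<^sup>2 + s\<^sup>2 = 1" "0 \<le> c'" "0 \<le> s'" "c'\<^sup>2 + s'\<^sup>2 = 1" "cmod x = 1" "cmod y = 1"
  obtains d where "valid_parameters d" "coeff_a d = a" "coeff_b d = b" "LU_equivalent (param_pencil a b c s c' s' x y) (decomposition_pencil d)"
proof -
  obtain \<beta> where \<beta>: "0 \<le> \<beta>" "\<beta> \<le> pi / 2" "c = cos \<beta>" "s = sin \<beta>"
    using sincos_total_pi_half[OF assms(4,5,6)] by metis
  obtain \<beta>' where \<beta>': "0 \<le> \<beta>'" "\<beta>' \<le> pi / 2" "c' = cos \<beta>'" "s' = sin \<beta>'"
    using sincos_total_pi_half[OF assms(7,8,9)] by metis
  define \<sigma> where "\<sigma> = Arg x" define \<delta> where "\<delta> = Arg y"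
  have xy: "x = cis \<sigma>" "y = cis \<delta>" using rcis_cmod_Arg[of x] rcis_cmod_Arg[of y] assms(10,11)
    by (simp_all add: \<sigma>_def \<delta>_def rcis_def)
  obtain k :: int where k: "- pi / 2 < (\<sigma> + \<delta>) / 2 - k * pi" "(\<sigma> + \<delta>) / 2 - k * pi \<le> pi / 2" by (rule reduce_mod_pi)
  obtain m :: int where m: "- pi / 2 < (\<sigma> - \<delta>) / 2 - m * pi" "(\<sigma> - \<delta>) / 2 - m * pi \<le> pi / 2" by (rule reduce_mod_pi)
  define d where "d = \<lparr>coeff_a = a, coeff_b = b, ang_alpha = (\<sigma> + \<delta>) / 2 - k * pi, ang_beta = \<beta>,
     ang_gamma = (\<sigma> - \<delta>) / 2 - m * pi, ang_beta' = \<beta>'\<rparr>"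
  have v: "valid_parameters d" using assms \<beta> \<beta>' k m by (simp add: valid_parameters_def d_def)
  define \<epsilon> where "\<epsilon> = cis (- ((k + m) * pi))"
  have "\<epsilon> * \<epsilon> = cis (2 * pi * (- (k + m)))" by (simp add: \<epsilon>_def cis_mult algebra_simps)
  also have "\<dots> = 1" by (rule cis_multiple_2pi) simp
  finally have eps: "\<epsilon> = 1 \<or> \<epsilon> = - 1" by (simp add: square_eq_1_iff)
  have "cis (2 * pi * m) = 1" by (rule cis_multiple_2pi) simp
  moreover have "cis (\<delta> + (- ((k + m) * pi) + 2 * pi * m)) = cis \<delta> * (\<epsilon> * cis (2 * pi * m))"
    unfolding \<epsilon>_def cis_mult ..
  moreover have "\<delta> + (- ((k + m) * pi) + 2 * pi * m) = (\<sigma> + \<delta>) / 2 - k * pi - ((\<sigma> - \<delta>) / 2 - m * pi)"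
    by (simp add: field_simps)
  ultimately have 1: "cis ((\<sigma> + \<delta>) / 2 - k * pi - ((\<sigma> - \<delta>) / 2 - m * pi)) = \<epsilon> * y"
    by (metis xy(2) mult.commute mult_1_right)
  have "cis (\<sigma> + - ((k + m) * pi)) = cis \<sigma> * \<epsilon>" unfolding \<epsilon>_def cis_mult ..
  moreover have "\<sigma> + - ((k + m) * pi) = (\<sigma> + \<delta>) / 2 - k * pi + ((\<sigma> - \<delta>) / 2 - m * pi)"
    by (simp add: field_simps)
  ultimately have 2: "cis ((\<sigma> + \<delta>) / 2 - k * pi + ((\<sigma> - \<delta>) / 2 - m * pi)) = \<epsilon> * x"
    by (metis xy(1) mult.commute)
  have "decomposition_pencil d = param_pencil a b c s c' s' (\<epsilon> * x) (\<epsilon> * y)"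
    by (simp only: decomposition_pencil_def d_def decomposition.select_convs 1 2 \<beta> \<beta>')
  then have "LU_equivalent (param_pencil a b c s c' s' x y) (decomposition_pencil d)"
    using eps LU_refl param_pencil_neg by auto
  with v show ?thesis by (intro that[of d]) (simp_all add: d_def)
qed

lemma ordered_pair_determined:
  fixes a b a' b' :: real
  assumes "b \<le> a" "0 \<le> b" "a\<^sup>2 + b\<^sup>2 = 1" "b' \<le> a'" "0 \<le> b'" "a'\<^sup>2 + b'\<^sup>2 = 1" "a * b = a' * b'"
  shows "a = a'" "b = b'"
proof -
  have "(a + b)\<^sup>2 = (a' + b')\<^sup>2" "(a - b)\<^sup>2 = (a' - b')\<^sup>2"
    using assms(3,6,7) by algebra+
  then have "a + b = a' + b'" "a - b = a' - b'" using assms by (simp_all add: power2_eq_iff_nonneg)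
  then show "a = a'" "b = b'" by simp_all
qed

text \<open>The determinant modulus fixes the singular values of a normalised slice, so equal moduli
  give both slices the same seed up to unitaries. Undoing those of the first slice leaves a pencil
  of the required form.\<close>

lemma decomposition_exists:
  assumes "frob N0 N0 = 1" "frob N1 N1 = 1" "cmod (det2 N0) = cmod (det2 N1)"
  obtains d where "valid_parameters d" "coeff_a d * coeff_b d = cmod (det2 N0)"
    "LU_equivalent (pencil N0 N1) (decomposition_pencil d)"
proof -
  obtain V W a b where V: "unitary_mat V" "unitary_mat W"
    and N0: "N0 = V ** mat2 (complex_of_real a) 0 0 (complex_of_real b) ** transpose W"
    and ab: "b \<le> a" "0 \<le> b" "a\<^sup>2 + b\<^sup>2 = 1" "a * b = cmod (det2 N0)"
    by (rule singular_value_decomposition[OF assms(1)])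
  obtain V' W' a' b' where V': "unitary_mat V'" "unitary_mat W'"
    and N1: "N1 = V' ** mat2 (complex_of_real a') 0 0 (complex_of_real b') ** transpose W'"
    and ab': "b' \<le> a'" "0 \<le> b'" "a'\<^sup>2 + b'\<^sup>2 = 1" "a' * b' = cmod (det2 N1)"
    by (rule singular_value_decomposition[OF assms(2)])
  have eq: "a' = a" "b' = b"
    using ordered_pair_determined[OF ab'(1-3) ab(1-3)] ab(4) ab'(4) assms(3) by simp_all
  let ?S = "mat2 (complex_of_real a) 0 0 (complex_of_real b)"
  have WT: "transpose W ** transpose (adjoint_mat W) = mat 1"
    using unitary_mult_cancel(1)[OF V(2)] by (metis matrix_transpose_mul transpose_mat)
  have "adjoint_mat V ** N0 ** transpose (adjoint_mat W) = (adjoint_mat V ** V) ** ?S ** (transpose W ** transpose (adjoint_mat W))"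
    unfolding N0 by (simp only: matrix_mul_assoc)
  then have 0: "adjoint_mat V ** N0 ** transpose (adjoint_mat W) = ?S" by (simp add: WT unitary_mult_cancel(1)[OF V(1)])
  have 1: "adjoint_mat V ** N1 ** transpose (adjoint_mat W) = (adjoint_mat V ** V') ** ?S ** transpose (adjoint_mat W ** W')"
    unfolding N1 eq matrix_transpose_mul by (simp only: matrix_mul_assoc)
  have LU1: "LU_equivalent (pencil N0 N1) (pencil ?S ((adjoint_mat V ** V') ** ?S ** transpose (adjoint_mat W ** W')))"
    using pencil_local_23[OF unitary_adjoint[OF V(1)] unitary_adjoint[OF V(2)], of N0 N1] unfolding 0 1 .
  obtain c s c' s' x y where p: "0 \<le> c" "0 \<le> s" "c\<^sup>2 + s\<^sup>2 = 1" "0 \<le> c'" "0 \<le> s'" "c'\<^sup>2 + s'\<^sup>2 = 1"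
      "cmod x = 1" "cmod y = 1"
    and LU2: "LU_equivalent (pencil ?S ((adjoint_mat V ** V') ** ?S ** transpose (adjoint_mat W ** W'))) (param_pencil a b c s c' s' x y)"
    by (rule pencil_to_param_pencil[OF unitary_mult[OF unitary_adjoint[OF V(1)] V'(1)] unitary_mult[OF unitary_adjoint[OF V(2)] V'(2)]])
  obtain d where d: "valid_parameters d" "coeff_a d = a" "coeff_b d = b" "LU_equivalent (param_pencil a b c s c' s' x y) (decomposition_pencil d)"
    by (rule param_pencil_to_decomposition[OF ab(1-3) p])
  show ?thesis
    by (rule that[OF d(1)]) (simp add: d(2,3) ab(4), rule LU_trans[OF LU1 LU_trans[OF LU2 d(4)]])
qed


text \<open>
  The slices are rotated by the unitary with rows \<open>(C, \<i> e S)\<close>, \<open>(\<i> cnj e S, C)\<close>. The phase \<open>e\<close> keeps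
  their norms equal, and the angle maximises their common determinant.
\<close>

lemma better_decomposition:
  assumes cs: "c\<^sup>2 + s\<^sup>2 = 1" "c'\<^sup>2 + s'\<^sup>2 = 1" "cmod x = 1" "cmod y = 1"
    and ab: "a\<^sup>2 + b\<^sup>2 = 1" "0 < b" "b < a"
    and nz: "s * s' * Im y \<noteq> 0"
    and deg: "c * c' * Im x = 0 \<or> 2 * a * b * c * c' * Re x + s * s' * Re y = 0"
  obtains d where "valid_parameters d" "LU_equivalent (param_pencil a b c s c' s' x y) (decomposition_pencil d)"
    "a * b < coeff_a d * coeff_b d"
proof -
  let ?S = "mat2 (complex_of_real a) 0 0 (complex_of_real b)"
  define M where "M = param_slice a b c s c' s' x y"
  define F where "F = frob ?S M"
  have F: "F = Complex (c * c' * (a\<^sup>2 + b\<^sup>2) * Re x + 2 * a * b * s * s' * Re y) (- c * c' * (a\<^sup>2 - b\<^sup>2) * Im x)"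
    by (simp only: F_def M_def frob_diag_param_slice)
  define t where "t = Complex (2 * a * b * c * c' * Re x + s * s' * (a\<^sup>2 + b\<^sup>2) * Re y) (- (a\<^sup>2 - b\<^sup>2) * s * s' * Im y)"
  have "a\<^sup>2 - b\<^sup>2 \<noteq> 0" using ab(2,3) by (simp add: power2_eq_iff)
  then have t0: "Im t \<noteq> 0" using nz by (simp add: t_def)
  define m where "m = a * b"
  \<comment> \<open>The norms stay equal if \<open>cnj e * F\<close> is real, the determinant moduli
    if \<open>Re t * Im e = 0\<close>. Either degeneracy leaves room for both: a real
    \<open>F\<close> allows \<open>e = 1\<close>, and \<open>Re t = 0\<close> allows the phase of
    \<open>F\<close>.\<close>
  have "\<exists>e. cmod e = 1 \<and> Im (cnj e * F) = 0 \<and> Re t * Im e = 0"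
    using deg
  proof
    assume "c * c' * Im x = 0"
    then show ?thesis by (intro exI[of _ 1]) (auto simp: F)
  next
    assume 0: "2 * a * b * c * c' * Re x + s * s' * Re y = 0"
    obtain e where e: "cmod e = 1" "F = complex_of_real (cmod F) * e" by (rule unit_phase)
    have "cnj e * F = complex_of_real (cmod F)"
      using cnj_mult_self[OF e(1)] by (subst e(2)) (simp add: mult.left_commute)
    then show ?thesis using 0 e(1) ab by (intro exI[of _ e]) (simp add: t_def)
  qed
  then obtain e where e: "cmod e = 1" "Im (cnj e * F) = 0" "Re t * Im e = 0" by blast
  note ee = cnj_mult_self[OF e(1)]
  \<comment> \<open>As a function of the angle, \<open>P\<close> below is
    \<open>m * Re e * cos (2 * h) - Im t / 2 * sin (2 * h)\<close>; it attains its amplitude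
    \<open>G\<close> when \<open>2 * h\<close> is the argument of \<open>?\<zeta>\<close>.\<close>
  let ?\<zeta> = "Complex (m * Re e) (- Im t / 2)"
  define G where "G = cmod ?\<zeta>"
  define h where "h = Arg ?\<zeta> / 2"
  define C where "C = cos h"
  define S where "S = sin h"
  have CS: "C * C + S * S = 1" using sin_cos_squared_add3[of h] by (simp add: C_def S_def)
  have "?\<zeta> = rcis G (2 * h)" by (simp add: G_def h_def rcis_cmod_Arg)
  then have "Re ?\<zeta> = G * cos (2 * h)" "Im ?\<zeta> = G * sin (2 * h)" by (metis Re_rcis, metis Im_rcis)
  then have G: "m * Re e = G * (C * C - S * S)" "- Im t = 4 * G * (S * C)"
    by (simp_all add: cos_double sin_double power2_eq_square C_def S_def)
  let ?z = "complex_of_real C" and ?w = "\<i> * e * complex_of_real S"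
  let ?z' = "\<i> * cnj e * complex_of_real S" and ?w' = "complex_of_real C"
  define N0 where "N0 = scale_mat ?z ?S + scale_mat ?w M"
  define N1 where "N1 = scale_mat ?z' ?S + scale_mat ?w' M"
  have CSc: "complex_of_real C * C + complex_of_real S * S = 1"
    using CS by (metis of_real_1 of_real_add of_real_mult)
  have LU: "LU_equivalent (param_pencil a b c s c' s' x y) (pencil N0 N1)"
    unfolding param_pencil_def M_def[symmetric]
  proof (rule LU_pencilI[of "mat2 ?z ?w ?z' ?w'" "mat 1" "mat 1"])
    have "?z * cnj ?z + ?z' * cnj ?z' = complex_of_real C * C + (cnj e * e) * (complex_of_real S * S)"
      "?w * cnj ?w + ?w' * cnj ?w' = complex_of_real C * C + (e * cnj e) * (complex_of_real S * S)"
      "?w * cnj ?z + ?w' * cnj ?z' = 0"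
      by (simp_all add: complex_eq_iff algebra_simps)
    then show "unitary_mat (mat2 ?z ?w ?z' ?w')"
      unfolding unitary_mat2_iff ee by (simp add: CSc)
  qed (simp_all add: N0_def N1_def)
  have f1: "Re (frob ?S ?S) = 1" "Re (frob M M) = 1"
    using ab by (simp_all add: frob_diag frob_param_slice[OF cs] M_def del: of_real_add of_real_power)
  have n: "(cmod ?z)\<^sup>2 = C * C" "(cmod ?w)\<^sup>2 = S * S" "(cmod ?z')\<^sup>2 = S * S"
    using e(1) by (simp_all add: norm_mult power2_eq_square)
  have "Re (?z * cnj ?w * F) = C * S * Im (cnj e * F)" "Re (?z' * cnj ?w' * F) = - (C * S * Im (cnj e * F))"
    by (simp_all add: algebra_simps)
  then have "Re (frob N0 N0) = 1" "Re (frob N1 N1) = 1"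
    unfolding N0_def N1_def frob_combination f1 n F_def[symmetric] e(2) using CS by (simp_all add: add.commute)
  then have fr: "frob N0 N0 = 1" "frob N1 N1 = 1" using frob_self(1) by (metis of_real_1)+
  have det: "det2 (scale_mat z ?S + scale_mat w M) = complex_of_real m * (z\<^sup>2 + w\<^sup>2) + t * (z * w)" for z w
    by (simp only: M_def det2_pencil_combination[OF cs] t_def m_def)
  have "cnj e * det2 N0 = complex_of_real m * (cnj e * complex_of_real (C * C) - (cnj e * e) * e * complex_of_real (S * S)) + \<i> * t * (cnj e * e) * complex_of_real (C * S)"
    unfolding N0_def det by (simp add: power2_eq_square algebra_simps)
  then have d0: "cnj e * det2 N0 = complex_of_real m * (cnj e * complex_of_real (C * C) - e * complex_of_real (S * S)) + \<i> * t * complex_of_real (C * S)"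
    unfolding ee by simp
  have "e * det2 N1 = complex_of_real m * (e * complex_of_real (C * C) - (e * cnj e) * cnj e * complex_of_real (S * S)) + \<i> * t * (e * cnj e) * complex_of_real (C * S)"
    unfolding N1_def det by (simp add: power2_eq_square algebra_simps)
  then have d1: "e * det2 N1 = complex_of_real m * (e * complex_of_real (C * C) - cnj e * complex_of_real (S * S)) + \<i> * t * complex_of_real (C * S)"
    unfolding ee by simp
  define P where "P = m * Re e * (C * C - S * S) - Im t * (C * S)"
  have re0: "Re (cnj e * det2 N0) = P" "Im (cnj e * det2 N0) = Re t * (C * S) - m * Im e * (C * C + S * S)"
    unfolding d0 by (simp_all add: P_def algebra_simps)
  have re1: "Re (e * det2 N1) = P" "Im (e * det2 N1) = Re t * (C * S) + m * Im e * (C * C + S * S)"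
    unfolding d1 by (simp_all add: P_def algebra_simps)
  have sq: "(u + v)\<^sup>2 = u\<^sup>2 + v\<^sup>2" "(u - v)\<^sup>2 = u\<^sup>2 + v\<^sup>2" if "u * v = 0" for u v :: real
    using that by algebra+
  \<comment> \<open>The imaginary parts of the two determinants differ only in the sign of
    \<open>m * Im e\<close>, so their squares agree once the cross term vanishes.\<close>
  have uv: "Re t * (C * S) * (m * Im e) = 0" using e(3) by auto
  have "cmod (det2 N0) = cmod (cnj e * det2 N0)" "cmod (det2 N1) = cmod (e * det2 N1)"
    using e(1) by (simp_all add: norm_mult)
  then have D: "(cmod (det2 N0))\<^sup>2 = P\<^sup>2 + ((Re t * (C * S))\<^sup>2 + (m * Im e)\<^sup>2)"
      "(cmod (det2 N1))\<^sup>2 = P\<^sup>2 + ((Re t * (C * S))\<^sup>2 + (m * Im e)\<^sup>2)"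
    by (simp_all only: cmod_power2 re0 re1 CS mult_1_right sq[OF uv])
  then have "(cmod (det2 N0))\<^sup>2 = (cmod (det2 N1))\<^sup>2" by simp
  then have cd: "cmod (det2 N0) = cmod (det2 N1)" by (simp add: power2_eq_iff_nonneg)
  have "P = G * ((C * C + S * S) * (C * C + S * S))"
    unfolding P_def G(1) using G(2) by algebra
  then have "P = G" by (simp add: CS)
  then have "P\<^sup>2 = (m * Re e)\<^sup>2 + (Im t / 2)\<^sup>2" by (simp add: G_def cmod_power2)
  moreover have "(Re e)\<^sup>2 + (Im e)\<^sup>2 = 1" using e(1) by (metis cmod_power2 one_power2)
  then have "(m * Re e)\<^sup>2 + (m * Im e)\<^sup>2 = m\<^sup>2" by algebra
  \<comment> \<open>The two components of \<open>e\<close> restore \<open>m\<^sup>2\<close> in full,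
    so a non-zero \<open>Im t\<close> makes the gain strict.\<close>
  ultimately have "(cmod (det2 N0))\<^sup>2 = m\<^sup>2 + (Im t / 2)\<^sup>2 + (Re t * (C * S))\<^sup>2" unfolding D(1) by linarith
  moreover have "(Im t / 2)\<^sup>2 > 0" using t0 by simp
  moreover have "(Re t * (C * S))\<^sup>2 \<ge> 0" by simp
  ultimately have "m\<^sup>2 < (cmod (det2 N0))\<^sup>2" by linarith
  then have lt: "m < cmod (det2 N0)" by (rule power2_less_imp_less) simp
  obtain d where d: "valid_parameters d" "coeff_a d * coeff_b d = cmod (det2 N0)" "LU_equivalent (pencil N0 N1) (decomposition_pencil d)"
    by (rule decomposition_exists[OF fr cd])
  show ?thesis
    by (rule that[OF d(1) LU_trans[OF LU d(3)]]) (use lt d(2) in \<open>simp add: m_def\<close>)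
qed

section \<open>Maximally entangled seeds\<close>

text \<open>The Euler matrix is \<open>c * Re x\<close> times the identity plus \<open>\<i>\<close>
  times a traceless Hermitian matrix. The latter has opposite eigenvalues, whose square
  \<open>1 - (c * Re x)\<^sup>2\<close> is read off from its determinant.\<close>

lemma euler_mat_diagonalization:
  assumes "c\<^sup>2 + s\<^sup>2 = 1" "cmod x = 1" "cmod y = 1"
  obtains V where "unitary_mat V"
    "euler_mat c s x y = V ** mat2 (Complex (c * Re x) (sqrt (1 - (c * Re x)\<^sup>2))) 0 0
        (Complex (c * Re x) (- sqrt (1 - (c * Re x)\<^sup>2))) ** adjoint_mat V"
proof -
  define p where "p = c * Im x"
  define z where "z = - \<i> * s * y"
  obtain V l m where V: "unitary_mat V" and ml: "m \<le> l"
    and H: "mat2 (complex_of_real p) z (cnj z) (complex_of_real (- p)) = V ** mat2 (complex_of_real l) 0 0 (complex_of_real m) ** adjoint_mat V"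
    by (rule hermitian2_diagonalization[of p z "- p"])
  have VV: "adjoint_mat V ** V = mat 1" "V ** adjoint_mat V = mat 1" using V by (simp_all add: unitary_mat_def)
  have "trace (V ** mat2 (complex_of_real l) 0 0 (complex_of_real m) ** adjoint_mat V) =
      trace (adjoint_mat V ** (V ** mat2 (complex_of_real l) 0 0 (complex_of_real m)))" by (rule trace_mul_sym)
  then have "complex_of_real (l + m) = 0" unfolding H[symmetric] by (simp add: matrix_mul_assoc VV trace_def sum_two)
  then have lm: "m = - l" by (simp only: of_real_eq_0_iff)
  have nV: "cmod (det2 V) = 1" "cmod (det2 (adjoint_mat V)) = 1" using unitary_det2 V unitary_adjoint by blast+
  have "cmod (det2 (mat2 (complex_of_real p) z (cnj z) (complex_of_real (- p)))) = l\<^sup>2"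
    unfolding H by (simp add: det2_mult norm_mult nV) (simp add: det2_def lm norm_mult power2_eq_square)
  moreover have "det2 (mat2 (complex_of_real p) z (cnj z) (complex_of_real (- p))) = - complex_of_real (p\<^sup>2 + s\<^sup>2)"
  proof -
    have "z * cnj z = complex_of_real (s\<^sup>2) * (y * cnj y)" by (simp add: z_def power2_eq_square algebra_simps)
    then show ?thesis by (simp add: det2_def cnj_mult_self[OF assms(3)] power2_eq_square)
  qed
  ultimately have "l\<^sup>2 = p\<^sup>2 + s\<^sup>2" by (simp only: norm_minus_cancel norm_of_real) simp
  moreover have "(Re x)\<^sup>2 + (Im x)\<^sup>2 = 1" using assms(2) by (metis cmod_power2 one_power2)
  ultimately have "l\<^sup>2 = 1 - (c * Re x)\<^sup>2" using assms(1) unfolding p_def by algebra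
  moreover have "0 \<le> l" using ml lm by simp
  ultimately have l: "l = sqrt (1 - (c * Re x)\<^sup>2)" by (metis real_sqrt_unique)
  let ?k = "complex_of_real (c * Re x)"
  have add: "scale_mat ?k (mat 1) + scale_mat \<i> (V ** Q ** adjoint_mat V)
     = V ** (scale_mat ?k (mat 1) + scale_mat \<i> Q) ** adjoint_mat V" for Q
  proof -
    have "V ** (scale_mat ?k (mat 1) + scale_mat \<i> Q) ** adjoint_mat V
       = scale_mat ?k (V ** adjoint_mat V) + scale_mat \<i> (V ** Q ** adjoint_mat V)"
      by (simp add: mat2_eq_iff mult_nth_two mat2_one algebra_simps)
    then show ?thesis by (simp add: VV)
  qed
  have "euler_mat c s x y = scale_mat ?k (mat 1) + scale_mat \<i> (mat2 (complex_of_real p) z (cnj z) (complex_of_real (- p)))"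
    by (simp add: mat2_eq_iff euler_mat_def mat2_one p_def z_def complex_eq_iff)
  also have "\<dots> = V ** (scale_mat ?k (mat 1) + scale_mat \<i> (mat2 (complex_of_real l) 0 0 (complex_of_real m))) ** adjoint_mat V"
    unfolding H add ..
  also have "scale_mat ?k (mat 1) + scale_mat \<i> (mat2 (complex_of_real l) 0 0 (complex_of_real m)) =
      mat2 (Complex (c * Re x) l) 0 0 (Complex (c * Re x) (- l))"
    by (simp add: mat2_eq_iff mat2_one lm complex_eq_iff)
  finally show ?thesis using V unfolding l by (intro that)
qed

text \<open>The seed slice is scalar here, so conjugating both slices by a unitary is a local
  operation that preserves it. Only the spectrum of \<open>U\<^sub>2\<close> survives, hence only
  \<open>c * Re x\<close>.\<close>

lemma param_pencil_maximal_canonical: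
  assumes "c\<^sup>2 + s\<^sup>2 = 1" "cmod x = 1" "cmod y = 1"
  shows "LU_equivalent (param_pencil a a c s 1 0 x y) (pencil (mat2 a 0 0 a) (scale_mat a
     (mat2 (Complex (c * Re x) (sqrt (1 - (c * Re x)\<^sup>2))) 0 0 (Complex (c * Re x) (- sqrt (1 - (c * Re x)\<^sup>2))))))"
proof -
  obtain V where V: "unitary_mat V" and R: "euler_mat c s x y = V ** mat2 (Complex (c * Re x) (sqrt (1 - (c * Re x)\<^sup>2))) 0 0
        (Complex (c * Re x) (- sqrt (1 - (c * Re x)\<^sup>2))) ** adjoint_mat V"
    by (rule euler_mat_diagonalization[OF assms])
  let ?D = "mat2 (Complex (c * Re x) (sqrt (1 - (c * Re x)\<^sup>2))) 0 0 (Complex (c * Re x) (- sqrt (1 - (c * Re x)\<^sup>2)))"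
  have VV: "adjoint_mat V ** V = mat 1" "V ** adjoint_mat V = mat 1" using V by (simp_all add: unitary_mat_def)
  have 1: "param_slice a a c s 1 0 x y = scale_mat a (euler_mat c s x y)"
    by (simp add: mat2_eq_iff param_slice_def euler_mat_def mult_ac)
  have "adjoint_mat V ** mat2 a 0 0 a ** V = scale_mat a (adjoint_mat V ** V)"
    by (simp add: mat2_eq_iff mult_nth_two algebra_simps)
  also have "\<dots> = mat2 a 0 0 a" by (simp add: VV mat2_eq_iff mat2_one)
  finally have 2: "adjoint_mat V ** mat2 a 0 0 a ** transpose (transpose V) = mat2 a 0 0 a" by simp
  have "adjoint_mat V ** param_slice a a c s 1 0 x y ** V = scale_mat a (adjoint_mat V ** euler_mat c s x y ** V)"
    unfolding 1 by (simp add: mat2_eq_iff mult_nth_two algebra_simps)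
  also have "adjoint_mat V ** euler_mat c s x y ** V = (adjoint_mat V ** V) ** ?D ** (adjoint_mat V ** V)"
    unfolding R by (simp only: matrix_mul_assoc)
  finally have 3: "adjoint_mat V ** param_slice a a c s 1 0 x y ** transpose (transpose V) = scale_mat a ?D"
    by (simp add: VV)
  show ?thesis
    using pencil_local_23[OF unitary_adjoint[OF V] unitary_transpose[OF V], of "mat2 a 0 0 a" "param_slice a a c s 1 0 x y"]
    unfolding 2 3 param_pencil_def .
qed

lemma param_pencil_maximal_LU:
  assumes "c\<^sup>2 + s\<^sup>2 = 1" "cmod x = 1" "cmod y = 1" "C\<^sup>2 + S\<^sup>2 = 1" "cmod X = 1" "cmod Y = 1"
    and "(c * Re x)\<^sup>2 = (C * Re X)\<^sup>2"
  shows "LU_equivalent (param_pencil a a c s 1 0 x y) (param_pencil a a C S 1 0 X Y)"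
proof -
  have same: "LU_equivalent (param_pencil a a c s 1 0 x y) (param_pencil a a C S 1 0 X' Y')"
    if "c * Re x = C * Re X'" "cmod X' = 1" "cmod Y' = 1" for X' Y'
    using param_pencil_maximal_canonical[OF assms(1-3), of a] param_pencil_maximal_canonical[OF assms(4) that(2,3), of a]
    unfolding that(1) by (rule LU_trans[OF _ LU_sym])
  from assms(7) have "c * Re x = C * Re X \<or> c * Re x = C * Re (- X)" by (simp add: power2_eq_iff)
  then show ?thesis
  proof
    assume "c * Re x = C * Re X" then show ?thesis using same assms by blast
  next
    assume "c * Re x = C * Re (- X)"
    from same[OF this, of "- Y"] have "LU_equivalent (param_pencil a a c s 1 0 x y) (param_pencil a a C S 1 0 (- X) (- Y))" using assms by simp
    from LU_trans[OF this param_pencil_neg] show ?thesis by simp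
  qed
qed

lemma frob_unit:
  assumes "c\<^sup>2 + s\<^sup>2 = 1" "c'\<^sup>2 + s'\<^sup>2 = 1" "cmod x = 1" "cmod y = 1" "a\<^sup>2 + b\<^sup>2 = 1"
  shows "frob (mat2 a 0 0 b) (mat2 a 0 0 b) = 1" "frob (param_slice a b c s c' s' x y) (param_slice a b c s c' s' x y) = 1"
  unfolding frob_diag frob_param_slice[OF assms(1-4)] assms(5) by simp_all

subsection \<open>The measures in terms of the parameters\<close>

lemma entanglement_seed:
  assumes "(coeff_a d)\<^sup>2 + (coeff_b d)\<^sup>2 = 1"
  shows "entanglement (seed d) = det_entropy ((coeff_a d * coeff_b d)\<^sup>2)"
proof -
  have s: "(\<Sum>k\<in>UNIV. (cmod (seed d $ (0, k)))\<^sup>2) = (coeff_a d)\<^sup>2"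
    "(\<Sum>k\<in>UNIV. (cmod (seed d $ (1, k)))\<^sup>2) = (coeff_b d)\<^sup>2"
    "(\<Sum>k\<in>UNIV. seed d $ (0, k) * cnj (seed d $ (1, k))) = 0"
    by (simp_all add: sum_two)
  show ?thesis using entanglement_eq[of "seed d"] assms unfolding s by (simp add: power_mult_distrib)
qed

text \<open>Keeps the argument in the range on which \<open>det_entropy\<close> is
  injective.\<close>

lemma product_bounds:
  assumes "a\<^sup>2 + b\<^sup>2 = (1 :: real)" shows "0 \<le> (a * b)\<^sup>2" "(a * b)\<^sup>2 \<le> 1 / 4"
proof -
  have "1 - 4 * (a * b)\<^sup>2 = (a\<^sup>2 - b\<^sup>2)\<^sup>2" using assms by algebra
  then have "1 - 4 * (a * b)\<^sup>2 \<ge> 0" by simp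
  then show "(a * b)\<^sup>2 \<le> 1 / 4" by simp
qed simp

text \<open>The squared overlap \<open>|\<langle>\<psi>\<^sub>s|U\<^sub>2 \<otimes> U\<^sub>3|\<psi>\<^sub>s\<rangle>|\<^sup>2\<close>, simplified by \<open>a\<^sup>2 + b\<^sup>2 = 1\<close>.\<close>

definition overlap2 :: "real \<Rightarrow> real \<Rightarrow> real \<Rightarrow> real \<Rightarrow> real \<Rightarrow> real \<Rightarrow> complex \<Rightarrow> complex \<Rightarrow> real" where
  "overlap2 a b c s c' s' x y =
     (c * c' * Re x + 2 * a * b * s * s' * Re y)\<^sup>2 + (c * c' * (a\<^sup>2 - b\<^sup>2) * Im x)\<^sup>2"

lemma entanglement_param_pencil:
  assumes "c\<^sup>2 + s\<^sup>2 = 1" "c'\<^sup>2 + s'\<^sup>2 = 1" "cmod x = 1" "cmod y = 1" "a\<^sup>2 + b\<^sup>2 = 1"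
  shows "entanglement ((1 / sqrt 2) *\<^sub>R param_pencil a b c s c' s' x y) = det_entropy ((1 - overlap2 a b c s c' s' x y) / 4)"
    and "overlap2 a b c s c' s' x y \<le> 1"
proof -
  have "(cmod (frob (mat2 a 0 0 b) (param_slice a b c s c' s' x y)))\<^sup>2 = overlap2 a b c s c' s' x y"
    unfolding frob_diag_param_slice overlap2_def assms(5) by (simp add: cmod_power2)
  with entanglement_half_pencil[OF frob_unit[OF assms]]
    power_mono[OF entanglement_half_pencil(2)[OF frob_unit[OF assms]] norm_ge_zero, of 2]
  show "entanglement ((1 / sqrt 2) *\<^sub>R param_pencil a b c s c' s' x y) = det_entropy ((1 - overlap2 a b c s c' s' x y) / 4)"
    "overlap2 a b c s c' s' x y \<le> 1"
    by (simp_all add: param_pencil_def)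
qed

lemma overlap2_nonneg: "0 \<le> overlap2 a b c s c' s' x y"
  by (simp add: overlap2_def)

text \<open>The four states of \<open>S_set\<close> realise only two overlaps, which differ in the sign of \<open>b\<close>.\<close>

lemma entanglement_S_set:
  fixes d
  defines "c \<equiv> cos (ang_beta d)" and "s \<equiv> sin (ang_beta d)" and "c' \<equiv> cos (ang_beta' d)" and "s' \<equiv> sin (ang_beta' d)"
    and "x \<equiv> cis (ang_alpha d + ang_gamma d)" and "y \<equiv> cis (ang_alpha d - ang_gamma d)"
    and "a \<equiv> coeff_a d" and "b \<equiv> coeff_b d"
  assumes "a\<^sup>2 + b\<^sup>2 = 1"
  shows "entanglement ` S_set d = {det_entropy ((1 - overlap2 a b c s c' s' x y) / 4),
     det_entropy ((1 - overlap2 a (- b) c s c' s' x y) / 4)}"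
proof -
  let ?S = "mat2 (complex_of_real a) 0 0 (complex_of_real b)"
  let ?U = "euler_mat c s x y" and ?W = "euler_mat c' s' 1 1"
  have cs: "c\<^sup>2 + s\<^sup>2 = 1" "c'\<^sup>2 + s'\<^sup>2 = 1" "cmod x = 1" "cmod y = 1"
    by (simp_all add: c_def s_def c'_def s'_def x_def y_def)
  have U: "unitary_mat ?U" and W: "unitary_mat ?W" using cs by (simp_all add: euler_mat_unitary)
  have p: "proj (ket 0) = mat2 1 0 0 0" "proj (ket 1) = mat2 0 0 0 1"
    by (simp_all add: mat2_eq_iff proj_def ket_def axis_def)
  have add: "pencil M N + pencil M' N' = pencil (M + M') (N + N')" for M N M' N'
    by (simp add: three_qubit_eq_iff)
  have 12: "Uc12 d *v pencil M N = pencil M (?U ** N)" for M N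
    unfolding Uc12_def matrix_vector_mult_add_rdistrib local_unitary_pencil p add
    by (simp add: pencil_eq_iff mat2_eq_iff U2_eq c_def s_def x_def y_def mult_nth_two)
  have 13: "Uc13 d *v pencil M N = pencil M (N ** transpose ?W)" for M N
    unfolding Uc13_def matrix_vector_mult_add_rdistrib local_unitary_pencil p add
    by (simp add: pencil_eq_iff mat2_eq_iff U3_eq c'_def s'_def mult_nth_two)
  have "ket_plus \<otimes>\<^sub>v seed d = (1 / sqrt 2) *\<^sub>R (ket 0 \<otimes>\<^sub>v seed d + ket 1 \<otimes>\<^sub>v seed d)"
    by (simp add: vec_eq_iff ket_plus_def tensor_vec_def scaleR_conv_of_real[where ?'a = complex] algebra_simps)
  then have sd: "ket_plus \<otimes>\<^sub>v seed d = (1 / sqrt 2) *\<^sub>R pencil ?S ?S"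
    by (simp add: ket_tensor_pencil seed_mat a_def b_def)
  have st: "Uc13 d *v (Uc12 d *v ((mat 1 \<otimes>\<^sub>m pauli n \<otimes>\<^sub>m mat 1) *v (ket_plus \<otimes>\<^sub>v seed d)))
      = (1 / sqrt 2) *\<^sub>R pencil (pauli n ** ?S) (?U ** (pauli n ** ?S) ** transpose ?W)" for n
  proof -
    have 1: "(mat 1 \<otimes>\<^sub>m pauli n \<otimes>\<^sub>m mat 1) *v pencil ?S ?S = pencil (pauli n ** ?S) (pauli n ** ?S)"
      unfolding local_unitary_pencil by (simp add: pencil_eq_iff mat2_eq_iff mat2_one mult_nth_two)
    show ?thesis unfolding sd by (simp add: matrix_vector_mult_scaleR_right 1 12 13)
  qed
  have en: "entanglement ((1 / sqrt 2) *\<^sub>R pencil Q (?U ** Q ** transpose ?W)) = det_entropy ((1 - (cmod (frob Q (?U ** Q ** transpose ?W)))\<^sup>2) / 4)"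
    if "frob Q Q = 1" for Q
    by (rule entanglement_half_pencil(1)) (simp_all add: that frob_unitary U W)
  define K where "K Q = (cmod (frob Q (?U ** Q ** transpose ?W)))\<^sup>2" for Q
  have P: "pauli 0 ** ?S = ?S" "pauli 1 ** ?S = mat2 0 b a 0" "pauli 2 ** ?S = mat2 0 (- \<i> * b) (\<i> * a) 0"
    "pauli 3 ** ?S = mat2 a 0 0 (- b)"
    by (simp_all add: pauli_def mat2_mult)
  have f: "frob (pauli n ** ?S) (pauli n ** ?S) = 1" if "n \<in> {0,1,2,3}" for n
  proof -
    have "complex_of_real (a\<^sup>2 + b\<^sup>2) = 1" using assms(9) by simp
    then have "complex_of_real a * a + complex_of_real b * b = 1" by (simp add: power2_eq_square)
    then show ?thesis using that P by (auto simp: frob_def sum_two algebra_simps)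
  qed
  have e: "entanglement (Uc13 d *v (Uc12 d *v ((mat 1 \<otimes>\<^sub>m pauli n \<otimes>\<^sub>m mat 1) *v (ket_plus \<otimes>\<^sub>v seed d))))
     = det_entropy ((1 - K (pauli n ** ?S)) / 4)" if "n \<in> {0,1,2,3}" for n
    unfolding st en[OF f[OF that]] K_def ..
  \<comment> \<open>One expansion serves all four Pauli matrices. Up to conjugation,
    \<open>n = 2\<close> gives the overlap of \<open>n = 0\<close>, while \<open>n = 1\<close> and
    \<open>n = 3\<close> reverse the sign of its term in \<open>Re y\<close>.\<close>
  have fr: "frob (mat2 p q r t) (?U ** mat2 p q r t ** transpose ?W) =
      p * cnj (c * c' * x * p + s * c' * y * r + c * s' * x * q + s * s' * y * t) +
      q * cnj (- c * s' * x * p - s * s' * y * r + c * c' * x * q + s * c' * y * t) +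
      r * cnj (- s * c' * cnj y * p + c * c' * cnj x * r - s * s' * cnj y * q + c * s' * cnj x * t) +
      t * cnj (s * s' * cnj y * p - c * s' * cnj x * r - s * c' * cnj y * q + c * c' * cnj x * t)" for p q r t
    by (simp add: frob_def sum_two mult_nth_two euler_mat_def algebra_simps)
  have ab: "a * a + b * b = 1" using assms(9) by (simp add: power2_eq_square)
  have K0: "K ?S = overlap2 a b c s c' s' x y"
  proof -
    have "frob ?S (?U ** ?S ** transpose ?W) = Complex (c * c' * (a * a + b * b) * Re x + 2 * a * b * s * s' * Re y) (- c * c' * (a\<^sup>2 - b\<^sup>2) * Im x)"
      unfolding fr by (simp add: complex_eq_iff power2_eq_square algebra_simps)
    then show ?thesis unfolding K_def overlap2_def ab by (simp add: cmod_power2)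
  qed
  have K1: "K (mat2 0 b a 0) = overlap2 a (- b) c s c' s' x y"
  proof -
    have "frob (mat2 0 b a 0) (?U ** mat2 0 b a 0 ** transpose ?W) = Complex (c * c' * (a * a + b * b) * Re x - 2 * a * b * s * s' * Re y) (c * c' * (a\<^sup>2 - b\<^sup>2) * Im x)"
      unfolding fr by (simp add: complex_eq_iff power2_eq_square algebra_simps)
    then show ?thesis unfolding K_def overlap2_def ab by (simp add: cmod_power2)
  qed
  have K2: "K (mat2 0 (- \<i> * b) (\<i> * a) 0) = overlap2 a b c s c' s' x y"
  proof -
    have "frob (mat2 0 (- \<i> * b) (\<i> * a) 0) (?U ** mat2 0 (- \<i> * b) (\<i> * a) 0 ** transpose ?W) = Complex (c * c' * (a * a + b * b) * Re x + 2 * a * b * s * s' * Re y) (c * c' * (a\<^sup>2 - b\<^sup>2) * Im x)"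
      unfolding fr by (simp add: complex_eq_iff power2_eq_square algebra_simps)
    then show ?thesis unfolding K_def overlap2_def ab by (simp add: cmod_power2)
  qed
  have K3: "K (mat2 a 0 0 (- b)) = overlap2 a (- b) c s c' s' x y"
  proof -
    have "frob (mat2 a 0 0 (- b)) (?U ** mat2 a 0 0 (- b) ** transpose ?W) = Complex (c * c' * (a * a + b * b) * Re x - 2 * a * b * s * s' * Re y) (- c * c' * (a\<^sup>2 - b\<^sup>2) * Im x)"
      unfolding fr by (simp add: complex_eq_iff power2_eq_square algebra_simps)
    then show ?thesis unfolding K_def overlap2_def ab by (simp add: cmod_power2)
  qed
  have "entanglement ` S_set d = (\<lambda>n. entanglement (Uc13 d *v (Uc12 d *v ((mat 1 \<otimes>\<^sub>m pauli n \<otimes>\<^sub>m mat 1) *v (ket_plus \<otimes>\<^sub>v seed d))))) ` {0,1,2,3}"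
    unfolding S_set_def by blast
  also have "\<dots> = (\<lambda>n. det_entropy ((1 - K (pauli n ** ?S)) / 4)) ` {0,1,2,3}"
    by (intro image_cong refl e)
  also have "\<dots> = {det_entropy ((1 - K (pauli 0 ** ?S)) / 4), det_entropy ((1 - K (pauli 1 ** ?S)) / 4),
     det_entropy ((1 - K (pauli 2 ** ?S)) / 4), det_entropy ((1 - K (pauli 3 ** ?S)) / 4)}" by simp
  also have "\<dots> = {det_entropy ((1 - overlap2 a b c s c' s' x y) / 4),
     det_entropy ((1 - overlap2 a (- b) c s c' s' x y) / 4)}"
    unfolding P K0 K1 K2 K3 by auto
  finally show ?thesis .
qed


abbreviation "cosb d \<equiv> cos (ang_beta d)"
abbreviation "sinb d \<equiv> sin (ang_beta d)"
abbreviation "cosb' d \<equiv> cos (ang_beta' d)"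
abbreviation "sinb' d \<equiv> sin (ang_beta' d)"
abbreviation "phase_x d \<equiv> cis (ang_alpha d + ang_gamma d)"
abbreviation "phase_y d \<equiv> cis (ang_alpha d - ang_gamma d)"

lemma valid_parametersD:
  assumes "valid_parameters d"
  shows "coeff_b d \<le> coeff_a d" "0 \<le> coeff_b d" "(coeff_a d)\<^sup>2 + (coeff_b d)\<^sup>2 = 1"
    "0 \<le> cosb d" "0 \<le> sinb d" "0 \<le> cosb' d" "0 \<le> sinb' d"
  using assms by (auto simp: valid_parameters_def intro!: cos_ge_zero sin_ge_zero)

lemma unit_parts: "cmod x = 1 \<Longrightarrow> (Re x)\<^sup>2 + (Im x)\<^sup>2 = 1"
  by (metis cmod_power2 one_power2)

lemma mixing_entropy_euler_mat:
  assumes "c\<^sup>2 + s\<^sup>2 = 1" "cmod x = 1" "cmod y = 1"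
  shows "mixing_entropy (euler_mat c s x y) = det_entropy ((1 - (c * Re x)\<^sup>2) / 4)"
proof -
  have "(euler_mat c s x y $ 0 $ 0 + euler_mat c s x y $ 1 $ 1) / 2 = complex_of_real (c * Re x)"
    by (simp add: euler_mat_def complex_eq_iff)
  then show ?thesis unfolding mixing_entropy_eq[OF euler_mat_unitary[OF assms]] by (simp only: norm_of_real power2_abs)
qed

lemma entanglement_E4_state:
  assumes "valid_parameters d"
  shows "entanglement ((1 / sqrt 2) *\<^sub>R (ket (0 :: 2) \<otimes>\<^sub>v seed d + ket 1 \<otimes>\<^sub>v ((U2 d \<otimes>\<^sub>m mat 1) *v seed d)))
    = det_entropy ((1 - overlap2 (coeff_a d) (coeff_b d) (cosb d) (sinb d) 1 0 (phase_x d) (phase_y d)) / 4)"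
proof -
  have m: "mat 1 = euler_mat 1 0 1 1" by (simp add: euler_mat_def mat2_one)
  show ?thesis
    unfolding ket_tensor_pencil tensor_seed seed_mat U2_eq m param_slice_eq[symmetric] param_pencil_def[symmetric]
    by (rule entanglement_param_pencil(1)) (use valid_parametersD[OF assms] in simp_all)
qed

text \<open>\<open>1 - |\<langle>+|U\<^sub>2|+\<rangle>|\<^sup>2\<close>.\<close>

definition E5_factor :: "real \<Rightarrow> real \<Rightarrow> complex \<Rightarrow> complex \<Rightarrow> real" where
  "E5_factor c s x y = c\<^sup>2 * (Im x)\<^sup>2 + s\<^sup>2 * (Re y)\<^sup>2"

lemma E5_factor_bounds:
  assumes "c\<^sup>2 + s\<^sup>2 = 1" "cmod x = 1" "cmod y = 1"
  shows "0 \<le> E5_factor c s x y" "E5_factor c s x y \<le> 1"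
proof -
  have "(Im x)\<^sup>2 \<le> 1" "(Re y)\<^sup>2 \<le> 1"
    using unit_parts[OF assms(2)] unit_parts[OF assms(3)] by (metis le_add_same_cancel1 le_add_same_cancel2 zero_le_power2)+
  then have "c\<^sup>2 * (Im x)\<^sup>2 \<le> c\<^sup>2" "s\<^sup>2 * (Re y)\<^sup>2 \<le> s\<^sup>2"
    by (simp_all add: mult_left_le)
  then show "E5_factor c s x y \<le> 1" using assms(1) unfolding E5_factor_def by linarith
qed (simp add: E5_factor_def)

lemma entanglement_E5_state:
  assumes "valid_parameters d"
  shows "entanglement (coeff_a d *\<^sub>R (ket_plus \<otimes>\<^sub>v ket (0 :: 2) \<otimes>\<^sub>v ket (0 :: 2)) +
       coeff_b d *\<^sub>R ((U2 d *v ket_plus) \<otimes>\<^sub>v ket 1 \<otimes>\<^sub>v ket 1))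
    = det_entropy ((coeff_a d * coeff_b d)\<^sup>2 * E5_factor (cosb d) (sinb d) (phase_x d) (phase_y d))"
proof -
  define a b c s x y where d: "a = coeff_a d" "b = coeff_b d" "c = cosb d" "s = sinb d" "x = phase_x d" "y = phase_y d"
  note v = valid_parametersD[OF assms, folded d]
  have cs: "c\<^sup>2 + s\<^sup>2 = 1" "cmod x = 1" "cmod y = 1" by (simp_all add: d)
  define r where "r = complex_of_real (1 / sqrt 2)"
  have r: "cmod r ^ 2 = 1 / 2" by (simp add: r_def norm_divide power_divide)
  define v0 v1 where vd: "v0 = r * (c * x + s * y)" "v1 = r * (- s * cnj y + c * cnj x)"
  let ?M = "mat2 (a * r) 0 0 (b * v0)" and ?N = "mat2 (a * r) 0 0 (b * v1)"
  have kp: "ket_plus $ i = r" for i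
    using two_cases[of i] by (auto simp: ket_plus_def ket_def axis_def r_def scaleR_conv_of_real[where ?'a = complex])
  have Uk: "(U2 d *v ket_plus) $ 0 = v0" "(U2 d *v ket_plus) $ 1 = v1"
    unfolding U2_eq d(3-6)[symmetric] by (simp_all add: matrix_vector_mult_def sum_two kp vd euler_mat_def algebra_simps)
  have st: "coeff_a d *\<^sub>R (ket_plus \<otimes>\<^sub>v ket (0 :: 2) \<otimes>\<^sub>v ket (0 :: 2)) +
       coeff_b d *\<^sub>R ((U2 d *v ket_plus) \<otimes>\<^sub>v ket 1 \<otimes>\<^sub>v ket 1) = pencil ?M ?N"
    by (simp add: three_qubit_eq_iff forall_two tensor_vec_def kp Uk ket_def axis_def d(1,2) scaleR_conv_of_real[where ?'a = complex])
  have u: "(cmod v0)\<^sup>2 + (cmod v1)\<^sup>2 = 1"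
  proof -
    have "(cmod (c * x + s * y))\<^sup>2 + (cmod (- s * cnj y + c * cnj x))\<^sup>2 = 2 * c\<^sup>2 * ((Re x)\<^sup>2 + (Im x)\<^sup>2) + 2 * s\<^sup>2 * ((Re y)\<^sup>2 + (Im y)\<^sup>2)"
      unfolding cmod_power2 by (simp add: power2_eq_square algebra_simps)
    also have "\<dots> = 2" using cs(1) by (simp add: unit_parts[OF cs(2)] unit_parts[OF cs(3)])
    finally show ?thesis by (simp add: vd norm_mult power_mult_distrib r)
  qed
  have diff: "(cmod (v0 - v1))\<^sup>2 = 2 * E5_factor c s x y"
  proof -
    have "v0 - v1 = r * Complex (2 * s * Re y) (2 * c * Im x)" by (simp add: vd complex_eq_iff algebra_simps)
    then have "(cmod (v0 - v1))\<^sup>2 = (cmod r)\<^sup>2 * (cmod (Complex (2 * s * Re y) (2 * c * Im x)))\<^sup>2"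
      by (simp only: norm_mult power_mult_distrib)
    also have "\<dots> = 2 * E5_factor c s x y"
      unfolding r unfolding cmod_power2 by (simp add: E5_factor_def power_mult_distrib)
    finally show ?thesis .
  qed
  have fM: "Re (frob ?M ?M) = a\<^sup>2 / 2 + b\<^sup>2 * (cmod v0)\<^sup>2" "Re (frob ?N ?N) = a\<^sup>2 / 2 + b\<^sup>2 * (cmod v1)\<^sup>2"
    by (simp_all add: frob_norm sum_two norm_mult power_mult_distrib r)
  have rr: "r * cnj r = complex_of_real (1 / 2)"
    unfolding complex_norm_square[symmetric] r ..
  have "frob ?M ?N = complex_of_real (a\<^sup>2) * (r * cnj r) + complex_of_real (b\<^sup>2) * (v0 * cnj v1)"
    by (simp add: frob_def sum_two power2_eq_square mult_ac)
  then have fMN: "(cmod (frob ?M ?N))\<^sup>2 = (a\<^sup>2 / 2 + b\<^sup>2 * (Re v0 * Re v1 + Im v0 * Im v1))\<^sup>2 + (b\<^sup>2 * (Im v0 * Re v1 - Re v0 * Im v1))\<^sup>2"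
    unfolding rr by (simp add: cmod_power2 del: of_real_power)
  have 1: "Re (frob ?M ?M) + Re (frob ?N ?N) = 1"
  proof -
    have "Re (frob ?M ?M) + Re (frob ?N ?N) = a\<^sup>2 + b\<^sup>2 * ((cmod v0)\<^sup>2 + (cmod v1)\<^sup>2)" unfolding fM by (simp add: algebra_simps)
    then show ?thesis using v(3) by (simp add: u)
  qed
  \<comment> \<open>The Gram determinant sees only \<open>v0 - v1\<close>, which is
    \<open>sqrt 2\<close> times the amplitude of \<open>U2 d *v ket_plus\<close> along the state
    orthogonal to \<open>ket_plus\<close>.\<close>
  have "Re (frob ?M ?M) * Re (frob ?N ?N) - (cmod (frob ?M ?N))\<^sup>2 = a\<^sup>2 * b\<^sup>2 / 2 * (cmod (v0 - v1))\<^sup>2"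
    unfolding fM fMN unfolding cmod_power2 by (simp add: power2_eq_square field_simps)
  also have "\<dots> = (a * b)\<^sup>2 * E5_factor c s x y" unfolding diff by (simp add: power_mult_distrib)
  finally show ?thesis unfolding st using entanglement_pencil[OF 1] by (simp add: d)
qed

text \<open>The two overlaps differ by a cross term only. Through it \<open>E6\<close> reads the
  sign of \<open>Re x * Re y\<close>, which the squared quantities in the other measures
  miss.\<close>

lemma overlap2_sign_le_iff:
  "overlap2 a (- b) c s c' s' x y \<le> overlap2 a b c s c' s' x y \<longleftrightarrow> 0 \<le> a * b * (c * c') * (s * s') * (Re x * Re y)"
proof -
  have "overlap2 a b c s c' s' x y - overlap2 a (- b) c s c' s' x y = 8 * (a * b * (c * c') * (s * s') * (Re x * Re y))"
    by (simp add: overlap2_def power2_eq_square algebra_simps)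
  then show ?thesis by linarith
qed

text \<open>Convention (i) compares entropies of seeds; monotonicity of \<open>det_entropy\<close>
  turns this into maximality of the squared product of the coefficients.\<close>

lemma admissibleD:
  assumes "admissible_choice D" "truly_tripartite_entangled \<psi>"
  shows "valid_parameters (D (LU_class \<psi>))" "LU_equivalent \<psi> (decomposed_state (D (LU_class \<psi>)))"
    "\<And>d. valid_parameters d \<Longrightarrow> LU_equivalent \<psi> (decomposed_state d) \<Longrightarrow>
       (coeff_a d * coeff_b d)\<^sup>2 \<le> (coeff_a (D (LU_class \<psi>)) * coeff_b (D (LU_class \<psi>)))\<^sup>2"
    "coeff_a (D (LU_class \<psi>)) = coeff_b (D (LU_class \<psi>)) \<Longrightarrow> ang_beta' (D (LU_class \<psi>)) = 0"
proof -
  have adm: "admissible_decomposition (LU_class \<psi>) (D (LU_class \<psi>))"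
    using assms by (simp add: admissible_choice_def)
  then show v: "valid_parameters (D (LU_class \<psi>))" and "LU_equivalent \<psi> (decomposed_state (D (LU_class \<psi>)))"
    by (simp_all add: admissible_decomposition_def is_decomposition_def LU_class_def)
  show "ang_beta' (D (LU_class \<psi>)) = 0" if "coeff_a (D (LU_class \<psi>)) = coeff_b (D (LU_class \<psi>))"
    using adm that by (simp add: admissible_decomposition_def)
  fix d assume d: "valid_parameters d" "LU_equivalent \<psi> (decomposed_state d)"
  then have "entanglement (seed d) \<le> entanglement (seed (D (LU_class \<psi>)))"
    using adm by (simp add: admissible_decomposition_def is_decomposition_def LU_class_def)
  then show "(coeff_a d * coeff_b d)\<^sup>2 \<le> (coeff_a (D (LU_class \<psi>)) * coeff_b (D (LU_class \<psi>)))\<^sup>2"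
    using valid_parametersD(3)[OF d(1)] valid_parametersD(3)[OF v]
    by (simp only: entanglement_seed det_entropy_le_iff product_bounds)
qed

lemma measures_eq:
  fixes D \<psi>
  defines "d \<equiv> D (LU_class \<psi>)"
  defines "a \<equiv> coeff_a d" and "b \<equiv> coeff_b d" and "c \<equiv> cosb d" and "s \<equiv> sinb d" and "c' \<equiv> cosb' d" and "s' \<equiv> sinb' d"
    and "x \<equiv> phase_x d" and "y \<equiv> phase_y d"
  assumes "admissible_choice D" "truly_tripartite_entangled \<psi>"
  shows "E1 D \<psi> = det_entropy ((a * b)\<^sup>2)"
    "E2 D \<psi> = det_entropy ((1 - (c * Re x)\<^sup>2) / 4)"
    "E3 D \<psi> = det_entropy ((1 - c'\<^sup>2) / 4)"
    "E4 D \<psi> = det_entropy ((1 - overlap2 a b c s 1 0 x y) / 4)"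
    "E5 D \<psi> = det_entropy ((a * b)\<^sup>2 * E5_factor c s x y)"
    "E6 D \<psi> = (if 0 \<le> a * b * (c * c') * (s * s') * (Re x * Re y) then 0 else 1)"
proof -
  note adm = admissibleD[OF assms(10,11), folded d_def]
  note v = valid_parametersD[OF adm(1)]
  have ab: "a\<^sup>2 + b\<^sup>2 = 1" using v by (simp add: a_def b_def)
  have cs: "c\<^sup>2 + s\<^sup>2 = 1" "c'\<^sup>2 + s'\<^sup>2 = 1" "cmod x = 1" "cmod y = 1"
    by (simp_all add: c_def s_def c'_def s'_def x_def y_def)
  show "E1 D \<psi> = det_entropy ((a * b)\<^sup>2)"
    using v by (simp add: E1_def d_def[symmetric] entanglement_seed a_def b_def)
  show "E2 D \<psi> = det_entropy ((1 - (c * Re x)\<^sup>2) / 4)"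
    unfolding E2_def d_def[symmetric] U2_eq c_def x_def by (rule mixing_entropy_euler_mat) simp_all
  have "mixing_entropy (euler_mat c' s' 1 1) = det_entropy ((1 - (c' * Re 1)\<^sup>2) / 4)"
    by (rule mixing_entropy_euler_mat) (simp_all add: cs)
  then show "E3 D \<psi> = det_entropy ((1 - c'\<^sup>2) / 4)"
    unfolding E3_def d_def[symmetric] U3_eq by (simp add: c'_def s'_def)
  show "E4 D \<psi> = det_entropy ((1 - overlap2 a b c s 1 0 x y) / 4)"
    unfolding E4_def d_def[symmetric] Let_def entanglement_E4_state[OF adm(1)] a_def b_def c_def s_def x_def y_def ..
  show "E5 D \<psi> = det_entropy ((a * b)\<^sup>2 * E5_factor c s x y)"
    unfolding E5_def d_def[symmetric] Let_def entanglement_E5_state[OF adm(1)] a_def b_def c_def s_def x_def y_def ..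
  have "entanglement \<psi> = entanglement (decomposed_state d)"
    using entanglement_LU[OF adm(2)] assms(11) by (simp add: truly_tripartite_entangled_def)
  also have "\<dots> = det_entropy ((1 - overlap2 a b c s c' s' x y) / 4)"
    unfolding decomposed_state_eq decomposition_pencil_def
    using entanglement_param_pencil(1)[OF cs ab] by (simp add: a_def b_def c_def s_def c'_def s'_def x_def y_def)
  finally have ent: "entanglement \<psi> = det_entropy ((1 - overlap2 a b c s c' s' x y) / 4)" .
  let ?o = "overlap2 a b c s c' s' x y" and ?o' = "overlap2 a (- b) c s c' s' x y"
  have o: "?o \<le> 1" "?o' \<le> 1" "0 \<le> ?o" "0 \<le> ?o'"
    using entanglement_param_pencil(2)[OF cs ab] entanglement_param_pencil(2)[OF cs, of a "- b"] ab by (simp_all add: overlap2_nonneg)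
  \<comment> \<open>One of the at most two entropies is that of \<psi>. A larger overlap means a
    smaller entropy, so the comparison reverses in the next step.\<close>
  have "entanglement \<psi> = Min (entanglement ` S_set d) \<longleftrightarrow> det_entropy ((1 - ?o) / 4) \<le> det_entropy ((1 - ?o') / 4)"
    using entanglement_S_set[of d] ab unfolding ent by (simp add: a_def b_def c_def s_def c'_def s'_def x_def y_def min_def)
  also have "\<dots> \<longleftrightarrow> ?o' \<le> ?o" using o by (subst det_entropy_le_iff) auto
  finally show "E6 D \<psi> = (if 0 \<le> a * b * (c * c') * (s * s') * (Re x * Re y) then 0 else 1)"
    unfolding E6_def d_def[symmetric] overlap2_sign_le_iff by simp
qed

subsection \<open>Classification\<close>

lemma unit_same_Re:
  assumes "cmod x = 1" "cmod X = 1" "(Re x)\<^sup>2 = (Re X)\<^sup>2"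
  shows "X = x \<or> X = cnj x \<or> X = - x \<or> X = - cnj x"
proof -
  have "(Im x)\<^sup>2 = (Im X)\<^sup>2" using unit_parts[OF assms(1)] unit_parts[OF assms(2)] assms(3) by linarith
  then show ?thesis using assms(3) by (auto simp: power2_eq_iff complex_eq_iff)
qed

text \<open>A vanishing \<open>c\<close> or \<open>s\<close> removes one phase from the slice, and a
  vanishing \<open>c'\<close> or \<open>s'\<close> leaves one phase off the diagonal only, where it
  is gauge. In each case the relative sign of \<open>x\<close> and \<open>y\<close> is lost.\<close>

lemma param_pencil_negate_x:
  assumes "c * c' * (s * s') = 0" "cmod x = 1" "cmod y = 1"
  shows "LU_equivalent (param_pencil a b c s c' s' x y) (param_pencil a b c s c' s' (- x) y)"
proof -
  have "cmod (- x) = 1" "cmod (- y) = 1" using assms by simp_all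
  note sx = param_pencil_shift_x[OF assms(2) this(1)] and sy = param_pencil_shift_y[OF this(2) assms(3)]
  consider "c = 0" | "c' = 0" | "s = 0" | "s' = 0" using assms by auto
  then show ?thesis
  proof cases
    case 1
    then have "param_pencil a b c s c' s' (- x) y = param_pencil a b c s c' s' x y" by (simp add: param_pencil_def param_slice_def)
    then show ?thesis by (simp add: LU_refl)
  next
    case 2 then show ?thesis using sx by simp
  next
    case 3
    then have "param_pencil a b c s c' s' (- x) y = param_pencil a b c s c' s' (- x) (- y)" by (simp add: param_pencil_def param_slice_def)
    then show ?thesis by (simp add: param_pencil_neg)
  next
    case 4 then show ?thesis using LU_trans[OF param_pencil_neg sy] by simp
  qed
qed

text \<open>The real parts leave sixteen sign and conjugation patterns. Exchanging the slices
  conjugates \<open>x\<close>, combining this with complex conjugation conjugates \<open>y\<close>,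
  and a sign on qubit 1 negates both; only a relative sign remains to be dealt with.\<close>

lemma param_pencil_equivalent_or_conjugate:
  assumes cs: "c\<^sup>2 + s\<^sup>2 = 1" "c'\<^sup>2 + s'\<^sup>2 = 1" "cmod x = 1" "cmod y = 1" "cmod X = 1" "cmod Y = 1"
    and Re: "(Re x)\<^sup>2 = (Re X)\<^sup>2" "(Re y)\<^sup>2 = (Re Y)\<^sup>2"
    and sign: "c * c' * (s * s') \<noteq> 0 \<Longrightarrow> 0 \<le> Re x * Re y \<longleftrightarrow> 0 \<le> Re X * Re Y"
  shows "LU_equivalent (param_pencil a b c s c' s' x y) (param_pencil a b c s c' s' X Y) \<or>
     LU_equivalent (param_pencil a b c s c' s' (cnj x) (cnj y)) (param_pencil a b c s c' s' X Y)"
proof -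
  let ?p = "param_pencil a b c s c' s'"
  let ?T = "\<lambda>X Y. LU_equivalent (?p x y) (?p X Y) \<or> LU_equivalent (?p (cnj x) (cnj y)) (?p X Y)"
  have xyc: "cmod (cnj x) = 1" "cmod (cnj y) = 1" using cs by simp_all
  have same: "?T X Y" if "X = x \<or> X = cnj x" "Y = y \<or> Y = cnj y" for X Y
    using that LU_refl param_pencil_swap_LU[OF cs(1-4)] param_pencil_swap_LU[OF cs(1,2) xyc] by auto
  have T: "?T X Y" if "?T X' Y'" "LU_equivalent (?p X' Y') (?p X Y)" for X Y X' Y'
    using that LU_trans by blast
  have both: "?T X Y" if "X = - x \<or> X = - cnj x" "Y = - y \<or> Y = - cnj y" for X Y
  proof (rule T)
    show "?T (- X) (- Y)" by (rule same) (use that in auto)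
    show "LU_equivalent (?p (- X) (- Y)) (?p X Y)" using param_pencil_neg[of a b c s c' s' "- X" "- Y"] by simp
  qed
  have mixed: "?T X Y" if m: "(X = - x \<or> X = - cnj x) \<and> (Y = y \<or> Y = cnj y) \<or> (X = x \<or> X = cnj x) \<and> (Y = - y \<or> Y = - cnj y)"
  proof (cases "c * c' * (s * s') = 0")
    case True
    have "?T (- X) Y" using m same[of "- X" Y] both[of "- X" Y] by auto
    moreover have "LU_equivalent (?p (- X) Y) (?p X Y)"
      using param_pencil_negate_x[OF True, of "- X" Y] cs by simp
    ultimately show ?thesis by (rule T)
  next
    case False
    \<comment> \<open>A relative sign reverses the product, so the sign condition forces it to
      vanish. Then one phase is purely imaginary, and negating it amounts to conjugating it.\<close>
    have "Re X * Re Y = - (Re x * Re y)" using m by auto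
    then have "Re X * Re Y = 0" using sign[OF False] by (cases "0 \<le> Re x * Re y") linarith+
    then consider "Re X = 0" | "Re Y = 0" by auto
    then show ?thesis
    proof cases
      case 1
      then have "X = - cnj X" by (simp add: complex_eq_iff)
      then show ?thesis using m same[of X Y] both[of X Y]
        by (metis complex_cnj_cnj complex_cnj_minus minus_minus)
    next
      case 2
      then have "Y = - cnj Y" by (simp add: complex_eq_iff)
      then show ?thesis using m same[of X Y] both[of X Y]
        by (metis complex_cnj_cnj complex_cnj_minus minus_minus)
    qed
  qed
  show ?thesis
    using unit_same_Re[OF cs(3,5) Re(1)] unit_same_Re[OF cs(4,6) Re(2)] same[of X Y] both[of X Y] mixed by blast
qed

lemma measures_determine_param_pencil:
  assumes cs: "c\<^sup>2 + s\<^sup>2 = 1" "c'\<^sup>2 + s'\<^sup>2 = 1" "cmod x = 1" "cmod y = 1"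
    and CS: "C\<^sup>2 + S\<^sup>2 = 1" "C'\<^sup>2 + S'\<^sup>2 = 1" "cmod X = 1" "cmod Y = 1"
    and nn: "0 \<le> c" "0 \<le> s" "0 \<le> c'" "0 \<le> s'" "0 \<le> C" "0 \<le> S" "0 \<le> C'" "0 \<le> S'"
    and ab: "b \<le> a" "0 \<le> b" "a\<^sup>2 + b\<^sup>2 = 1"
    and AB: "B \<le> A" "0 \<le> B" "A\<^sup>2 + B\<^sup>2 = 1"
    and max: "a = b \<Longrightarrow> c' = 1 \<and> s' = 0"
    and m1: "(a * b)\<^sup>2 = (A * B)\<^sup>2"
    and m2: "(c * Re x)\<^sup>2 = (C * Re X)\<^sup>2"
    and m3: "c'\<^sup>2 = C'\<^sup>2"
    and m4: "overlap2 a b c s 1 0 x y = overlap2 A B C S 1 0 X Y"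
    and m5: "(a * b)\<^sup>2 * E5_factor c s x y = (A * B)\<^sup>2 * E5_factor C S X Y"
    and m6: "0 \<le> a * b * (c * c') * (s * s') * (Re x * Re y) \<longleftrightarrow> 0 \<le> A * B * (C * C') * (S * S') * (Re X * Re Y)"
  shows "LU_equivalent (param_pencil a b c s c' s' x y) (param_pencil A B C S C' S' X Y) \<or>
     LU_equivalent (param_pencil a b c s c' s' (cnj x) (cnj y)) (param_pencil A B C S C' S' X Y)"
proof -
  have "a * b = A * B" using m1 ab AB by (simp add: power2_eq_iff_nonneg)
  then have eq: "A = a" "B = b" using ordered_pair_determined[OF ab AB] by simp_all
  have c': "C' = c'" using m3 nn by (simp add: power2_eq_iff_nonneg)
  then have "S'\<^sup>2 = s'\<^sup>2" using cs(2) CS(2) by simp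
  then have s': "S' = s'" using nn by (simp add: power2_eq_iff_nonneg)
  \<comment> \<open>At the extremes the measures lose parameters that are also immaterial:
    \<open>b = 0\<close> needs only \<open>c\<close> and \<open>c'\<close>, and \<open>a = b\<close>
    only \<open>c * Re x\<close>.\<close>
  consider "b = 0" | "a = b" | "0 < b" "b < a" using ab by fastforce
  then show ?thesis
  proof cases
    case 2
    then show ?thesis using max param_pencil_maximal_LU[OF cs(1,3,4) CS(1,3,4) m2] by (simp add: eq c' s')
  next
    case 1
    have "c\<^sup>2 = C\<^sup>2"
    proof -
      have "overlap2 a b k l 1 0 z w = k\<^sup>2" if "cmod z = 1" for k l z w
      proof -
        have "overlap2 a b k l 1 0 z w = k\<^sup>2 * ((Re z)\<^sup>2 + (Im z)\<^sup>2)"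
          using ab(3) by (simp add: overlap2_def 1 power_mult_distrib algebra_simps)
        then show ?thesis by (simp add: unit_parts[OF that])
      qed
      then show ?thesis using m4 cs CS unfolding eq by metis
    qed
    then have c: "C = c" using nn by (simp add: power2_eq_iff_nonneg)
    then have "S\<^sup>2 = s\<^sup>2" using cs(1) CS(1) by simp
    then have s: "S = s" using nn by (simp add: power2_eq_iff_nonneg)
    show ?thesis unfolding eq c s c' s' 1 using param_pencil_product_seed cs CS by blast
  next
    case 3
    have k: "a\<^sup>2 - b\<^sup>2 \<noteq> 0" using 3 by (simp add: power2_eq_iff)
    \<comment> \<open>Removing from \<open>E4\<close> the part known from \<open>E2\<close> isolates
      \<open>c * Im x\<close>; the sum of both squares then frees \<open>c\<close> from the
      phase.\<close>
    have "(a\<^sup>2 - b\<^sup>2)\<^sup>2 * (c * Im x)\<^sup>2 = (a\<^sup>2 - b\<^sup>2)\<^sup>2 * (C * Im X)\<^sup>2"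
      using m4 m2 unfolding overlap2_def eq by (simp add: power_mult_distrib mult_ac)
    then have im: "c\<^sup>2 * (Im x)\<^sup>2 = C\<^sup>2 * (Im X)\<^sup>2" using k by (simp add: power_mult_distrib)
    have re: "c\<^sup>2 * (Re x)\<^sup>2 = C\<^sup>2 * (Re X)\<^sup>2" using m2 by (simp add: power_mult_distrib)
    have "c\<^sup>2 * ((Re x)\<^sup>2 + (Im x)\<^sup>2) = C\<^sup>2 * ((Re X)\<^sup>2 + (Im X)\<^sup>2)" using im re by (simp add: distrib_left)
    then have "c\<^sup>2 = C\<^sup>2" by (simp add: unit_parts cs CS)
    then have c: "C = c" using nn by (simp add: power2_eq_iff_nonneg)
    then have "S\<^sup>2 = s\<^sup>2" using cs(1) CS(1) by simp
    then have s: "S = s" using nn by (simp add: power2_eq_iff_nonneg)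
    have "E5_factor c s x y = E5_factor c s X Y" using m5 3 by (simp add: eq c s)
    then have rey: "s\<^sup>2 * (Re y)\<^sup>2 = s\<^sup>2 * (Re Y)\<^sup>2" using im by (simp add: E5_factor_def c)
    \<comment> \<open>When \<open>c\<close> or \<open>s\<close> vanishes, the corresponding phase is
      undetermined but absent from the slice, so it may be replaced.\<close>
    define X' where "X' = (if c = 0 then x else X)"
    define Y' where "Y' = (if s = 0 then y else Y)"
    have E: "param_pencil A B C S C' S' X Y = param_pencil a b c s c' s' X' Y'"
      unfolding eq c s c' s' X'_def Y'_def by (simp add: param_pencil_def param_slice_def)
    have u: "cmod X' = 1" "cmod Y' = 1" using cs CS by (simp_all add: X'_def Y'_def)
    have sg: "0 \<le> Re x * Re y \<longleftrightarrow> 0 \<le> Re X' * Re Y'" if "c * c' * (s * s') \<noteq> 0"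
    proof -
      have "0 < a * b * (c * c') * (s * s')" using that nn 3 by (simp add: mult_less_0_iff zero_less_mult_iff)
      then have "0 \<le> a * b * (c * c') * (s * s') * t \<longleftrightarrow> 0 \<le> t" for t
        by (metis mult_nonneg_nonneg order_less_imp_le zero_le_mult_iff linorder_not_less)
      then show ?thesis using m6 that unfolding eq c s c' s' X'_def Y'_def by auto
    qed
    have R: "(Re x)\<^sup>2 = (Re X')\<^sup>2" "(Re y)\<^sup>2 = (Re Y')\<^sup>2"
      using re rey by (auto simp: X'_def Y'_def c)
    show ?thesis unfolding E by (rule param_pencil_equivalent_or_conjugate[OF cs u R sg])
  qed
qed

section \<open>Conjugation and independence of the choice\<close>

text \<open>Exchanging the slices already conjugates \<open>x\<close>; it remains to conjugate
  \<open>y\<close>, which works when \<open>y\<close> is absent, gauge or real. For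
  \<open>b > 0\<close> the condition is complementary to the assumption \<open>nz\<close> of
  \<open>better_decomposition\<close>.\<close>

lemma param_pencil_self_conjugate:
  assumes "c\<^sup>2 + s\<^sup>2 = 1" "c'\<^sup>2 + s'\<^sup>2 = 1" "cmod x = 1" "cmod y = 1" "b = 0 \<or> s * s' * Im y = 0"
  shows "LU_equivalent (param_pencil a b c s c' s' x y) (param_pencil a b c s c' s' (cnj x) (cnj y))"
proof -
  have u: "cmod (cnj x) = 1" "cmod (cnj y) = 1" using assms by simp_all
  note sw = param_pencil_swap_LU[OF assms(1-4)]
  consider "b = 0" | "s = 0" | "s' = 0" | "Im y = 0" using assms by auto
  then show ?thesis
  proof cases
    case 1 then show ?thesis using param_pencil_product_seed assms u by simp
  next
    case 2
    then have "param_pencil a b c s c' s' (cnj x) (cnj y) = param_pencil a b c s c' s' (cnj x) y" by (simp add: param_pencil_def param_slice_def)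
    then show ?thesis using sw by simp
  next
    case 3
    have "LU_equivalent (param_pencil a b c s c' s' (cnj x) y) (param_pencil a b c s c' s' (cnj x) (cnj y))"
      using param_pencil_shift_y assms u by (simp add: 3)
    then show ?thesis using LU_trans[OF sw] by blast
  next
    case 4
    then have "cnj y = y" by (simp add: complex_eq_iff)
    then show ?thesis using sw by simp
  qed
qed

lemma conj_decomposed: "conj_state (decomposed_state d) = (1 / sqrt 2) *\<^sub>R
   param_pencil (coeff_a d) (coeff_b d) (cosb d) (sinb d) (cosb' d) (sinb' d) (cnj (phase_x d)) (cnj (phase_y d))"
  by (simp only: decomposed_state_eq conj_state_scaleR decomposition_pencil_def conj_state_param_pencil)

lemma conj_conj_state [simp]: "conj_state (conj_state \<psi>) = \<psi>"
  by (simp add: vec_eq_iff conj_state_def)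

text \<open>The conjugate of a decomposition becomes, after renormalising its angles, a
  decomposition in the conjugate class with the same seed, and maximality applies there. Used both
  ways, this shows that conjugate classes have the same maximal seed.\<close>

lemma conj_class_seed_le:
  assumes D: "admissible_choice D" "truly_tripartite_entangled \<psi>" "truly_tripartite_entangled \<phi>"
    and LU: "LU_equivalent (conj_state \<psi>) \<phi>"
  shows "(coeff_a (D (LU_class \<psi>)) * coeff_b (D (LU_class \<psi>)))\<^sup>2 \<le> (coeff_a (D (LU_class \<phi>)) * coeff_b (D (LU_class \<phi>)))\<^sup>2"
proof -
  define d where "d = D (LU_class \<psi>)"
  note ad = admissibleD(1,2)[OF D(1,2), folded d_def]
  obtain e where e: "valid_parameters e" "coeff_a e = coeff_a d" "coeff_b e = coeff_b d"
    "LU_equivalent (param_pencil (coeff_a d) (coeff_b d) (cosb d) (sinb d) (cosb' d) (sinb' d) (cnj (phase_x d)) (cnj (phase_y d))) (decomposition_pencil e)"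
    by (rule param_pencil_to_decomposition[of "coeff_b d" "coeff_a d" "cosb d" "sinb d" "cosb' d" "sinb' d" "cnj (phase_x d)" "cnj (phase_y d)"])
      (use valid_parametersD[OF ad(1)] in simp_all)
  have "LU_equivalent (conj_state (decomposed_state d)) (decomposed_state e)"
    unfolding conj_decomposed unfolding decomposed_state_eq using e(4) by (rule LU_scaleR)
  then have "LU_equivalent \<phi> (decomposed_state e)"
    using LU_sym[OF LU] LU_conj[OF ad(2)] LU_trans by blast
  from admissibleD(3)[OF D(1,3) e(1) this] show ?thesis by (simp add: e d_def)
qed

text \<open>The decompositions chosen for the two classes are compared through uniqueness of the
  parameters. Where uniqueness fails, either the classes coincide, which is the first alternative,
  or maximality of the seed is violated.\<close>

lemma measures_conj:
  assumes D: "admissible_choice D" "truly_tripartite_entangled \<psi>" "truly_tripartite_entangled \<phi>"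
    and LU: "LU_equivalent (conj_state \<psi>) \<phi>"
  shows "LU_equivalent \<psi> \<phi> \<or> E1 D \<psi> = E1 D \<phi> \<and> E2 D \<psi> = E2 D \<phi> \<and> E3 D \<psi> = E3 D \<phi> \<and>
          E4 D \<psi> = E4 D \<phi> \<and> E5 D \<psi> = E5 D \<phi> \<and> E6 D \<psi> = E6 D \<phi>"
proof -
  define d where "d = D (LU_class \<psi>)"
  define e where "e = D (LU_class \<phi>)"
  note ad = admissibleD[OF D(1,2), folded d_def] and ae = admissibleD[OF D(1,3), folded e_def]
  note vd = valid_parametersD[OF ad(1)] and ve = valid_parametersD[OF ae(1)]
  note md = measures_eq[OF D(1,2), folded d_def] and me = measures_eq[OF D(1,3), folded e_def]
  have "LU_equivalent (conj_state \<phi>) \<psi>" using LU_sym[OF LU_conj[OF LU]] by simp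
  then have sq: "(coeff_a d * coeff_b d)\<^sup>2 = (coeff_a e * coeff_b e)\<^sup>2"
    using conj_class_seed_le[OF D LU] conj_class_seed_le[OF D(1,3,2)] by (simp add: d_def e_def order_antisym)
  then have "coeff_a d * coeff_b d = coeff_a e * coeff_b e"
    using vd ve by (simp add: power2_eq_iff_nonneg)
  then have eq: "coeff_a e = coeff_a d" "coeff_b e = coeff_b d"
    using ordered_pair_determined[OF vd(1-3) ve(1-3)] by simp_all
  have "LU_equivalent (conj_state (decomposed_state d)) (decomposed_state e)"
    using LU_sym[OF LU_conj[OF ad(2)]] LU ae(2) LU_trans by blast
  then have LUde: "LU_equivalent (param_pencil (coeff_a d) (coeff_b d) (cosb d) (sinb d) (cosb' d) (sinb' d) (cnj (phase_x d)) (cnj (phase_y d)))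
      (param_pencil (coeff_a d) (coeff_b d) (cosb e) (sinb e) (cosb' e) (sinb' e) (phase_x e) (phase_y e))"
    unfolding conj_decomposed unfolding decomposed_state_eq decomposition_pencil_def eq by (simp add: LU_scaleR_iff)
  show ?thesis
  proof (cases "coeff_b d = 0 \<or> sinb d * sinb' d * Im (phase_y d) = 0")
    case True
    have "LU_equivalent (decomposed_state d) (conj_state (decomposed_state d))"
      unfolding conj_decomposed unfolding decomposed_state_eq decomposition_pencil_def
      by (rule LU_scaleR, rule param_pencil_self_conjugate) (use True in simp_all)
    then have "LU_equivalent \<psi> (conj_state (decomposed_state d))" using ad(2) LU_trans by blast
    then have "LU_equivalent \<psi> \<phi>" using LU_sym[OF LU_conj[OF ad(2)]] LU LU_trans by blast
    then show ?thesis ..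
  next
    case False
    then have b: "0 < coeff_b d" using vd by simp
    \<comment> \<open>By convention (ii) a maximally entangled seed has
      \<open>ang_beta' d = 0\<close>, which would make \<open>sinb' d\<close> vanish.\<close>
    have "coeff_a d \<noteq> coeff_b d" using False ad(4) by auto
    then have ba: "coeff_b d < coeff_a d" using vd by simp
    let ?x = "phase_x d" and ?y = "phase_y d" and ?X = "phase_x e" and ?Y = "phase_y e"
    have gen: "cosb d * cosb' d * Im ?x \<noteq> 0 \<and> 2 * coeff_a d * coeff_b d * cosb d * cosb' d * Re ?x + sinb d * sinb' d * Re ?y \<noteq> 0"
    proof (rule ccontr)
      assume "\<not> ?thesis"
      then have deg: "cosb d * cosb' d * Im ?x = 0 \<or> 2 * coeff_a d * coeff_b d * cosb d * cosb' d * Re ?x + sinb d * sinb' d * Re ?y = 0"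
        by blast
      have cs: "(cosb d)\<^sup>2 + (sinb d)\<^sup>2 = 1" "(cosb' d)\<^sup>2 + (sinb' d)\<^sup>2 = 1" by simp_all
      have nz: "sinb d * sinb' d * Im ?y \<noteq> 0" using False by blast
      obtain d' where d': "valid_parameters d'" "LU_equivalent (decomposition_pencil d) (decomposition_pencil d')"
          "coeff_a d * coeff_b d < coeff_a d' * coeff_b d'"
        unfolding decomposition_pencil_def[of d] by (rule better_decomposition[OF cs norm_cis norm_cis vd(3) b ba nz deg])
      have "LU_equivalent \<psi> (decomposed_state d')"
        by (rule LU_trans[OF ad(2)]) (simp add: LU_decomposed_iff d'(2))
      then have "(coeff_a d' * coeff_b d')\<^sup>2 \<le> (coeff_a d * coeff_b d)\<^sup>2" by (rule ad(3)[OF d'(1)])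
      moreover have "0 \<le> coeff_a d * coeff_b d" using vd by simp
      ultimately show False using d'(3) power_strict_mono[of "coeff_a d * coeff_b d" "coeff_a d' * coeff_b d'" 2] by simp
    qed
    have "cosb e = cosb d \<and> cosb' e = cosb' d \<and> (Re ?X)\<^sup>2 = (Re (cnj ?x))\<^sup>2 \<and> (Im ?Y)\<^sup>2 = (Im (cnj ?y))\<^sup>2 \<and>
        Re ?X * Re ?Y = Re (cnj ?x) * Re (cnj ?y)"
    proof (rule generic_parameters_unique[OF LUde])
      show "cosb d * cosb' d * Im (cnj ?x) \<noteq> 0" using gen by (simp only: cnj.sel) simp
      show "sinb d * sinb' d \<noteq> 0" using False by auto
      show "2 * coeff_a d * coeff_b d * cosb d * cosb' d * Re (cnj ?x) + sinb d * sinb' d * Re (cnj ?y) \<noteq> 0"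
        using gen by (simp only: cnj.sel simp_thms)
    qed (use vd ve b ba in \<open>simp_all only: complex_mod_cnj norm_cis sin_cos_squared_add2\<close>)
    then have p: "cosb e = cosb d" "cosb' e = cosb' d" "(Re ?X)\<^sup>2 = (Re ?x)\<^sup>2" "(Im ?Y)\<^sup>2 = (Im ?y)\<^sup>2"
        "Re ?X * Re ?Y = Re ?x * Re ?y" by (simp_all only: power2_minus cnj.sel)
    have "(sinb e)\<^sup>2 = (sinb d)\<^sup>2" "(sinb' e)\<^sup>2 = (sinb' d)\<^sup>2" using p(1,2) by (simp_all add: sin_squared_eq)
    then have s: "sinb e = sinb d" "sinb' e = sinb' d" using vd ve by (simp_all add: power2_eq_iff_nonneg)
    have q: "(Im ?X)\<^sup>2 = (Im ?x)\<^sup>2" "(Re ?Y)\<^sup>2 = (Re ?y)\<^sup>2"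
      using p(3,4) unit_parts[OF norm_cis, of "ang_alpha d + ang_gamma d"] unit_parts[OF norm_cis, of "ang_alpha e + ang_gamma e"]
        unit_parts[OF norm_cis, of "ang_alpha d - ang_gamma d"] unit_parts[OF norm_cis, of "ang_alpha e - ang_gamma e"]
      by linarith+
    have "E5_factor (cosb e) (sinb e) ?X ?Y = E5_factor (cosb d) (sinb d) ?x ?y"
      unfolding E5_factor_def by (simp only: p s q)
    moreover have "overlap2 (coeff_a e) (coeff_b e) (cosb e) (sinb e) 1 0 ?X ?Y = overlap2 (coeff_a d) (coeff_b d) (cosb d) (sinb d) 1 0 ?x ?y"
      unfolding overlap2_def mult_zero_right mult_zero_left add_0_right power_mult_distrib by (simp only: p s q eq)
    moreover have "(cosb e * Re ?X)\<^sup>2 = (cosb d * Re ?x)\<^sup>2" unfolding power_mult_distrib by (simp only: p)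
    ultimately show ?thesis by (simp only: md me eq p s simp_thms)
  qed
qed

theorem mainTheorem3:
  fixes D :: "three_qubit set \<Rightarrow> decomposition" and \<psi> \<phi> :: three_qubit
  assumes "admissible_choice D"
    and "truly_tripartite_entangled \<psi>"
    and "truly_tripartite_entangled \<phi>"
  shows "(E1 D \<psi> = E1 D \<phi> \<and> E2 D \<psi> = E2 D \<phi> \<and> E3 D \<psi> = E3 D \<phi> \<and>
          E4 D \<psi> = E4 D \<phi> \<and> E5 D \<psi> = E5 D \<phi> \<and> E6 D \<psi> = E6 D \<phi>) \<longleftrightarrow>
         (LU_equivalent \<psi> \<phi> \<or> LU_equivalent (conj_state \<psi>) \<phi>)"
    (is "?E \<longleftrightarrow> ?L")
proof
  assume ?L
  moreover have ?E if LU: "LU_equivalent \<psi> \<phi>"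
  proof -
    \<comment> \<open>The measures depend on the class alone, except that \<open>E6\<close> contains
      the entanglement of the state itself.\<close>
    have "entanglement \<phi> = entanglement \<psi>"
      using entanglement_LU[OF LU] assms(2) by (simp add: truly_tripartite_entangled_def)
    then show ?E
      unfolding E1_def E2_def E3_def E4_def E5_def E6_def using LU_class_eq[OF LU] by simp
  qed
  ultimately show ?E using measures_conj[OF assms] by blast
next
  assume E: ?E
  define d where "d = D (LU_class \<psi>)"
  define e where "e = D (LU_class \<phi>)"
  note ad = admissibleD[OF assms(1,2), folded d_def] and ae = admissibleD[OF assms(1,3), folded e_def]
  note vd = valid_parametersD[OF ad(1)] and ve = valid_parametersD[OF ae(1)]
  note md = measures_eq[OF assms(1,2), folded d_def] and me = measures_eq[OF assms(1,3), folded e_def]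
  let ?a = "coeff_a d" and ?b = "coeff_b d" and ?A = "coeff_a e" and ?B = "coeff_b e"
  let ?x = "phase_x d" and ?y = "phase_y d" and ?X = "phase_x e" and ?Y = "phase_y e"
  note pb = product_bounds[OF vd(3)] product_bounds[OF ve(3)]
  have m1: "(?a * ?b)\<^sup>2 = (?A * ?B)\<^sup>2"
    using E det_entropy_eq_iff[OF pb] by (simp only: md(1) me(1))
  have quarter: "(1 - k\<^sup>2) / 4 = (1 - l\<^sup>2) / 4 \<longleftrightarrow> k\<^sup>2 = l\<^sup>2" for k l :: real by auto
  \<comment> \<open>Equal entropies give equal arguments only within the interval from 0 to 1/4, so
    each argument is first confined to it.\<close>
  have bound: "0 \<le> (1 - k\<^sup>2) / 4" "(1 - k\<^sup>2) / 4 \<le> 1 / 4" if "\<bar>k\<bar> \<le> 1" for k :: real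
    using that by (simp_all add: abs_square_le_1)
  have cR: "\<bar>cos t * Re z\<bar> \<le> 1" if "cmod z = 1" for t z
    using abs_cos_le_one[of t] abs_Re_le_cmod[of z] that by (simp add: abs_mult mult_le_one)
  have m2: "(cosb d * Re ?x)\<^sup>2 = (cosb e * Re ?X)\<^sup>2"
  proof -
    have "\<bar>cosb d * Re ?x\<bar> \<le> 1" "\<bar>cosb e * Re ?X\<bar> \<le> 1" by (rule cR, rule norm_cis)+
    then have "(1 - (cosb d * Re ?x)\<^sup>2) / 4 = (1 - (cosb e * Re ?X)\<^sup>2) / 4"
      using E det_entropy_eq_iff[OF bound bound] by (simp only: md(2) me(2))
    then show ?thesis by (simp only: quarter)
  qed
  have m3: "(cosb' d)\<^sup>2 = (cosb' e)\<^sup>2"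
  proof -
    have "(1 - (cosb' d)\<^sup>2) / 4 = (1 - (cosb' e)\<^sup>2) / 4"
      using E det_entropy_eq_iff[OF bound[OF abs_cos_le_one] bound[OF abs_cos_le_one]] by (simp only: md(3) me(3))
    then show ?thesis by (simp only: quarter)
  qed
  let ?o = "overlap2 ?a ?b (cosb d) (sinb d) 1 0 ?x ?y" and ?O = "overlap2 ?A ?B (cosb e) (sinb e) 1 0 ?X ?Y"
  have m4: "?o = ?O"
  proof -
    have "?o \<le> 1" "?O \<le> 1" by (rule entanglement_param_pencil(2); use vd ve in simp)+
    then have "(1 - ?o) / 4 = (1 - ?O) / 4"
      using E overlap2_nonneg unfolding md(4) me(4) by (subst (asm) det_entropy_eq_iff) auto
    then show ?thesis by simp
  qed
  have m5: "(?a * ?b)\<^sup>2 * E5_factor (cosb d) (sinb d) ?x ?y = (?A * ?B)\<^sup>2 * E5_factor (cosb e) (sinb e) ?X ?Y"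
  proof -
    have f: "0 \<le> E5_factor (cos t) (sin t) (cis u) (cis v)" "E5_factor (cos t) (sin t) (cis u) (cis v) \<le> 1" for t u v
      by (rule E5_factor_bounds; simp)+
    have g: "0 \<le> k * E5_factor (cos t) (sin t) (cis u) (cis v)" "k * E5_factor (cos t) (sin t) (cis u) (cis v) \<le> 1 / 4"
      if "0 \<le> k" "k \<le> 1 / 4" for k t u v
      using that f[of t u v] mult_mono[OF that(2) f(2)[of t u v]] by simp_all
    show ?thesis
      using E det_entropy_eq_iff[OF g[OF pb(1,2)] g[OF pb(3,4)]] by (simp only: md(5) me(5))
  qed
  have m6: "0 \<le> ?a * ?b * (cosb d * cosb' d) * (sinb d * sinb' d) * (Re ?x * Re ?y) \<longleftrightarrow>
      0 \<le> ?A * ?B * (cosb e * cosb' e) * (sinb e * sinb' e) * (Re ?X * Re ?Y)"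
  proof -
    have "(if P then 0 else 1 :: real) = (if Q then 0 else 1) \<longleftrightarrow> P = Q" for P Q by simp
    then show ?thesis using E by (simp only: md(6) me(6))
  qed
  have max: "cosb' d = 1 \<and> sinb' d = 0" if "?a = ?b" using ad(4)[OF that] by simp
  have "LU_equivalent (param_pencil ?a ?b (cosb d) (sinb d) (cosb' d) (sinb' d) ?x ?y) (param_pencil ?A ?B (cosb e) (sinb e) (cosb' e) (sinb' e) ?X ?Y) \<or>
     LU_equivalent (param_pencil ?a ?b (cosb d) (sinb d) (cosb' d) (sinb' d) (cnj ?x) (cnj ?y)) (param_pencil ?A ?B (cosb e) (sinb e) (cosb' e) (sinb' e) ?X ?Y)"
    by (rule measures_determine_param_pencil[OF _ _ _ _ _ _ _ _ vd(4-7) ve(4-7) vd(1-3) ve(1-3) max m1 m2 m3 m4 m5 m6]) simp_all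
  moreover have r: "1 / sqrt 2 \<noteq> 0" by simp
  ultimately have "LU_equivalent (decomposed_state d) (decomposed_state e) \<or> LU_equivalent (conj_state (decomposed_state d)) (decomposed_state e)"
    unfolding conj_decomposed unfolding decomposed_state_eq decomposition_pencil_def by (simp only: LU_scaleR_iff[OF r])
  then show ?L
    using LU_trans[OF LU_trans[OF ad(2)] LU_sym[OF ae(2)]] LU_trans[OF LU_trans[OF LU_conj[OF ad(2)]] LU_sym[OF ae(2)]] by blast
qed

end
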